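(* Let $K$ and $L$ be convex discs in $\mathbb{R}^2$ with $C^2_+$ smooth boundary such that $K$ is $L$-convex, and assume that $$\max_{x\in\mathrm{bd}\,L}\kappa_L(x)<1<\min_{y\in\mathrm{bd}\,K}\kappa_K(y).$$ Let $x_1,\dots,x_n$ be i.i.d. uniform random points from $K$ and let $K_{(n)}=[x_1,\dots,x_n]_L$ be the corresponding uniform random $L$-polygon. Then $$\lim_{n\to\infty}\mathbb{E}\big(A(K\setminus K_{(n)})\big)\,n^{\frac23}=\sqrt[3]{\frac{2A^2(K)}{3}}\;\Gamma\left(\frac53\right)\int_{S^1}\frac{\left(\kappa_K(u)-\kappa_L(u)\right)^{\frac13}}{\kappa_K(u)}\,\mathrm{d}u .$$
   Context: A convex disc is a compact convex set in $\mathbb{R}^2$ with non-empty interior. $C^2_+$ smooth boundary means that the boundary is twice continuously differentiable with strictly positive curvature everywhere. $\mathrm{bd}$ denotes boundary, $A(\cdot)$ area (and $A^2(K)=(A(K))^2$), $\mathbb{E}$ expectation, $\Gamma$ Euler's gamma function, $S^1$ the unit circle, and $\mathrm{d}u$ integration with respect to arc length on $S^1$. $K$ is $L$-convex if it equals the intersection of all translates of $L$ that contain $K$. For a set $X$ contained in a translate of $L$, $[X]_L$ denotes the intersection of all translates of $L$ that contain $X$. For a convex disc $M$ with $C^2_+$ boundary, $\kappa_M(x)$ is the curvature of $\mathrm{bd}\,M$ at $x\in\mathrm{bd}\,M$. For $u\in S^1$, $\kappa_M(u)$ denotes the curvature of $\mathrm{bd}\,M$ at the unique boundary point where the outer unit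 normal is $u$. *)

theory Defs
  imports "HOL-Probability.Probability"
begin

definition convex_disc :: "(real^2) set \<Rightarrow> bool" where
  "convex_disc M \<longleftrightarrow> compact M \<and> convex M \<and> interior M \<noteq> {}"

text \<open>
  A regular twice continuously differentiable parametrization of the boundary as a simple
  closed curve, given as a 1-periodic map on the whole real line.
\<close>
definition C2_boundary_param :: "(real^2) set \<Rightarrow> (real \<Rightarrow> real^2) \<Rightarrow> bool" where
  "C2_boundary_param M \<gamma> \<longleftrightarrow>
     \<gamma> C1_differentiable_on UNIV \<and>
     (\<lambda>t. vector_derivative \<gamma> (at t)) C1_differentiable_on UNIV \<and>
     (\<forall>t. vector_derivative \<gamma> (at t) \<noteq> 0) \<and>
     (\<forall>t. \<gamma> (t + 1) = \<gamma> t) \<and>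
     inj_on \<gamma> {0..<1} \<and>
     range \<gamma> = frontier M"

text \<open>
  The absolute value makes the curvature independent of the orientation of the curve; for the
  boundary of a convex disc it agrees with the curvature with respect to the inner normal.
\<close>
definition curve_curvature :: "(real \<Rightarrow> real^2) \<Rightarrow> real \<Rightarrow> real" where
  "curve_curvature \<gamma> t =
     (let v = vector_derivative \<gamma> (at t);
          a = vector_derivative (\<lambda>s. vector_derivative \<gamma> (at s)) (at t)
      in \<bar>v $ 1 * a $ 2 - v $ 2 * a $ 1\<bar> / norm v ^ 3)"

text \<open>
  The curvature is invariant under reparametrization, so the description is well defined whenever
  the boundary has a parametrization as above and \<open>x\<close> lies on it.
\<close>
definition boundary_curvature :: "(real^2) set \<Rightarrow> real^2 \<Rightarrow> real" where
  "boundary_curvature M x =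
     (THE k. \<exists>\<gamma> t. C2_boundary_param M \<gamma> \<and> \<gamma> t = x \<and> k = curve_curvature \<gamma> t)"

definition C2_plus_boundary :: "(real^2) set \<Rightarrow> bool" where
  "C2_plus_boundary M \<longleftrightarrow>
     (\<exists>\<gamma>. C2_boundary_param M \<gamma>) \<and> (\<forall>x\<in>frontier M. boundary_curvature M x > 0)"

definition outer_unit_normal :: "(real^2) set \<Rightarrow> real^2 \<Rightarrow> real^2 \<Rightarrow> bool" where
  "outer_unit_normal M x u \<longleftrightarrow> norm u = 1 \<and> (\<forall>y\<in>M. (y - x) \<bullet> u \<le> 0)"

definition normal_curvature :: "(real^2) set \<Rightarrow> real^2 \<Rightarrow> real" where
  "normal_curvature M u =
     boundary_curvature M (THE x. x \<in> frontier M \<and> outer_unit_normal M x u)"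

text \<open>
  If no translate of \<open>L\<close> contains \<open>X\<close>, the hull is \<open>UNIV\<close>. Hence a bounded \<open>L\<close>-convex set is
  always contained in some translate of \<open>L\<close>.
\<close>
definition L_hull :: "(real^2) set \<Rightarrow> (real^2) set \<Rightarrow> (real^2) set" where
  "L_hull L X = \<Inter>{T. (\<exists>v. T = (+) v ` L) \<and> X \<subseteq> T}"

definition L_convex :: "(real^2) set \<Rightarrow> (real^2) set \<Rightarrow> bool" where
  "L_convex L K \<longleftrightarrow> K = L_hull L K"

abbreviation area :: "(real^2) set \<Rightarrow> real" where
  "area \<equiv> measure lborel"

text \<open>Integration over the unit circle with respect to arc length.\<close>
definition circle_integral :: "(real^2 \<Rightarrow> real) \<Rightarrow> real" where
  "circle_integral f = (LBINT \<theta>:{0..2 * pi}. f (vector [cos \<theta>, sin \<theta>]))"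

end

theory Submission
  imports Defs
begin

text \<open>
  A point \<open>y\<close> of \<open>K\<close> is missed by the \<open>L\<close>-hull of the sample iff some translate of \<open>L\<close> contains the
  sample and has \<open>y\<close> on its boundary. Rotating such a translate around \<open>y\<close> until it touches a sample
  point \<open>x\<close> singles out, almost surely, a unique \<open>x\<close> such that the translate of \<open>L\<close> with the chord
  from \<open>y\<close> to \<open>x\<close> contains all the other sample points. Hence the expected missing area is
  \<open>n / A(K)\<close> times the integral over \<open>x, y \<in> K\<close> of the \<open>(n - 1)\<close>-st power of the probability that a
  random point falls into that translate. Parametrize \<open>x - y\<close> in polar coordinates \<open>r\<close>, \<open>t + \<pi>/2\<close> and
  \<open>y\<close> in the moving frame of \<open>bd K\<close> at the point with outer normal \<open>t\<close>. At the scale \<open>n\<^sup>-\<^sup>1\<^sup>/\<^sup>3\<close> along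
  the tangent and \<open>n\<^sup>-\<^sup>2\<^sup>/\<^sup>3\<close> along the normal both boundaries become parabolas, and the part of \<open>K\<close>
  outside the translate becomes a parabolic cap whose area is an explicit multiple of the
  power \<open>3/2\<close> of its height. Comparison with inscribed and circumscribed circles dominates the integrand, so
  the limit may be taken under the integral, which then reduces to a Gamma integral.
\<close>

section \<open>Curvature of the boundary\<close>

text \<open>The curvature hypothesis is used in the form of two rolling discs: \<open>K\<close> fits
  into a disc of radius \<open>\<rho>\<close> touching at any of its boundary points, and a disc of
  radius \<open>R > \<rho>\<close> fits into \<open>L\<close> likewise. Hence differences of points
  of \<open>K\<close> are shorter than \<open>2 * R\<close>, which makes the certifying chord of
  \<open>L\<close> exist. The radii of curvature are merely continuous, so no Taylor remainder is
  available: second order behaviour is obtained by squeezing a boundary between circles slightly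
  larger and slightly smaller than the osculating one. A certificate involves one sample point
  instead of an edge with two, so only one variable has to be conditioned on. With
  \<open>d = n powr (- 1 / 3)\<close>, the point \<open>y\<close> contributes a Jacobian
  \<open>d ^ 3\<close> and the vector \<open>x - y\<close> a factor \<open>d ^ 2\<close>; together
  with the prefactor \<open>n\<close> this is \<open>n powr (- 2 / 3)\<close>. Subtracting the
  parabola of \<open>L\<close> from that of \<open>K\<close> leaves a parabola of curvature
  \<open>\<kappa> - \<mu>\<close>, the origin of the difference in the limit.\<close>

definition nu :: "real \<Rightarrow> real^2" where "nu t = vector [cos t, sin t]"
text \<open>The derivative of \<open>nu\<close>. Vectors are written as multiples of
  \<open>tau t\<close>, so that a chord in that direction is parallel to the tangent at outer normal
  \<open>nu t\<close>.\<close>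

definition tau :: "real \<Rightarrow> real^2" where "tau t = vector [- sin t, cos t]"

lemma nu_nth [simp]: "nu t $ 1 = cos t" "nu t $ 2 = sin t"
  and tau_nth [simp]: "tau t $ 1 = - sin t" "tau t $ 2 = cos t"
  by (simp_all add: nu_def tau_def)

lemma inner_real2: "x \<bullet> y = x $ 1 * y $ 1 + x $ 2 * y $ 2" for x y :: "real^2"
  by (simp add: inner_vec_def sum_2)

lemma frame_inner [simp]:
  "nu s \<bullet> nu t = cos (s - t)" "tau s \<bullet> tau t = cos (s - t)"
  "tau s \<bullet> nu t = sin (t - s)" "nu s \<bullet> tau t = sin (s - t)"
  by (simp_all add: inner_real2 cos_diff sin_diff algebra_simps)

lemma frame_norm [simp]: "norm (nu t) = 1" "norm (tau t) = 1"
  by (simp_all add: norm_eq_sqrt_inner)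

lemma frame_nonzero [simp]: "nu t \<noteq> 0" "tau t \<noteq> 0"
  by (metis frame_norm norm_zero zero_neq_one)+

lemma frame_periodic [simp]: "nu (t + 2 * pi) = nu t" "tau (t + 2 * pi) = tau t"
  by (simp_all add: vec_eq_iff forall_2)

lemma frame_expand: "x = (x \<bullet> tau t) *\<^sub>R tau t + (x \<bullet> nu t) *\<^sub>R nu t"
proof -
  have *: "cos t * (cos t * z) + sin t * (sin t * z) = z" for z
    using sin_cos_squared_add3[of t] by (metis distrib_right mult.assoc mult_1)
  show ?thesis
    by (simp add: vec_eq_iff forall_2 inner_real2 algebra_simps *)
qed

lemma frame_eqI: "x \<bullet> tau t = y \<bullet> tau t \<Longrightarrow> x \<bullet> nu t = y \<bullet> nu t \<Longrightarrow> x = y"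
  by (metis frame_expand)

lemma frame_inner_sum: "x \<bullet> y = (x \<bullet> tau t) * (y \<bullet> tau t) + (x \<bullet> nu t) * (y \<bullet> nu t)"
proof -
  have "x \<bullet> y = ((x \<bullet> tau t) *\<^sub>R tau t + (x \<bullet> nu t) *\<^sub>R nu t) \<bullet> y"
    using frame_expand[of x t] by presburger
  then show ?thesis
    by (simp add: inner_add_left inner_commute[of "tau t" y] inner_commute[of "nu t" y])
qed

lemma frame_norm_sq: "(norm x)\<^sup>2 = (x \<bullet> tau t)\<^sup>2 + (x \<bullet> nu t)\<^sup>2"
  using frame_inner_sum[of x x t] by (simp add: dot_square_norm power2_eq_square)

lemma unit_eq_nu:
  assumes "norm (u::real^2) = 1" obtains t where "0 \<le> t" "t < 2 * pi" "u = nu t"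
proof -
  have "(u $ 1)\<^sup>2 + (u $ 2)\<^sup>2 = 1"
    using assms by (simp add: norm_eq_sqrt_inner inner_real2 power2_eq_square)
  then obtain t where "0 \<le> t" "t < 2 * pi" "u $ 1 = cos t" "u $ 2 = sin t"
    using sincos_total_2pi by metis
  then show ?thesis
    using that[of t] by (simp add: vec_eq_iff forall_2)
qed

lemma polar_tau: obtains t where "w = norm w *\<^sub>R tau t"
proof (cases "w = 0")
  case False
  then obtain s where s: "w /\<^sub>R norm w = nu s"
    using unit_eq_nu[of "w /\<^sub>R norm w"] by auto
  have "tau (s - pi / 2) = nu s"
    by (simp add: vec_eq_iff forall_2 sin_diff cos_diff)
  then have "w = norm w *\<^sub>R tau (s - pi / 2)"
    using s False by (metis divideR_right norm_eq_zero)
  then show ?thesis by (rule that)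
qed (use that in auto)

lemma nu_has_vector_derivative: "(nu has_vector_derivative tau t) (at t within S)"
proof -
  have "((\<lambda>t. cos t *\<^sub>R axis 1 1 + sin t *\<^sub>R axis 2 1 :: real^2) has_vector_derivative
      (- sin t) *\<^sub>R axis 1 1 + cos t *\<^sub>R axis 2 1) (at t within S)"
    by (auto intro!: derivative_eq_intros)
  moreover have "(\<lambda>t. cos t *\<^sub>R axis 1 1 + sin t *\<^sub>R axis 2 1) = nu"
    by (rule ext) (simp add: vec_eq_iff forall_2 axis_def)
  moreover have "(- sin t) *\<^sub>R axis 1 1 + cos t *\<^sub>R axis 2 1 = tau t"
    by (simp add: vec_eq_iff forall_2 axis_def)
  ultimately show ?thesis by (simp only:)
qed

lemma tau_eq_nu: "tau t = nu (t + pi / 2)"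
  by (simp add: vec_eq_iff forall_2 sin_add cos_add)

lemma nu_continuous: "continuous_on S nu"
  by (rule continuous_on_vector_derivative[OF nu_has_vector_derivative])

lemma tau_has_vector_derivative: "(tau has_vector_derivative - nu t) (at t within S)"
proof -
  have "((\<lambda>t. t + pi / 2) has_vector_derivative 1) (at t within S)"
    by (simp add: has_real_derivative_iff_has_vector_derivative[symmetric]) (auto intro!: derivative_eq_intros)
  from vector_diff_chain_within[OF this nu_has_vector_derivative]
  have "((\<lambda>t. nu (t + pi / 2)) has_vector_derivative tau (t + pi / 2)) (at t within S)"
    by (simp add: o_def)
  moreover have "tau (t + pi / 2) = - nu t"
    by (simp add: vec_eq_iff forall_2 sin_add cos_add)
  moreover have "(\<lambda>t. nu (t + pi / 2)) = tau"
    by (simp add: tau_eq_nu fun_eq_iff)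
  ultimately show ?thesis by (simp only:)
qed

lemma tau_continuous: "continuous_on S tau"
  by (rule continuous_on_vector_derivative[OF tau_has_vector_derivative])

section \<open>Derivatives along curves and second order contact\<close>

lemma has_real_derivative_inner:
  assumes "(f has_vector_derivative f') (at t within S)" "(g has_vector_derivative g') (at t within S)"
  shows "((\<lambda>t. f t \<bullet> g t) has_real_derivative f t \<bullet> g' + f' \<bullet> g t) (at t within S)"
  unfolding has_field_derivative_def
  using has_derivative_inner[OF assms[unfolded has_vector_derivative_def]]
  by (rule has_derivative_eq_rhs) (auto simp: fun_eq_iff algebra_simps)

lemma has_real_derivative_inner_const:
  assumes "(f has_vector_derivative f') (at t within S)"
  shows "((\<lambda>t. (f t - c) \<bullet> u) has_real_derivative f' \<bullet> u) (at t within S)"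
proof -
  have "((\<lambda>t. f t - c) has_vector_derivative f') (at t within S)"
    using assms by (auto intro!: derivative_eq_intros)
  moreover have "((\<lambda>_. u) has_vector_derivative 0) (at t within S)" by simp
  ultimately show ?thesis
    using has_real_derivative_inner[of "\<lambda>t. f t - c" f' t S "\<lambda>_. u" 0] by simp
qed

lemma vector_derivative_quotient_tendsto:
  assumes "(f has_vector_derivative f') (at t)"
  shows "((\<lambda>s. (f s - f t) /\<^sub>R (s - t)) \<longlongrightarrow> f') (at t)"
proof -
  have "((\<lambda>s. (1 / norm (s - t)) *\<^sub>R (f s - (f t + (s - t) *\<^sub>R f'))) \<longlongrightarrow> 0) (at t)"
    using assms unfolding has_vector_derivative_def has_derivative_within by blast
  then have "((\<lambda>s. norm ((1 / norm (s - t)) *\<^sub>R (f s - (f t + (s - t) *\<^sub>R f')))) \<longlongrightarrow> 0) (at t)"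
    by (rule tendsto_norm_zero)
  then have "((\<lambda>s. norm ((f s - f t) /\<^sub>R (s - t) - f')) \<longlongrightarrow> 0) (at t)"
  proof (rule Lim_transform_eventually)
    have "norm ((1 / norm (s - t)) *\<^sub>R (f s - (f t + (s - t) *\<^sub>R f'))) = norm ((f s - f t) /\<^sub>R (s - t) - f')"
      if "s \<noteq> t" for s
    proof -
      have "(f s - (f t + (s - t) *\<^sub>R f')) /\<^sub>R (s - t)
          = (f s - f t) /\<^sub>R (s - t) - ((s - t) *\<^sub>R f') /\<^sub>R (s - t)"
        by (simp only: diff_diff_eq[symmetric] scaleR_diff_right)
      also have "((s - t) *\<^sub>R f') /\<^sub>R (s - t) = f'" using that by simp
      finally have "(f s - f t) /\<^sub>R (s - t) - f' = (f s - (f t + (s - t) *\<^sub>R f')) /\<^sub>R (s - t)" ..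
      then show ?thesis by (simp add: divide_inverse)
    qed
    then show "\<forall>\<^sub>F s in at t. norm ((1 / norm (s - t)) *\<^sub>R (f s - (f t + (s - t) *\<^sub>R f')))
        = norm ((f s - f t) /\<^sub>R (s - t) - f')"
      unfolding eventually_at by (intro exI[of _ 1]) auto
  qed
  then show ?thesis
    by (rule LIM_zero_cancel[OF tendsto_norm_zero_cancel])
qed

text \<open>The quotient depends on the point \<open>\<gamma> s\<close> alone, not on the
  parametrization, while its limit is half the normal acceleration divided by the squared speed.
  This makes curvature a property of the boundary set.\<close>

lemma second_order_quotient_tendsto:
  fixes \<gamma> :: "real \<Rightarrow> real^2"
  assumes \<gamma>: "\<And>t. (\<gamma> has_vector_derivative v t) (at t)" and v: "(v has_vector_derivative a) (at t)"
    and u: "v t \<bullet> u = 0" and v0: "v t \<noteq> 0"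
  shows "((\<lambda>s. ((\<gamma> s - \<gamma> t) \<bullet> u) / (norm (\<gamma> s - \<gamma> t))\<^sup>2) \<longlongrightarrow> (a \<bullet> u) / (2 * (norm (v t))\<^sup>2)) (at t)"
proof -
  have 1: "((\<lambda>s. ((\<gamma> s - \<gamma> t) \<bullet> u) / (s - t)\<^sup>2) \<longlongrightarrow> (a \<bullet> u) / 2) (at t)"
  proof (rule lhopital[where f' = "\<lambda>s. v s \<bullet> u" and g' = "\<lambda>s. 2 * (s - t)"])
    have "((\<lambda>s. (\<gamma> s - \<gamma> t) \<bullet> u) has_real_derivative v s \<bullet> u) (at s)" for s
      by (rule has_real_derivative_inner_const[OF \<gamma>])
    then show "\<forall>\<^sub>F s in at t. ((\<lambda>s. (\<gamma> s - \<gamma> t) \<bullet> u) has_real_derivative v s \<bullet> u) (at s)"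
      and "((\<lambda>s. (\<gamma> s - \<gamma> t) \<bullet> u) \<longlongrightarrow> 0) (at t)"
      using DERIV_isCont[of "\<lambda>s. (\<gamma> s - \<gamma> t) \<bullet> u" "v t \<bullet> u" t] by (auto simp: isCont_def)
    show "((\<lambda>s. (s - t)\<^sup>2) \<longlongrightarrow> 0) (at t)"
      by (auto intro!: tendsto_eq_intros)
    show "\<forall>\<^sub>F s in at t. ((\<lambda>s. (s - t)\<^sup>2) has_real_derivative 2 * (s - t)) (at s)"
      by (auto intro!: derivative_eq_intros always_eventually)
    show "\<forall>\<^sub>F s in at t. (s - t)\<^sup>2 \<noteq> 0" "\<forall>\<^sub>F s in at t. 2 * (s - t) \<noteq> 0"
      by (auto simp: eventually_at intro!: exI[of _ 1])
    \<comment> \<open>After one differentiation the quotient is a difference quotient of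
      \<open>v\<close> at \<open>t\<close>, since \<open>v t\<close> is orthogonal to
      \<open>u\<close>; the derivative of \<open>v\<close> is needed at \<open>t\<close>
      only.\<close>
    have "((\<lambda>s. ((v s - v t) /\<^sub>R (s - t)) \<bullet> u / 2) \<longlongrightarrow> (a \<bullet> u) / 2) (at t)"
      by (intro tendsto_intros vector_derivative_quotient_tendsto v) auto
    moreover have "((v s - v t) /\<^sub>R (s - t)) \<bullet> u / 2 = v s \<bullet> u / (2 * (s - t))" for s
      using u by (simp add: inner_diff_left divide_simps)
    ultimately show "((\<lambda>s. v s \<bullet> u / (2 * (s - t))) \<longlongrightarrow> (a \<bullet> u) / 2) (at t)"
      by (simp only:)
  qed
  have 2: "((\<lambda>s. (norm ((\<gamma> s - \<gamma> t) /\<^sub>R (s - t)))\<^sup>2) \<longlongrightarrow> (norm (v t))\<^sup>2) (at t)"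
    by (intro tendsto_intros vector_derivative_quotient_tendsto \<gamma>)
  have "((\<lambda>s. (((\<gamma> s - \<gamma> t) \<bullet> u) / (s - t)\<^sup>2) / (norm ((\<gamma> s - \<gamma> t) /\<^sub>R (s - t)))\<^sup>2)
      \<longlongrightarrow> ((a \<bullet> u) / 2) / (norm (v t))\<^sup>2) (at t)"
    using v0 by (intro tendsto_divide 1 2) auto
  then have "((\<lambda>s. (((\<gamma> s - \<gamma> t) \<bullet> u) / (s - t)\<^sup>2) / (norm ((\<gamma> s - \<gamma> t) /\<^sub>R (s - t)))\<^sup>2)
      \<longlongrightarrow> (a \<bullet> u) / (2 * (norm (v t))\<^sup>2)) (at t)"
    by simp
  then show ?thesis
  proof (rule Lim_transform_eventually)
    show "\<forall>\<^sub>F s in at t. (((\<gamma> s - \<gamma> t) \<bullet> u) / (s - t)\<^sup>2) / (norm ((\<gamma> s - \<gamma> t) /\<^sub>R (s - t)))\<^sup>2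
        = ((\<gamma> s - \<gamma> t) \<bullet> u) / (norm (\<gamma> s - \<gamma> t))\<^sup>2"
      unfolding eventually_at
      by (rule exI[of _ 1]) (auto simp: divide_simps power_mult_distrib power2_eq_square[of "inverse _"] dist_real_def power2_eq_square)
  qed
qed

lemma C2_boundary_paramE:
  assumes "C2_boundary_param M \<gamma>"
  obtains v a where "\<And>t. (\<gamma> has_vector_derivative v t) (at t)"
    "\<And>t. (v has_vector_derivative a t) (at t)" "continuous_on UNIV a" "\<And>t. v t \<noteq> 0"
    "\<And>t. curve_curvature \<gamma> t = \<bar>v t $ 1 * a t $ 2 - v t $ 2 * a t $ 1\<bar> / norm (v t) ^ 3"
    "\<And>t. \<gamma> (t + 1) = \<gamma> t" "inj_on \<gamma> {0..<1}" "range \<gamma> = frontier M"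
proof -
  note A = assms[unfolded C2_boundary_param_def]
  define v where "v = (\<lambda>t. vector_derivative \<gamma> (at t))"
  define a where "a = (\<lambda>t. vector_derivative v (at t))"
  have 1: "(\<gamma> has_vector_derivative v t) (at t)" for t
    using A unfolding v_def C1_differentiable_on_def
    by (metis UNIV_I differentiableI_vector vector_derivative_works)
  have "v C1_differentiable_on UNIV"
    using A by (simp add: v_def)
  then obtain D where D: "\<And>t. (v has_vector_derivative D t) (at t)" "continuous_on UNIV D"
    by (auto simp: C1_differentiable_on_def)
  have "a = D"
    using D(1) by (auto simp: a_def fun_eq_iff vector_derivative_at)
  show ?thesis
  proof (rule that[of v a])
    show "curve_curvature \<gamma> t = \<bar>v t $ 1 * a t $ 2 - v t $ 2 * a t $ 1\<bar> / norm (v t) ^ 3" for t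
      by (simp add: curve_curvature_def v_def a_def Let_def)
  qed (use A 1 D \<open>a = D\<close> v_def in auto)
qed

lemma abs_cross_eq_inner_normal:
  fixes v a u :: "real^2"
  assumes "v \<bullet> u = 0" "norm u = 1"
  shows "\<bar>v $ 1 * a $ 2 - v $ 2 * a $ 1\<bar> = norm v * \<bar>a \<bullet> u\<bar>"
proof -
  obtain t where t: "u = nu t"
    using unit_eq_nu assms by blast
  define c where "c = v \<bullet> tau t"
  have v: "v = c *\<^sub>R tau t"
    using frame_expand[of v t] assms t by (simp add: c_def)
  have "norm v = \<bar>c\<bar>"
    by (simp add: v)
  moreover have "v $ 1 * a $ 2 - v $ 2 * a $ 1 = - c * (a \<bullet> u)"
    unfolding v by (simp add: inner_real2 t algebra_simps)
  ultimately show ?thesis by (simp add: abs_mult)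
qed

lemma curvature_eq_inner_normal:
  fixes v a u :: "real^2"
  assumes "v \<bullet> u = 0" "norm u = 1" "v \<noteq> 0"
  shows "\<bar>v $ 1 * a $ 2 - v $ 2 * a $ 1\<bar> / norm v ^ 3 = \<bar>(a \<bullet> u) / (norm v)\<^sup>2\<bar>"
proof -
  have "norm v * c / norm v ^ 3 = c / (norm v)\<^sup>2" for c
    using assms(3) by (simp add: power2_eq_square power3_eq_cube)
  then show ?thesis
    unfolding abs_cross_eq_inner_normal[OF assms(1,2)] by (simp add: abs_divide)
qed

lemma periodic_int_shift:
  fixes \<gamma> :: "real \<Rightarrow> 'a" assumes "\<And>t. \<gamma> (t + p) = \<gamma> t" shows "\<gamma> (t + of_int n * p) = \<gamma> t"
proof -
  have *: "\<gamma> (t + real k * p) = \<gamma> t" for t k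
  proof (induction k)
    case (Suc k)
    then show ?case using assms[of "t + real k * p"] by (simp add: algebra_simps)
  qed simp
  show ?thesis
  proof (cases "n \<ge> 0")
    case True
    then show ?thesis using *[of t "nat n"] by simp
  next
    case False
    then show ?thesis using *[of "t + of_int n * p" "nat (-n)"] by simp
  qed
qed

lemma frontier_supporting_normal:
  fixes M :: "(real^2) set"
  assumes "convex M" "interior M \<noteq> {}" "x \<in> frontier M"
  obtains u where "norm u = 1" "\<And>y. y \<in> closure M \<Longrightarrow> y \<bullet> u \<le> x \<bullet> u"
proof -
  have "x \<in> closure M" "x \<notin> rel_interior M"
    using assms by (auto simp: frontier_def rel_interior_nonempty_interior)
  then obtain a where a: "a \<noteq> 0" "\<And>y. y \<in> closure M \<Longrightarrow> a \<bullet> x \<le> a \<bullet> y"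
    using supporting_hyperplane_relative_frontier[OF assms(1)] by metis
  show ?thesis
    by (rule that[of "- a /\<^sub>R norm a"]) (use a in \<open>auto simp: inner_commute divide_simps\<close>)
qed

text \<open>Both curvatures are limits of the same quotient, which sees only points of the boundary.
  No smooth change of parameter is constructed: a sequence of points on one curve is located on the
  other, and compactness with injectivity shows that the parameters converge along a
  subsequence.\<close>

lemma curve_curvature_unique:
  assumes "convex M" "interior M \<noteq> {}" "C2_boundary_param M \<gamma>" "C2_boundary_param M \<delta>" "\<gamma> s = \<delta> t"
  shows "curve_curvature \<gamma> s = curve_curvature \<delta> t"
proof -
  obtain v a where \<gamma>: "\<And>t. (\<gamma> has_vector_derivative v t) (at t)"
    "\<And>t. (v has_vector_derivative a t) (at t)" "continuous_on UNIV a" "\<And>t. v t \<noteq> 0"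
    "\<And>t. curve_curvature \<gamma> t = \<bar>v t $ 1 * a t $ 2 - v t $ 2 * a t $ 1\<bar> / norm (v t) ^ 3"
    "\<And>t. \<gamma> (t + 1) = \<gamma> t" "inj_on \<gamma> {0..<1}" "range \<gamma> = frontier M"
    using C2_boundary_paramE[OF assms(3)] by metis
  obtain w b where \<delta>: "\<And>t. (\<delta> has_vector_derivative w t) (at t)"
    "\<And>t. (w has_vector_derivative b t) (at t)" "continuous_on UNIV b" "\<And>t. w t \<noteq> 0"
    "\<And>t. curve_curvature \<delta> t = \<bar>w t $ 1 * b t $ 2 - w t $ 2 * b t $ 1\<bar> / norm (w t) ^ 3"
    "\<And>t. \<delta> (t + 1) = \<delta> t" "inj_on \<delta> {0..<1}" "range \<delta> = frontier M"
    using C2_boundary_paramE[OF assms(4)] by metis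
  have per: "\<delta> (r + of_int n) = \<delta> r" for r n
    using periodic_int_shift[of \<delta> 1, OF \<delta>(6)] by simp
  have "\<gamma> s \<in> frontier M" using \<gamma>(8) by blast
  then obtain u where u: "norm u = 1" "\<And>x. x \<in> closure M \<Longrightarrow> x \<bullet> u \<le> \<gamma> s \<bullet> u"
    using frontier_supporting_normal assms by metis
  \<comment> \<open>Both curves stay in the half plane supporting \<open>M\<close> at the common
    point, so the height along \<open>u\<close> is maximal there and both velocities are
    tangential.\<close>
  have "v s \<bullet> u = 0"
  proof (rule DERIV_local_max[OF has_real_derivative_inner_const[OF \<gamma>(1)], of 1 s])
    show "\<forall>y. \<bar>s - y\<bar> < 1 \<longrightarrow> (\<gamma> y - 0) \<bullet> u \<le> (\<gamma> s - 0) \<bullet> u"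
      using u(2) \<gamma>(8) by (auto simp: frontier_def)
  qed simp
  have "w t \<bullet> u = 0"
  proof (rule DERIV_local_max[OF has_real_derivative_inner_const[OF \<delta>(1)], of 1 t])
    have "\<delta> r \<in> closure M" for r using \<delta>(8) by (auto simp: frontier_def)
    then show "\<forall>y. \<bar>t - y\<bar> < 1 \<longrightarrow> (\<delta> y - 0) \<bullet> u \<le> (\<delta> t - 0) \<bullet> u"
      using u(2) assms(5) by auto
  qed simp
  define q where "q = (\<lambda>z. ((z - \<gamma> s) \<bullet> u) / (norm (z - \<gamma> s))\<^sup>2)"
  have q\<gamma>: "((\<lambda>r. q (\<gamma> r)) \<longlongrightarrow> (a s \<bullet> u) / (2 * (norm (v s))\<^sup>2)) (at s)"
    unfolding q_def by (rule second_order_quotient_tendsto) (use \<gamma> \<open>v s \<bullet> u = 0\<close> in auto)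
  have q\<delta>: "((\<lambda>r. q (\<delta> r)) \<longlongrightarrow> (b t \<bullet> u) / (2 * (norm (w t))\<^sup>2)) (at t)"
    unfolding q_def assms(5) by (rule second_order_quotient_tendsto) (use \<delta> \<open>w t \<bullet> u = 0\<close> in auto)
  define s' where "s' = (\<lambda>i. s + inverse (real (Suc i)))"
  have s': "s' \<longlonglongrightarrow> s"
    unfolding s'_def using tendsto_add[OF tendsto_const LIMSEQ_inverse_real_of_nat, of s] by simp
  have at_s: "filterlim s' (at s) sequentially"
    using s' by (auto simp: filterlim_at s'_def)
  have nz: "\<forall>\<^sub>F i in sequentially. \<gamma> (s' i) \<noteq> \<gamma> s"
  proof -
    have "\<forall>\<^sub>F r in at s. (\<gamma> r - \<gamma> s) /\<^sub>R (r - s) \<noteq> 0"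
      using tendsto_imp_eventually_ne[OF vector_derivative_quotient_tendsto[OF \<gamma>(1)] \<gamma>(4)] .
    then have "\<forall>\<^sub>F r in at s. \<gamma> r \<noteq> \<gamma> s"
      by (rule eventually_mono) auto
    then show ?thesis using at_s unfolding filterlim_iff by blast
  qed
  \<comment> \<open>The parameter of the same point on the other curve, taken modulo 1 within 1/2 of
    \<open>t\<close>: this window is compact and too short to contain another parameter equivalent
    to \<open>t\<close>.\<close>
  have "\<exists>r. \<bar>r - t\<bar> \<le> 1/2 \<and> \<delta> r = \<gamma> (s' i)" for i
  proof -
    have "\<gamma> (s' i) \<in> range \<delta>" using \<gamma>(8) \<delta>(8) by auto
    then obtain r where r: "\<delta> r = \<gamma> (s' i)" by auto
    have "\<bar>r + of_int (- round (r - t)) - t\<bar> \<le> 1/2"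
      using of_int_round_abs_le[of "r - t"] by (simp add: abs_minus_commute algebra_simps)
    then show ?thesis using r per[of r "- round (r - t)"] by metis
  qed
  then obtain r where r: "\<And>i. \<bar>r i - t\<bar> \<le> 1/2" "\<And>i. \<delta> (r i) = \<gamma> (s' i)" by metis
  have "seq_compact {t - 1/2 .. t + 1/2}"
    by (simp add: compact_imp_seq_compact)
  moreover have "\<forall>i. r i \<in> {t - 1/2 .. t + 1/2}"
  proof
    fix i show "r i \<in> {t - 1/2 .. t + 1/2}" using abs_le_D1[OF r(1)[of i]] abs_le_D2[OF r(1)[of i]] by simp
  qed
  ultimately obtain l \<phi> where l: "l \<in> {t - 1/2 .. t + 1/2}" "strict_mono \<phi>" "(r \<circ> \<phi>) \<longlonglongrightarrow> l"
    unfolding seq_compact_def by metis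
  have cont: "isCont \<delta> x" "isCont \<gamma> x" for x
    using has_vector_derivative_continuous \<delta>(1) \<gamma>(1) by blast+
  have "(\<lambda>i. \<delta> ((r \<circ> \<phi>) i)) \<longlonglongrightarrow> \<delta> l"
    using isCont_tendsto_compose[OF cont(1) l(3)] .
  moreover have "(\<lambda>i. \<gamma> ((s' \<circ> \<phi>) i)) \<longlonglongrightarrow> \<gamma> s"
    by (rule isCont_tendsto_compose[OF cont(2) LIMSEQ_subseq_LIMSEQ[OF s' l(2)]])
  ultimately have "\<delta> l = \<delta> t"
    using LIMSEQ_unique r(2) assms(5) by (simp add: o_def) 
  have "l = t"
  proof -
    have "\<delta> (frac l) = \<delta> l" "\<delta> (frac t) = \<delta> t"
      using per[of l "-\<lfloor>l\<rfloor>"] per[of t "-\<lfloor>t\<rfloor>"] by (simp_all add: frac_def)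
    then have "frac l = frac t"
      using inj_onD[OF \<delta>(7), of "frac l" "frac t"] \<open>\<delta> l = \<delta> t\<close> by (simp add: frac_lt_1)
    then have lt: "l - t = of_int (\<lfloor>l\<rfloor> - \<lfloor>t\<rfloor>)" by (simp add: frac_def)
    moreover have "\<bar>l - t\<bar> < 1" using l(1) by (auto simp: abs_less_iff)
    ultimately have "\<bar>real_of_int (\<lfloor>l\<rfloor> - \<lfloor>t\<rfloor>)\<bar> < 1" by simp
    then have "\<bar>\<lfloor>l\<rfloor> - \<lfloor>t\<rfloor>\<bar> < 1" by linarith
    then show ?thesis using lt by simp
  qed
  have at_t: "filterlim (r \<circ> \<phi>) (at t) sequentially"
  proof -
    have "\<forall>\<^sub>F i in sequentially. \<gamma> (s' (\<phi> i)) \<noteq> \<gamma> s"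
      using eventually_subseq[OF l(2) nz] .
    then have "\<forall>\<^sub>F i in sequentially. (r \<circ> \<phi>) i \<noteq> t"
      by (rule eventually_mono) (metis assms(5) comp_apply r(2))
    then show ?thesis using l(3) \<open>l = t\<close> by (simp add: filterlim_at)
  qed
  have "(\<lambda>i. q (\<delta> ((r \<circ> \<phi>) i))) \<longlonglongrightarrow> (b t \<bullet> u) / (2 * (norm (w t))\<^sup>2)"
    by (rule filterlim_compose[OF q\<delta> at_t])
  moreover have "(\<lambda>i. q (\<gamma> (s' (\<phi> i)))) \<longlonglongrightarrow> (a s \<bullet> u) / (2 * (norm (v s))\<^sup>2)"
    by (rule filterlim_compose[OF filterlim_compose[OF q\<gamma> at_s] filterlim_subseq[OF l(2)]])
  ultimately have "(b t \<bullet> u) / (2 * (norm (w t))\<^sup>2) = (a s \<bullet> u) / (2 * (norm (v s))\<^sup>2)"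
    using LIMSEQ_unique r(2) by (simp add: o_def)
  then have "(b t \<bullet> u) / (norm (w t))\<^sup>2 = (a s \<bullet> u) / (norm (v s))\<^sup>2" by simp
  then have "\<bar>(b t \<bullet> u) / (norm (w t))\<^sup>2\<bar> = \<bar>(a s \<bullet> u) / (norm (v s))\<^sup>2\<bar>" by simp
  moreover have "curve_curvature \<gamma> s = \<bar>(a s \<bullet> u) / (norm (v s))\<^sup>2\<bar>"
    unfolding \<gamma>(5) by (rule curvature_eq_inner_normal[OF \<open>v s \<bullet> u = 0\<close> u(1) \<gamma>(4)])
  moreover have "curve_curvature \<delta> t = \<bar>(b t \<bullet> u) / (norm (w t))\<^sup>2\<bar>"
    unfolding \<delta>(5) by (rule curvature_eq_inner_normal[OF \<open>w t \<bullet> u = 0\<close> u(1) \<delta>(4)])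
  ultimately show ?thesis by simp
qed

lemma boundary_curvature_eq:
  assumes "convex M" "interior M \<noteq> {}" "C2_boundary_param M \<gamma>"
  shows "boundary_curvature M (\<gamma> t) = curve_curvature \<gamma> t"
  unfolding boundary_curvature_def
proof (rule the_equality)
  show "\<exists>\<gamma>' s. C2_boundary_param M \<gamma>' \<and> \<gamma>' s = \<gamma> t \<and> curve_curvature \<gamma> t = curve_curvature \<gamma>' s"
    using assms by (intro exI[of _ \<gamma>] exI[of _ t]) simp
next
  fix k assume "\<exists>\<gamma>' s. C2_boundary_param M \<gamma>' \<and> \<gamma>' s = \<gamma> t \<and> k = curve_curvature \<gamma>' s"
  then obtain \<gamma>' s where "C2_boundary_param M \<gamma>'" "\<gamma>' s = \<gamma> t" "k = curve_curvature \<gamma>' s" by metis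
  then show "k = curve_curvature \<gamma> t"
    using curve_curvature_unique[OF assms(1,2)] assms(3) by metis
qed

section \<open>Parametrization by the normal angle\<close>

text \<open>The point \<open>m t\<close> is the boundary point with outer normal \<open>nu t\<close>, so that \<open>r t\<close> is the radius of
  curvature there.\<close>
locale normal_disc =
  fixes M :: "(real^2) set" and m :: "real \<Rightarrow> real^2" and r :: "real \<Rightarrow> real"
  assumes compact: "compact M" and convex: "convex M" and interior_nonempty: "interior M \<noteq> {}"
    and m_deriv: "\<And>t. (m has_vector_derivative r t *\<^sub>R tau t) (at t)"
    and r_cont: "continuous_on UNIV r" and r_pos: "\<And>t. r t > 0"
    and m_in: "\<And>t. m t \<in> M" and support: "\<And>z t. z \<in> M \<Longrightarrow> (z - m t) \<bullet> nu t \<le> 0"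

lemma cross_frame:
  "v $ 1 * a $ 2 - v $ 2 * a $ 1 = (v \<bullet> nu t) * (a \<bullet> tau t) - (v \<bullet> tau t) * (a \<bullet> nu t)"
proof -
  have "cos t * (cos t * z) + sin t * (sin t * z) = z" for z
    using sin_cos_squared_add3[of t] by (metis distrib_right mult.assoc mult_1)
  from this[of "v $ 1 * a $ 2"] this[of "v $ 2 * a $ 1"] show ?thesis
    by (simp add: inner_real2 algebra_simps)
qed

text \<open>The tangent angle is obtained by integrating the angular speed.\<close>
lemma tangent_angle:
  fixes v a :: "real \<Rightarrow> real^2"
  assumes v: "\<And>t. (v has_vector_derivative a t) (at t)" and a: "continuous_on UNIV a" and v0: "\<And>t. v t \<noteq> 0"
  obtains \<theta> where
    "\<And>t. (\<theta> has_real_derivative (v t $ 1 * a t $ 2 - v t $ 2 * a t $ 1) / (norm (v t))\<^sup>2) (at t)"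
    "\<And>t. v t = norm (v t) *\<^sub>R tau (\<theta> t)"
proof -
  define D where "D = (\<lambda>t. v t $ 1 * a t $ 2 - v t $ 2 * a t $ 1)"
  define \<omega> where "\<omega> = (\<lambda>t. D t / (norm (v t))\<^sup>2)"
  have cv: "continuous_on UNIV v"
    by (rule continuous_on_vector_derivative[OF v])
  have "continuous_on UNIV \<omega>"
    unfolding \<omega>_def D_def using v0 by (intro continuous_intros cv a) auto
  then have "\<And>t. isCont \<omega> t" by (simp add: continuous_on_eq_continuous_at)
  then obtain G where G: "\<And>t. (G has_vector_derivative \<omega> t) (at t)"
    using einterval_antiderivative[of "-\<infinity>" "\<infinity>" \<omega>] by auto
  obtain c where c: "v 0 = norm (v 0) *\<^sub>R tau c" by (rule polar_tau)
  define \<theta> where "\<theta> = (\<lambda>t. G t - G 0 + c)"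
  have \<theta>: "(\<theta> has_real_derivative \<omega> t) (at t)" for t
    unfolding \<theta>_def has_real_derivative_iff_has_vector_derivative
    by (auto intro!: derivative_eq_intros G)
  have tau\<theta>: "((\<lambda>t. tau (\<theta> t)) has_vector_derivative \<omega> t *\<^sub>R (- nu (\<theta> t))) (at t)" for t
    using vector_diff_chain_at[of \<theta> "\<omega> t" t tau "- nu (\<theta> t)"] \<theta>[of t] tau_has_vector_derivative
    by (simp add: o_def has_real_derivative_iff_has_vector_derivative)
  \<comment> \<open>\<open>q\<close> is the cosine of the angle between the velocity and
    \<open>tau (\<theta> t)\<close>. It is 1 at 0, and its derivative vanishes because
    \<open>\<omega>\<close> is the angular speed of \<open>v\<close>.\<close>
  define q where "q = (\<lambda>t. (v t \<bullet> tau (\<theta> t)) / sqrt (v t \<bullet> v t))"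
  have q: "(q has_real_derivative 0) (at t)" for t
  proof -
    define N where "N = sqrt (v t \<bullet> v t)"
    have N: "N > 0" "N * N = v t \<bullet> v t" "norm (v t) = N"
      using v0[of t] by (auto simp: N_def norm_eq_sqrt_inner)
    define f where "f = v t \<bullet> tau (\<theta> t)"
    define g where "g = v t \<bullet> nu (\<theta> t)"
    define al where "al = a t \<bullet> tau (\<theta> t)"
    define be where "be = a t \<bullet> nu (\<theta> t)"
    have d1: "((\<lambda>t. v t \<bullet> tau (\<theta> t)) has_real_derivative al - \<omega> t * g) (at t)"
      using has_real_derivative_inner[OF v tau\<theta>, of t] by (simp add: al_def g_def)
    have "((\<lambda>t. v t \<bullet> v t) has_real_derivative 2 * (v t \<bullet> a t)) (at t)"
      using has_real_derivative_inner[OF v v, of t] by (simp add: inner_commute)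
    from DERIV_real_sqrt[THEN DERIV_chain2, OF _ this]
    have d2: "((\<lambda>t. sqrt (v t \<bullet> v t)) has_real_derivative (v t \<bullet> a t) / N) (at t)"
      using v0[of t] by (simp add: N_def field_simps)
    have "(q has_real_derivative ((al - \<omega> t * g) * N - f * ((v t \<bullet> a t) / N)) / (N * N)) (at t)"
      unfolding q_def f_def using DERIV_divide[OF d1 d2] N by (simp add: N_def)
    moreover have "(al - \<omega> t * g) * N - f * ((v t \<bullet> a t) / N) = 0"
    proof -
      have "\<omega> t * (N * N) = g * al - f * be"
        using N by (simp add: \<omega>_def D_def cross_frame[of _ _ "\<theta> t"] power2_eq_square f_def g_def al_def be_def)
      moreover have "v t \<bullet> a t = f * al + g * be" "N * N = f * f + g * g"
        using frame_inner_sum[of "v t" "a t" "\<theta> t"] frame_inner_sum[of "v t" "v t" "\<theta> t"] N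
        by (simp_all add: f_def g_def al_def be_def)
      ultimately have "((al - \<omega> t * g) * N - f * ((v t \<bullet> a t) / N)) * N = 0"
        using N(1) by (simp add: left_diff_distrib) algebra
      then show ?thesis using N(1) by simp
    qed
    ultimately show ?thesis by simp
  qed
  have "q t = q 0" for t
    using DERIV_isconst_all[of q] q by blast
  moreover have "q 0 = 1"
  proof -
    have "v 0 \<bullet> tau c = norm (v 0)" by (subst c) simp
    then show ?thesis using v0[of 0] by (simp add: q_def \<theta>_def norm_eq_sqrt_inner)
  qed
  ultimately have "q t = 1" for t by simp
  then have "v t \<bullet> tau (\<theta> t) = norm (v t)" for t
    using v0[of t] unfolding q_def norm_eq_sqrt_inner by (simp add: field_simps)
  then have "v t = norm (v t) *\<^sub>R tau (\<theta> t)" for t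
    using frame_norm_sq[of "v t" "\<theta> t"] frame_expand[of "v t" "\<theta> t"] by simp
  then show ?thesis
    using that[of \<theta>] \<theta> by (simp add: \<omega>_def D_def)
qed

text \<open>A positive lower bound on the derivative, rather than positivity alone, forces linear
  growth and hence surjectivity by the intermediate value theorem.\<close>

lemma increasing_surj_inverse:
  fixes f :: "real \<Rightarrow> real"
  assumes f: "\<And>t. (f has_real_derivative f' t) (at t)" and c: "c > 0" "\<And>t. c \<le> f' t"
  obtains g where "\<And>t. f (g t) = t" "\<And>t. (g has_real_derivative inverse (f' (g t))) (at t)"
proof -
  have inc: "f y - f x \<ge> c * (y - x)" if "x \<le> y" for x y
  proof (cases "x = y")
    case False
    then have "x < y" using that by simp
    from MVT2[OF this, of f f'] f obtain z where "f y - f x = (y - x) * f' z" by blast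
    then show ?thesis using mult_right_mono[OF c(2)[of z], of "y - x"] that by (simp add: mult.commute)
  qed simp
  have cf: "continuous_on S f" for S
    by (rule DERIV_continuous_on[OF has_field_derivative_at_within[OF f]])
  have "\<exists>x. f x = t" for t
  proof -
    define b where "b = \<bar>t - f 0\<bar> / c"
    have "f (-b) \<le> t" "t \<le> f b"
      using inc[of "-b" 0] inc[of 0 b] c(1) by (auto simp: b_def)
    then show ?thesis
      using IVT'[of f "-b" t b, OF _ _ _ cf] c(1) by (force simp: b_def)
  qed
  then obtain g where g: "\<And>t. f (g t) = t" by metis
  have inj: "f x = f y \<Longrightarrow> x = y" for x y
  proof (cases x y rule: linorder_cases)
    case less
    moreover have "c * (y - x) > 0" using less c(1) by simp
    ultimately show "f x = f y \<Longrightarrow> x = y" using inc[of x y] by simp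
  next
    case greater
    moreover have "c * (x - y) > 0" using greater c(1) by simp
    ultimately show "f x = f y \<Longrightarrow> x = y" using inc[of y x] by simp
  qed
  have gf: "g (f x) = x" for x
    using inj[of "g (f x)" x] g by simp
  have "isCont g t" for t
    using isCont_inverse_function[of 1 "g t" g f] gf g DERIV_isCont[OF f] by simp
  then have cg: "\<And>t. isCont g t" by blast
  have "(g has_real_derivative inverse (f' (g t))) (at t)" for t
  proof (rule DERIV_inverse_function[of f _ g t "t - 1" "t + 1"])
    show "f' (g t) \<noteq> 0" using c(1) c(2)[of "g t"] by linarith
  qed (use f g cg in auto)
  then show ?thesis using that g by blast
qed

text \<open>Inverting the tangent angle reparametrizes the curve by its normal angle. The radius of
  curvature is speed divided by angular speed, which gives the formula for \<open>r\<close>. The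
  positive cross product means counterclockwise orientation, so that \<open>nu\<close> points
  outwards.\<close>

lemma normal_disc_of_curve:
  fixes \<gamma> :: "real \<Rightarrow> real^2"
  assumes M: "compact M" "convex M" "interior M \<noteq> {}"
    and \<gamma>: "\<And>t. (\<gamma> has_vector_derivative v t) (at t)" and v: "\<And>t. (v has_vector_derivative a t) (at t)"
    and a: "continuous_on UNIV a" and v0: "\<And>t. v t \<noteq> 0"
    and pos: "\<And>t. v t $ 1 * a t $ 2 - v t $ 2 * a t $ 1 > 0"
    and per: "\<And>t. \<gamma> (t + 1) = \<gamma> t" and front: "range \<gamma> \<subseteq> frontier M"
  obtains m r where "normal_disc M m r"
    "\<And>t. \<exists>s. m t = \<gamma> s \<and> r t = norm (v s) ^ 3 / (v s $ 1 * a s $ 2 - v s $ 2 * a s $ 1)"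
proof -
  define D where "D = (\<lambda>t. v t $ 1 * a t $ 2 - v t $ 2 * a t $ 1)"
  obtain \<theta> where \<theta>: "\<And>t. (\<theta> has_real_derivative D t / (norm (v t))\<^sup>2) (at t)"
    "\<And>t. v t = norm (v t) *\<^sub>R tau (\<theta> t)"
    using tangent_angle[OF v a v0] unfolding D_def by metis
  have vper: "v (t + 1) = v t" for t
  proof -
    have "((\<lambda>t. t + 1) has_vector_derivative 1) (at t)"
      by (simp add: has_real_derivative_iff_has_vector_derivative[symmetric]) (auto intro!: derivative_eq_intros)
    from vector_diff_chain_at[OF this \<gamma>] show ?thesis
      using per \<gamma>[of t] by (auto simp: o_def intro: vector_derivative_unique_at)
  qed
  have aper: "a (t + 1) = a t" for t
  proof -
    have "((\<lambda>t. t + 1) has_vector_derivative 1) (at t)"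
      by (simp add: has_real_derivative_iff_has_vector_derivative[symmetric]) (auto intro!: derivative_eq_intros)
    from vector_diff_chain_at[OF this v] show ?thesis
      using vper v[of t] by (auto simp: o_def intro: vector_derivative_unique_at)
  qed
  define \<omega> where "\<omega> = (\<lambda>t. D t / (norm (v t))\<^sup>2)"
  have cv: "continuous_on S v" for S
    by (rule continuous_on_vector_derivative) (use v has_vector_derivative_at_within in blast)
  have ca: "continuous_on S a" for S using a continuous_on_subset by blast
  have cD: "continuous_on S D" for S
    unfolding D_def by (intro continuous_intros cv ca)
  have "continuous_on {0..1} \<omega>"
    unfolding \<omega>_def using v0 by (intro continuous_intros cv cD) auto
  then obtain x0 where x0: "x0 \<in> {0..1}" "\<forall>y\<in>{0..1}. \<omega> x0 \<le> \<omega> y"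
    using continuous_attains_inf[of "{0..1::real}" \<omega>] by auto
  \<comment> \<open>By periodicity the minimum over one period bounds the angular speed everywhere,
    the uniform bound needed for the inversion.\<close>
  have "\<omega> x0 \<le> \<omega> t" for t
  proof -
    have "\<omega> (t + 1) = \<omega> t" for t by (simp add: \<omega>_def D_def vper aper)
    from periodic_int_shift[of \<omega> 1, OF this, of t "- \<lfloor>t\<rfloor>"] have "\<omega> (frac t) = \<omega> t"
      by (simp add: frac_def)
    then show ?thesis using x0(2) frac_lt_1[of t] by (metis atLeastAtMost_iff frac_ge_0 less_imp_le)
  qed
  moreover have "\<omega> x0 > 0" using pos[of x0] v0[of x0] by (simp add: \<omega>_def D_def)
  ultimately obtain s where s: "\<And>t. \<theta> (s t) = t" "\<And>t. (s has_real_derivative inverse (\<omega> (s t))) (at t)"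
    using increasing_surj_inverse[of \<theta> \<omega> "\<omega> x0"] \<theta>(1) unfolding \<omega>_def by blast
  define m where "m = (\<lambda>t. \<gamma> (s t))"
  define r where "r = (\<lambda>t. norm (v (s t)) ^ 3 / D (s t))"
  have Dpos: "D t > 0" for t using pos by (simp add: D_def)
  have sup: "(z - \<gamma> t) \<bullet> nu (\<theta> t) \<le> 0" if "z \<in> M" for z t
  proof -
    have "\<gamma> t \<in> frontier M" using front by blast
    then obtain u where u: "norm u = 1" "\<And>y. y \<in> closure M \<Longrightarrow> y \<bullet> u \<le> \<gamma> t \<bullet> u"
      using frontier_supporting_normal[OF M(2,3)] by metis
    have "v t \<bullet> u = 0"
    proof (rule DERIV_local_max[OF has_real_derivative_inner_const[OF \<gamma>], of 1 t])
      show "\<forall>y. \<bar>t - y\<bar> < 1 \<longrightarrow> (\<gamma> y - 0) \<bullet> u \<le> (\<gamma> t - 0) \<bullet> u"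
        using u(2) front by (auto simp: frontier_def)
    qed simp
    then have "tau (\<theta> t) \<bullet> u = 0"
      by (subst (asm) \<theta>(2)) (use v0 in simp)
    then have "(u \<bullet> nu (\<theta> t))\<^sup>2 = 1"
      using frame_norm_sq[of u "\<theta> t"] u(1) by (simp add: inner_commute)
    moreover have ue: "u = (u \<bullet> nu (\<theta> t)) *\<^sub>R nu (\<theta> t)"
      using frame_expand[of u "\<theta> t"] \<open>tau (\<theta> t) \<bullet> u = 0\<close> by (simp add: inner_commute)
    ultimately consider "u = nu (\<theta> t)" | "u = - nu (\<theta> t)"
      by (metis power2_eq_1_iff scaleR_minus_left scaleR_one)
    then show ?thesis
    proof cases
      case 1
      then show ?thesis using u(2)[of z] closure_subset[of M] that by (auto simp: inner_diff_left)
    next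
      case 2
      \<comment> \<open>The normal \<open>nu (\<theta> t)\<close> cannot point inwards: the curve
        would lie on its positive side, while the positive cross product makes the second order
        quotient negative near \<open>t\<close>.\<close>
      have vn: "v t \<bullet> nu (\<theta> t) = 0" by (subst \<theta>(2)) simp
      have "norm (v t) = v t \<bullet> tau (\<theta> t)" by (subst (2) \<theta>(2)) simp
      then have "D t = - norm (v t) * (a t \<bullet> nu (\<theta> t))"
        using vn by (simp add: D_def cross_frame[of _ _ "\<theta> t"])
      then have "a t \<bullet> nu (\<theta> t) < 0"
        using Dpos[of t] by (simp add: mult_less_0_iff)
      then have "a t \<bullet> nu (\<theta> t) / (2 * (norm (v t))\<^sup>2) < 0"
        using v0[of t] by (simp add: divide_neg_pos)
      from order_tendstoD(2)[OF second_order_quotient_tendsto[OF \<gamma> v vn v0] this]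
      have "\<forall>\<^sub>F x in at t. False"
      proof (rule eventually_mono)
        fix x assume "(\<gamma> x - \<gamma> t) \<bullet> nu (\<theta> t) / (norm (\<gamma> x - \<gamma> t))\<^sup>2 < 0"
        moreover have "(\<gamma> x - \<gamma> t) \<bullet> nu (\<theta> t) \<ge> 0"
          using u(2)[of "\<gamma> x"] front 2 by (auto simp: frontier_def inner_diff_left)
        ultimately show False by (simp add: divide_less_0_iff)
      qed
      then show ?thesis by simp
    qed
  qed
  have m': "(m has_vector_derivative r t *\<^sub>R tau t) (at t)" for t
  proof -
    have "(\<gamma> \<circ> s has_vector_derivative inverse (\<omega> (s t)) *\<^sub>R v (s t)) (at t)"
      using vector_diff_chain_at[of s "inverse (\<omega> (s t))" t \<gamma> "v (s t)"] s(2)[of t] \<gamma>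
      by (simp add: has_real_derivative_iff_has_vector_derivative)
    moreover have "inverse (\<omega> (s t)) *\<^sub>R v (s t) = r t *\<^sub>R tau t"
      by (subst \<theta>(2)) (use v0[of "s t"] in \<open>simp add: \<omega>_def r_def s(1) power2_eq_square power3_eq_cube field_simps\<close>)
    ultimately show ?thesis by (simp add: m_def o_def)
  qed
  have cs: "continuous_on UNIV s"
    by (rule DERIV_continuous_on[OF s(2)])
  have "normal_disc M m r"
  proof
    show "continuous_on UNIV r"
      unfolding r_def using Dpos
      by (intro continuous_intros continuous_on_compose2[OF cv cs] continuous_on_compose2[OF cD cs])
        (auto simp: less_imp_neq[THEN not_sym])
    show "r t > 0" for t using Dpos v0 by (simp add: r_def)
    show "m t \<in> M" for t
      using front compact_imp_closed[OF M(1)] by (auto simp: m_def frontier_def)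
    show "(z - m t) \<bullet> nu t \<le> 0" if "z \<in> M" for z t
      using sup[OF that, of "s t"] s(1) by (simp add: m_def)
  qed (use M m' in auto)
  then show ?thesis
  proof (rule that)
    show "\<exists>x. m t = \<gamma> x \<and> r t = norm (v x) ^ 3 / (v x $ 1 * a x $ 2 - v x $ 2 * a x $ 1)" for t
      by (intro exI[of _ "s t"]) (simp add: m_def r_def D_def)
  qed
qed

text \<open>Positive curvature keeps the cross product of velocity and acceleration away from zero,
  so it has constant sign on the connected line. A clockwise curve is traversed backwards.\<close>

lemma C2_plus_normal_disc:
  assumes "convex_disc M" "C2_plus_boundary M"
  obtains m r where "normal_disc M m r" "\<And>t. boundary_curvature M (m t) = 1 / r t"
proof -
  have M: "compact M" "convex M" "interior M \<noteq> {}"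
    using assms(1) by (auto simp: convex_disc_def)
  obtain \<gamma> where "C2_boundary_param M \<gamma>" and bpos: "\<And>x. x \<in> frontier M \<Longrightarrow> boundary_curvature M x > 0"
    using assms(2) by (auto simp: C2_plus_boundary_def)
  note bc = boundary_curvature_eq[OF M(2,3) this(1)]
  obtain v a where \<gamma>: "\<And>t. (\<gamma> has_vector_derivative v t) (at t)"
    "\<And>t. (v has_vector_derivative a t) (at t)" "continuous_on UNIV a" "\<And>t. v t \<noteq> 0"
    "\<And>t. curve_curvature \<gamma> t = \<bar>v t $ 1 * a t $ 2 - v t $ 2 * a t $ 1\<bar> / norm (v t) ^ 3"
    "\<And>t. \<gamma> (t + 1) = \<gamma> t" "inj_on \<gamma> {0..<1}" "range \<gamma> = frontier M"
    using C2_boundary_paramE[OF \<open>C2_boundary_param M \<gamma>\<close>] by metis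
  define D where "D = (\<lambda>t. v t $ 1 * a t $ 2 - v t $ 2 * a t $ 1)"
  have D0: "D t \<noteq> 0" for t
  proof -
    have "\<gamma> t \<in> frontier M" using \<gamma>(8) by blast
    then show ?thesis using bpos[of "\<gamma> t"] by (auto simp: bc \<gamma>(5) D_def)
  qed
  have "continuous_on UNIV v"
    by (rule continuous_on_vector_derivative[OF \<gamma>(2)])
  then have cD: "continuous_on S D" for S
    unfolding D_def using \<gamma>(3) by (intro continuous_intros) (auto intro: continuous_on_subset)
  have "connected (range D)" by (intro connected_continuous_image cD) simp
  then have icc: "{D s .. D t} \<subseteq> range D" for s t by (rule connected_contains_Icc) auto
  have sign: "D t > 0" if "D s > 0" for s t
  proof (rule ccontr)
    assume "\<not> ?thesis"
    then have "0 \<in> range D" using icc[of t s] that by auto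
    then show False using D0 by auto
  qed
  show ?thesis
  proof (cases "D 0 > 0")
    case True
    then have "\<And>t. D t > 0" using sign by blast
    obtain m r where mr: "normal_disc M m r" "\<And>t. \<exists>s. m t = \<gamma> s \<and> r t = norm (v s) ^ 3 / D s"
    proof (rule normal_disc_of_curve[OF M \<gamma>(1,2,3,4) _ \<gamma>(6)])
      show "0 < v t $ 1 * a t $ 2 - v t $ 2 * a t $ 1" for t
        using \<open>\<And>t. D t > 0\<close>[of t] by (simp add: D_def)
      show "range \<gamma> \<subseteq> frontier M" using \<gamma>(8) by simp
    qed (simp add: D_def)
    have "boundary_curvature M (m t) = 1 / r t" for t
    proof -
      obtain s where "m t = \<gamma> s" "r t = norm (v s) ^ 3 / D s"
        using mr(2)[of t] by blast
      moreover have "curve_curvature \<gamma> s = \<bar>D s\<bar> / norm (v s) ^ 3"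
        unfolding \<gamma>(5) D_def ..
      ultimately show ?thesis
        using \<open>\<And>t. D t > 0\<close>[of s] by (simp add: bc)
    qed
    then show ?thesis using that mr(1) by blast
  next
    case False
    have neg: "D t < 0" for t
      using sign[of t 0] D0[of t] False by linarith
    have minus: "(uminus has_vector_derivative -1) (at t)" for t :: real
      by (simp add: has_real_derivative_iff_has_vector_derivative[symmetric]) (auto intro!: derivative_eq_intros)
    have 1: "((\<lambda>t. \<gamma> (- t)) has_vector_derivative - v (- t)) (at t)" for t
      using vector_diff_chain_at[OF minus \<gamma>(1), of t] by (simp add: o_def)
    have 2: "((\<lambda>t. - v (- t)) has_vector_derivative a (- t)) (at t)" for t
      using has_vector_derivative_minus[OF vector_diff_chain_at[OF minus \<gamma>(2), of t]] by (simp add: o_def)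
    have 3: "continuous_on UNIV (\<lambda>t. a (- t))"
      by (intro continuous_on_compose2[OF \<gamma>(3)] continuous_intros) auto
    have 4: "\<gamma> (- (t + 1)) = \<gamma> (- t)" for t
      using \<gamma>(6)[of "- (t + 1)"] by simp
    obtain m r where mr: "normal_disc M m r" "\<And>t. \<exists>s. m t = \<gamma> (- s) \<and> r t = norm (- v (- s)) ^ 3 /
       ((- v (-s)) $ 1 * a (-s) $ 2 - (- v (-s)) $ 2 * a (-s) $ 1)"
    proof (rule normal_disc_of_curve[OF M 1 2 3 _ _ 4])
      show "- v (- t) \<noteq> 0" for t using \<gamma>(4) by simp
      show "0 < (- v (- t)) $ 1 * a (- t) $ 2 - (- v (- t)) $ 2 * a (- t) $ 1" for t
        using neg[of "- t"] by (simp add: D_def)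
      show "range (\<lambda>t. \<gamma> (- t)) \<subseteq> frontier M" using \<gamma>(8) by auto
    qed blast
    have "boundary_curvature M (m t) = 1 / r t" for t
    proof -
      obtain s where "m t = \<gamma> (- s)" "r t = norm (v (- s)) ^ 3 / - D (- s)"
        using mr(2)[of t] by (auto simp: D_def)
      moreover have "curve_curvature \<gamma> (- s) = \<bar>D (- s)\<bar> / norm (v (- s)) ^ 3"
        unfolding \<gamma>(5) D_def ..
      ultimately show ?thesis
        using neg[of "- s"] by (simp add: bc abs_of_neg)
    qed
    then show ?thesis using that mr(1) by blast
  qed
qed

section \<open>Support lines and comparison with touching circles\<close>

lemma angle_reduce:
  obtains n :: int where "c \<le> s + of_int n * (2 * pi)" "s + of_int n * (2 * pi) < c + 2 * pi"
proof
  define x where "x = (s - c) / (2 * pi)"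
  have s: "s = c + x * (2 * pi)" by (simp add: x_def)
  have "of_int \<lfloor>x\<rfloor> \<le> x" "x < of_int \<lfloor>x\<rfloor> + 1" by linarith+
  then have "of_int \<lfloor>x\<rfloor> * (2 * pi) \<le> x * (2 * pi)" "x * (2 * pi) < (of_int \<lfloor>x\<rfloor> + 1) * (2 * pi)"
    by (intro mult_right_mono mult_strict_right_mono; simp)+
  then show "c \<le> s + of_int (- \<lfloor>x\<rfloor>) * (2 * pi)" "s + of_int (- \<lfloor>x\<rfloor>) * (2 * pi) < c + 2 * pi"
    unfolding s by (simp_all add: algebra_simps)
qed

lemma frame_periodic_int [simp]: "nu (t + of_int n * (2 * pi)) = nu t" "tau (t + of_int n * (2 * pi)) = tau t"
  using periodic_int_shift[of nu "2 * pi"] periodic_int_shift[of tau "2 * pi"] by simp_all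

context normal_disc
begin

lemma closed: "closed M"
  using compact by (rule compact_imp_closed)

lemma proj_deriv:
  "((\<lambda>s. (m s - c) \<bullet> nu t) has_real_derivative r s * sin (t - s)) (at s)"
  "((\<lambda>s. (m s - c) \<bullet> tau t) has_real_derivative r s * cos (s - t)) (at s)"
  using has_real_derivative_inner_const[OF m_deriv, of c "nu t" s]
    has_real_derivative_inner_const[OF m_deriv, of c "tau t" s] by simp_all

text \<open>The function \<open>(z - m s) \<bullet> nu s\<close> has its maximum 0 at
  \<open>s = t\<close>. Since \<open>m\<close> moves tangentially, the derivative there is the
  tangential component of \<open>z - m t\<close>, which therefore vanishes too. This is the strict
  convexity used below.\<close>

lemma support_unique:
  assumes "z \<in> M" "(z - m t) \<bullet> nu t \<ge> 0" shows "z = m t"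
proof -
  have z0: "(z - m t) \<bullet> nu t = 0" using assms support[of z t] by simp
  have "((\<lambda>s. z - m s) has_vector_derivative - (r t *\<^sub>R tau t)) (at t)"
    using m_deriv[of t] by (auto intro!: derivative_eq_intros)
  from has_real_derivative_inner[OF this nu_has_vector_derivative]
  have "((\<lambda>s. (z - m s) \<bullet> nu s) has_real_derivative (z - m t) \<bullet> tau t) (at t)"
    by simp
  then have "(z - m t) \<bullet> tau t = 0"
    by (rule DERIV_local_max[of _ _ _ 1]) (use z0 support assms(1) in auto)
  then have "z - m t = 0"
    using z0 by (intro frame_eqI[of _ t]) auto
  then show ?thesis by simp
qed

text \<open>Angles differing by full turns share the outer normal, and a direction has a single
  support point.\<close>

lemma m_periodic: "m (t + of_int n * (2 * pi)) = m t"
proof (rule support_unique[OF m_in])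
  show "(m (t + of_int n * (2 * pi)) - m t) \<bullet> nu t \<ge> 0"
    using support[OF m_in[of t], of "t + of_int n * (2 * pi)"] by (simp add: inner_diff_left)
qed

lemma r_periodic: "r (t + of_int n * (2 * pi)) = r t"
proof -
  have "((\<lambda>t. t + of_int n * (2 * pi)) has_vector_derivative 1) (at t)"
    by (simp add: has_real_derivative_iff_has_vector_derivative[symmetric]) (auto intro!: derivative_eq_intros)
  from vector_diff_chain_at[OF this m_deriv]
  have "(m has_vector_derivative r (t + of_int n * (2 * pi)) *\<^sub>R tau t) (at t)"
    by (simp add: o_def m_periodic)
  from vector_derivative_unique_at[OF this m_deriv]
  have "(r (t + of_int n * (2 * pi)) *\<^sub>R tau t) \<bullet> tau t = (r t *\<^sub>R tau t) \<bullet> tau t" by simp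
  then show ?thesis by simp
qed

text \<open>Moves a direction into the turn centred at \<open>t\<close>, where the comparison with
  the circle touching at \<open>m t\<close> is valid.\<close>

lemma angle_cases:
  obtains s' where "t - pi \<le> s'" "s' < t + pi" "nu s' = nu s" "tau s' = tau s" "m s' = m s"
proof -
  obtain n where n: "t - pi \<le> s + of_int n * (2 * pi)" "s + of_int n * (2 * pi) < t - pi + 2 * pi"
    by (rule angle_reduce)
  show ?thesis
    by (rule that[of "s + of_int n * (2 * pi)"]) (use n m_periodic in auto)
qed

lemma mem_iff: "z \<in> M \<longleftrightarrow> (\<forall>t. (z - m t) \<bullet> nu t \<le> 0)"
proof
  assume *: "\<forall>t. (z - m t) \<bullet> nu t \<le> 0"
  show "z \<in> M"
  proof (rule ccontr)
    assume "z \<notin> M"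
    then obtain a b where ab: "a \<bullet> z < b" "\<And>x. x \<in> M \<Longrightarrow> a \<bullet> x > b"
      using separating_hyperplane_closed_point[OF convex closed] by metis
    then have "a \<noteq> 0" using m_in[of 0] by force
    then have "norm (- a /\<^sub>R norm a) = 1" by simp
    then obtain t where t: "- a /\<^sub>R norm a = nu t" using unit_eq_nu by metis
    have "(z - m t) \<bullet> (- a /\<^sub>R norm a) > 0"
      using ab(1) ab(2)[OF m_in[of t]] \<open>a \<noteq> 0\<close>
      by (simp add: inner_diff_left inner_diff_right inner_commute field_simps)
    then show False using *[rule_format, of t] unfolding t by simp
  qed
qed (use support in auto)

lemma r_bounded_below: obtains e where "e > 0" "\<And>t. e \<le> r t"
proof -
  obtain x where x: "x \<in> {0..2 * pi}" "\<And>y. y \<in> {0..2 * pi} \<Longrightarrow> r x \<le> r y"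
    using continuous_attains_inf[of "{0..2 * pi}" r] continuous_on_subset[OF r_cont] by auto
  have "r x \<le> r t" for t
  proof -
    obtain n where "0 \<le> t + of_int n * (2 * pi)" "t + of_int n * (2 * pi) < 0 + 2 * pi"
      by (rule angle_reduce)
    then show ?thesis using x(2)[of "t + of_int n * (2 * pi)"] by (simp add: r_periodic)
  qed
  then show ?thesis using that r_pos by blast
qed

text \<open>Comparing with the circle of radius \<open>R\<close> touching at \<open>m t\<close>: the derivative of the difference of the
  support functions is an integral of \<open>(r - R) sin\<close>, whose sign is known on a half turn.\<close>
lemma support_le:
  assumes "\<bar>s - t\<bar> \<le> pi" "\<And>x. x \<in> closed_segment t s \<Longrightarrow> r x \<le> R"
  shows "(m s - m t + R *\<^sub>R nu t) \<bullet> nu s \<le> R"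
proof -
  \<comment> \<open>Height of \<open>m x\<close> in direction \<open>nu s\<close> minus the height
    of the circle point with normal \<open>nu x\<close>. The claim is
    \<open>F s \<le> F t\<close>.\<close>
  define F where "F = (\<lambda>x. (m x - 0) \<bullet> nu s - R * cos (s - x))"
  have F: "(F has_real_derivative (r x - R) * sin (s - x)) (at x)" for x
  proof -
    have "((\<lambda>x. R * cos (s - x)) has_real_derivative R * sin (s - x)) (at x)"
      by (auto intro!: derivative_eq_intros)
    from DERIV_diff[OF proj_deriv(1)[of 0 s x] this] show ?thesis
      unfolding F_def by (simp add: left_diff_distrib)
  qed
  have "F s \<le> F t"
  proof (cases "t \<le> s")
    case True
    show ?thesis
    proof (rule DERIV_nonpos_imp_nonincreasing[of t s F, OF True])
      fix x assume "t \<le> x" "x \<le> s"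
      then have "sin (s - x) \<ge> 0" "r x \<le> R"
        using assms by (auto simp: closed_segment_eq_real_ivl intro!: sin_ge_zero)
      then show "\<exists>y. (F has_real_derivative y) (at x) \<and> y \<le> 0"
        using F[of x] by (intro exI[of _ "(r x - R) * sin (s - x)"] conjI) (auto intro: mult_nonpos_nonneg)
    qed
  next
    case False
    show ?thesis
    proof (rule DERIV_nonneg_imp_nondecreasing[of s t F])
      fix x assume "s \<le> x" "x \<le> t"
      then have "sin (x - s) \<ge> 0" "r x \<le> R"
        using assms False by (auto simp: closed_segment_eq_real_ivl intro!: sin_ge_zero)
      then have "sin (s - x) \<le> 0" "r x \<le> R" by (metis minus_diff_eq neg_0_le_iff_le sin_minus)+
      then show "\<exists>y. (F has_real_derivative y) (at x) \<and> y \<ge> 0"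
        using F[of x] by (intro exI[of _ "(r x - R) * sin (s - x)"] conjI) (auto intro: mult_nonpos_nonpos)
    qed (use False in simp)
  qed
  moreover have "cos (t - s) = cos (s - t)" by (metis cos_minus minus_diff_eq)
  ultimately show ?thesis
    by (simp add: F_def inner_add_left inner_diff_left)
qed

lemma support_ge:
  assumes "\<bar>s - t\<bar> \<le> pi" "\<And>x. x \<in> closed_segment t s \<Longrightarrow> R \<le> r x"
  shows "R \<le> (m s - m t + R *\<^sub>R nu t) \<bullet> nu s"
proof -
  define F where "F = (\<lambda>x. (m x - 0) \<bullet> nu s - R * cos (s - x))"
  have F: "(F has_real_derivative (r x - R) * sin (s - x)) (at x)" for x
  proof -
    have "((\<lambda>x. R * cos (s - x)) has_real_derivative R * sin (s - x)) (at x)"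
      by (auto intro!: derivative_eq_intros)
    from DERIV_diff[OF proj_deriv(1)[of 0 s x] this] show ?thesis
      unfolding F_def by (simp add: left_diff_distrib)
  qed
  have "F t \<le> F s"
  proof (cases "t \<le> s")
    case True
    show ?thesis
    proof (rule DERIV_nonneg_imp_nondecreasing[of t s F, OF True])
      fix x assume "t \<le> x" "x \<le> s"
      then have "sin (s - x) \<ge> 0" "R \<le> r x"
        using assms by (auto simp: closed_segment_eq_real_ivl intro!: sin_ge_zero)
      then show "\<exists>y. (F has_real_derivative y) (at x) \<and> y \<ge> 0"
        using F[of x] by (intro exI[of _ "(r x - R) * sin (s - x)"] conjI) auto
    qed
  next
    case False
    show ?thesis
    proof (rule DERIV_nonpos_imp_nonincreasing[of s t F])
      fix x assume "s \<le> x" "x \<le> t"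
      then have "sin (x - s) \<ge> 0" "R \<le> r x"
        using assms False by (auto simp: closed_segment_eq_real_ivl intro!: sin_ge_zero)
      then have "sin (s - x) \<le> 0" "R \<le> r x" by (metis minus_diff_eq neg_0_le_iff_le sin_minus)+
      then show "\<exists>y. (F has_real_derivative y) (at x) \<and> y \<le> 0"
        using F[of x] by (intro exI[of _ "(r x - R) * sin (s - x)"] conjI) (auto intro: mult_nonneg_nonpos)
    qed (use False in simp)
  qed
  moreover have "cos (t - s) = cos (s - t)" by (metis cos_minus minus_diff_eq)
  ultimately show ?thesis
    by (simp add: F_def inner_add_left inner_diff_left)
qed

text \<open>One half of Blaschke's rolling theorem. A point \<open>z\<close> lies in some direction
  \<open>nu s\<close> from the centre of the circle, and its distance is at most the height of
  \<open>M\<close> in that direction, which \<open>support_le\<close> bounds by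
  \<open>R\<close>.\<close>

lemma subset_cball:
  assumes "\<And>t. r t \<le> R" shows "M \<subseteq> cball (m t - R *\<^sub>R nu t) R"
proof
  fix z assume z: "z \<in> M"
  define c where "c = m t - R *\<^sub>R nu t"
  show "z \<in> cball (m t - R *\<^sub>R nu t) R"
  proof (cases "z = c")
    case True
    then show ?thesis using assms[of t] r_pos[of t] by (simp add: c_def)
  next
    case False
    then have "norm ((z - c) /\<^sub>R norm (z - c)) = 1" by simp
    then obtain s0 where s0: "(z - c) /\<^sub>R norm (z - c) = nu s0" using unit_eq_nu by metis
    obtain s where s: "t - pi \<le> s" "s < t + pi" "nu s = nu s0" "m s = m s0"
      using angle_cases by metis
    have zs: "z - c = norm (z - c) *\<^sub>R nu s" using s0[symmetric] s(3) False by simp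
    have "norm (z - c) = (z - c) \<bullet> nu s"
      using arg_cong[OF zs, of "\<lambda>x. x \<bullet> nu s"] by simp
    also have "\<dots> \<le> (m s - c) \<bullet> nu s"
      using support[OF z, of s] by (simp add: inner_diff_left)
    also have "\<dots> \<le> R"
    proof -
      have "m s - c = m s - m t + R *\<^sub>R nu t" by (simp add: c_def)
      then show ?thesis using s(1,2) assms by (simp only:) (rule support_le; auto)
    qed
    finally show ?thesis by (simp add: c_def dist_norm norm_minus_commute)
  qed
qed

text \<open>The other half of the rolling theorem: by \<open>support_ge\<close> every supporting
  half plane of \<open>M\<close> contains the disc, and \<open>M\<close> is the intersection of
  these half planes.\<close>

lemma cball_subset:
  assumes "\<And>t. R \<le> r t" shows "cball (m t - R *\<^sub>R nu t) R \<subseteq> M"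
proof
  fix z assume z: "z \<in> cball (m t - R *\<^sub>R nu t) R"
  define c where "c = m t - R *\<^sub>R nu t"
  have "(z - m s0) \<bullet> nu s0 \<le> 0" for s0
  proof -
    obtain s where s: "t - pi \<le> s" "s < t + pi" "nu s = nu s0" "m s = m s0"
      using angle_cases by metis
    have "(z - c) \<bullet> nu s \<le> norm (z - c)"
      using norm_cauchy_schwarz[of "z - c" "nu s"] by simp
    also have "\<dots> \<le> R" using z by (simp add: c_def dist_norm norm_minus_commute)
    also have "R \<le> (m s - c) \<bullet> nu s"
    proof -
      have "m s - c = m s - m t + R *\<^sub>R nu t" by (simp add: c_def)
      then show ?thesis using s(1,2) assms by (simp only:) (rule support_ge; auto)
    qed
    finally show ?thesis using s by (simp add: inner_diff_left)
  qed
  then show "z \<in> M" by (simp add: mem_iff)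
qed

lemma frontier_eq: "frontier M = range m"
proof
  show "frontier M \<subseteq> range m"
  proof
    fix z assume z: "z \<in> frontier M"
    then obtain u where u: "norm u = 1" "\<And>y. y \<in> closure M \<Longrightarrow> y \<bullet> u \<le> z \<bullet> u"
      using frontier_supporting_normal[OF convex interior_nonempty] by metis
    obtain t where t: "u = nu t" using unit_eq_nu[OF u(1)] by metis
    have "z \<in> M" using z closed by (auto simp: frontier_def)
    then have "z = m t"
      by (rule support_unique) (use u(2)[of "m t"] m_in[of t] closure_subset[of M] t in \<open>auto simp: inner_diff_left\<close>)
    then show "z \<in> range m" by simp
  qed
  show "range m \<subseteq> frontier M"
  proof clarify
    fix t
    have "m t \<notin> interior M"
    proof
      assume "m t \<in> interior M"
      then obtain e where e: "e > 0" "cball (m t) e \<subseteq> M" by (meson mem_interior_cball)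
      then have "m t + e *\<^sub>R nu t \<in> M" by (auto simp: dist_norm subset_iff)
      from support[OF this, of t] e(1) show False by simp
    qed
    then show "m t \<in> frontier M"
      using m_in[of t] closure_subset[of M] by (auto simp: frontier_def)
  qed
qed

lemma normal_curvature_eq:
  "normal_curvature M (nu t) = boundary_curvature M (m t)"
proof -
  have "(THE x. x \<in> frontier M \<and> outer_unit_normal M x (nu t)) = m t"
  proof (rule the_equality)
    show "m t \<in> frontier M \<and> outer_unit_normal M (m t) (nu t)"
      using frontier_eq support by (auto simp: outer_unit_normal_def)
    fix x assume x: "x \<in> frontier M \<and> outer_unit_normal M x (nu t)"
    then have "x \<in> M" using closed by (auto simp: frontier_def)
    then show "x = m t"
    proof (rule support_unique)
      have "(m t - x) \<bullet> nu t \<le> 0" using x m_in by (auto simp: outer_unit_normal_def)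
      then show "(x - m t) \<bullet> nu t \<ge> 0" by (simp add: inner_diff_left)
    qed
  qed
  then show ?thesis by (simp add: normal_curvature_def)
qed

lemma r_near:
  assumes "e > 0" obtains d where "0 < d" "d \<le> pi" "\<And>x. \<bar>x - t\<bar> \<le> d \<Longrightarrow> \<bar>r x - r t\<bar> < e"
proof -
  have "isCont r t" using r_cont by (simp add: continuous_on_eq_continuous_at)
  then obtain d where d: "d > 0" "\<And>x. dist x t < d \<Longrightarrow> dist (r x) (r t) < e"
    using assms by (metis continuous_at_eps_delta)
  show ?thesis
    by (rule that[of "min pi (d / 2)"]) (use d in \<open>auto simp: dist_real_def\<close>)
qed

text \<open>Local form of the outer comparison, where \<open>r\<close> is bounded by
  \<open>R\<close> only for normals near \<open>t\<close>. A point close to \<open>m t\<close> is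
  seen from the centre of the circle in a direction close to \<open>nu t\<close>, so only these
  normals matter. Dropping the square of the depth turns the circle into a parabola.\<close>

lemma osculation_outer:
  assumes "r t < R"
  obtains d where "d > 0"
    "\<And>z. z \<in> M \<Longrightarrow> norm (z - m t) < d \<Longrightarrow> ((z - m t) \<bullet> tau t)\<^sup>2 \<le> 2 * R * ((m t - z) \<bullet> nu t)"
proof -
  obtain d0 where d0: "0 < d0" "d0 \<le> pi" "\<And>x. \<bar>x - t\<bar> \<le> d0 \<Longrightarrow> \<bar>r x - r t\<bar> < R - r t"
    using r_near[of "R - r t" t] assms by auto
  have R: "R > 0" using assms r_pos[of t] by simp
  have c1: "cos d0 < 1" using cos_monotone_0_pi[of 0 d0] d0 by simp
  \<comment> \<open>A direction at angle \<open>d0\<close> or more would give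
    \<open>R - d \<le> (R + d) * cos d0\<close>, hence \<open>R * (1 - cos d0) \<le> 2 * d\<close>;
    the factor one quarter makes this impossible.\<close>
  define d where "d = R * (1 - cos d0) / 4"
  have d: "d > 0" using R c1 by (simp add: d_def)
  define c where "c = m t - R *\<^sub>R nu t"
  have "((z - m t) \<bullet> tau t)\<^sup>2 \<le> 2 * R * ((m t - z) \<bullet> nu t)" if z: "z \<in> M" "norm (z - m t) < d" for z
  proof -
    have zc: "z - c = (z - m t) + R *\<^sub>R nu t" by (simp add: c_def)
    have "norm (z - c) \<le> R"
    proof (cases "z = c")
      case False
      then have "norm ((z - c) /\<^sub>R norm (z - c)) = 1" by simp
      then obtain s0 where s0: "(z - c) /\<^sub>R norm (z - c) = nu s0" using unit_eq_nu by metis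
      obtain s where s: "t - pi \<le> s" "s < t + pi" "nu s = nu s0"
        using angle_cases by metis
      have zs: "z - c = norm (z - c) *\<^sub>R nu s" using s0[symmetric] s(3) False by simp
      have "\<bar>s - t\<bar> < d0"
      proof (rule ccontr)
        assume "\<not> \<bar>s - t\<bar> < d0"
        then have "cos \<bar>s - t\<bar> \<le> cos d0"
          using s d0 by (intro cos_monotone_0_pi_le) auto
        then have cs: "cos (s - t) \<le> cos d0" by simp
        have "norm (z - c) * cos (s - t) = (z - c) \<bullet> nu t"
          using arg_cong[OF zs, of "\<lambda>x. x \<bullet> nu t"] by simp
        also have "\<dots> = (z - m t) \<bullet> nu t + R" by (simp add: zc inner_add_left)
        also have "\<dots> \<ge> R - d"
          using Cauchy_Schwarz_ineq2[of "z - m t" "nu t"] z(2) by auto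
        finally have 1: "R - d \<le> norm (z - c) * cos (s - t)" .
        have "norm (z - c) \<le> norm (z - m t) + norm (R *\<^sub>R nu t)" unfolding zc by (rule norm_triangle_ineq)
        then have 2: "norm (z - c) \<le> R + d" using z(2) R by simp
        have "R - d > 0"
        proof -
          have "1 - cos d0 \<le> 2" using cos_ge_minus_one[of d0] by linarith
          then have "d \<le> R * 2 / 4" using R unfolding d_def by (intro divide_right_mono mult_left_mono) auto
          then show ?thesis using R by simp
        qed
        have "norm (z - c) * cos (s - t) \<le> norm (z - c) * cos d0" using cs by (simp add: mult_left_mono)
        with 1 have 3: "R - d \<le> norm (z - c) * cos d0" by simp
        then have "cos d0 > 0" using \<open>R - d > 0\<close> using mult_nonneg_nonpos[of "norm (z - c)" "cos d0"] by (metis less_le_trans linorder_not_less norm_ge_zero)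
        then have "norm (z - c) * cos d0 \<le> (R + d) * cos d0" using 2 by (simp add: mult_right_mono)
        with 3 have "R - d \<le> (R + d) * cos d0" by simp
        then have "R * (1 - cos d0) \<le> d * (1 + cos d0)" by (simp add: algebra_simps)
        also have "\<dots> \<le> d * 2" using d by (intro mult_left_mono) auto
        also have "\<dots> = R * (1 - cos d0) / 2" by (simp add: d_def)
        finally show False using R c1 by (simp add: mult_le_0_iff field_simps)
      qed
      have "norm (z - c) = (z - c) \<bullet> nu s"
        using arg_cong[OF zs, of "\<lambda>x. x \<bullet> nu s"] by simp
      also have "\<dots> \<le> (m s - c) \<bullet> nu s"
        using support[OF z(1), of s] by (simp add: inner_diff_left)
      also have "\<dots> = (m s - m t + R *\<^sub>R nu t) \<bullet> nu s" by (simp add: c_def diff_diff_eq2 diff_add_eq)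
      also have "\<dots> \<le> R"
      proof (rule support_le)
        show "\<bar>s - t\<bar> \<le> pi" using s by auto
        fix x assume "x \<in> closed_segment t s"
        then have "\<bar>x - t\<bar> \<le> d0" using \<open>\<bar>s - t\<bar> < d0\<close> by (auto simp: closed_segment_eq_real_ivl split: if_splits)
        then show "r x \<le> R" using d0(3)[of x] by auto
      qed
      finally show ?thesis .
    qed (use R in simp)
    then have "(norm (z - c))\<^sup>2 \<le> R\<^sup>2" by (simp add: power_mono)
    moreover have "(norm (z - c))\<^sup>2 = ((z - m t) \<bullet> tau t)\<^sup>2 + ((z - m t) \<bullet> nu t + R)\<^sup>2"
      by (simp add: frame_norm_sq[of _ t] zc inner_add_left)
    ultimately have "((z - m t) \<bullet> tau t)\<^sup>2 \<le> - ((z - m t) \<bullet> nu t)\<^sup>2 - 2 * R * ((z - m t) \<bullet> nu t)"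
      by (simp add: power2_eq_square algebra_simps)
    also have "\<dots> \<le> 2 * R * ((m t - z) \<bullet> nu t)" by (simp add: inner_diff_left algebra_simps)
    finally show ?thesis .
  qed
  then show ?thesis using that d by blast
qed

text \<open>The disc of radius \<open>e\<close> touching at \<open>m t\<close> lies in
  \<open>M\<close>, so each support line of \<open>M\<close> stays beyond it. This quantifies how
  far \<open>m t\<close> is from support lines with other normals.\<close>

lemma support_gap:
  assumes "0 < e" "\<And>t. e \<le> r t"
  shows "(m t - m s) \<bullet> nu s \<le> - e * (1 - cos (s - t))"
proof -
  have "m t - e *\<^sub>R nu t + e *\<^sub>R nu s \<in> cball (m t - e *\<^sub>R nu t) e"
    using assms(1) by (simp add: dist_norm)
  then have "m t - e *\<^sub>R nu t + e *\<^sub>R nu s \<in> M"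
    using cball_subset[OF assms(2)] by blast
  from support[OF this, of s] show ?thesis
    by (simp add: inner_add_left inner_diff_left cos_diff algebra_simps)
qed

lemma osculation_inner:
  assumes "0 < R" "R < r t"
  obtains d where "d > 0"
    "\<And>z. norm (z - m t) < d \<Longrightarrow> ((z - m t) \<bullet> tau t)\<^sup>2 \<le> 2 * R * ((m t - z) \<bullet> nu t) \<Longrightarrow> z \<in> M"
proof -
  \<comment> \<open>The intermediate radius gives room: the parabola of radius \<open>R\<close>
    stays inside the circle of radius \<open>R'\<close> down to depth
    \<open>2 * (R' - R)\<close>.\<close>
  define R' where "R' = (R + r t) / 2"
  have R': "R < R'" "R' < r t" using assms by (auto simp: R'_def)
  obtain d0 where d0: "0 < d0" "d0 \<le> pi" "\<And>x. \<bar>x - t\<bar> \<le> d0 \<Longrightarrow> \<bar>r x - r t\<bar> < r t - R'"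
    using r_near[of "r t - R'" t] R' by auto
  have c1: "cos d0 < 1" using cos_monotone_0_pi[of 0 d0] d0 by simp
  obtain e where e: "e > 0" "\<And>t. e \<le> r t" by (rule r_bounded_below) blast
  \<comment> \<open>The first bound keeps the point inside the intermediate circle, which settles
    normals near \<open>t\<close>; the second is the support gap for all other normals.\<close>
  define d where "d = min (2 * (R' - R)) (e * (1 - cos d0))"
  have d: "d > 0" using R' e c1 by (simp add: d_def)
  have "z \<in> M" if z: "norm (z - m t) < d" "((z - m t) \<bullet> tau t)\<^sup>2 \<le> 2 * R * ((m t - z) \<bullet> nu t)" for z
  proof -
    have "(z - m s0) \<bullet> nu s0 \<le> 0" for s0
    proof -
      obtain s where s: "t - pi \<le> s" "s < t + pi" "nu s = nu s0" "m s = m s0"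
        using angle_cases by metis
      show ?thesis
      proof (cases "\<bar>s - t\<bar> < d0")
        case True
        define c where "c = m t - R' *\<^sub>R nu t"
        define y where "y = (m t - z) \<bullet> nu t"
        have y0: "y \<ge> 0"
        proof -
          have "0 \<le> 2 * R * y" using z(2) zero_le_power2[of "(z - m t) \<bullet> tau t"] unfolding y_def by linarith
          then show ?thesis using assms(1) by (simp add: zero_le_mult_iff)
        qed
        have "y \<le> norm (z - m t)"
          using Cauchy_Schwarz_ineq2[of "m t - z" "nu t"] by (simp add: y_def norm_minus_commute)
        then have "y \<le> 2 * (R' - R)" using z(1) by (simp add: d_def)
        have zc: "z - c = (z - m t) + R' *\<^sub>R nu t" by (simp add: c_def)
        have "(norm (z - c))\<^sup>2 = ((z - m t) \<bullet> tau t)\<^sup>2 + (R' - y)\<^sup>2"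
          unfolding frame_norm_sq[of _ t] zc by (simp add: inner_add_left y_def inner_diff_left algebra_simps)
        also have "\<dots> \<le> 2 * R * y + (R' - y)\<^sup>2" using z(2) by (simp add: y_def)
        also have "\<dots> = R'\<^sup>2 - y * (2 * (R' - R) - y)" by (simp add: power2_eq_square algebra_simps)
        also have "\<dots> \<le> R'\<^sup>2" using y0 \<open>y \<le> 2 * (R' - R)\<close> by simp
        finally have "(norm (z - c))\<^sup>2 \<le> R'\<^sup>2" .
        then have n: "norm (z - c) \<le> R'"
          by (rule power2_le_imp_le) (use R' assms in linarith)
        have "(z - c) \<bullet> nu s \<le> norm (z - c)"
          using norm_cauchy_schwarz[of "z - c" "nu s"] by simp
        also note n
        also have "R' \<le> (m s - m t + R' *\<^sub>R nu t) \<bullet> nu s"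
        proof (rule support_ge)
          show "\<bar>s - t\<bar> \<le> pi" using s by auto
          fix x assume "x \<in> closed_segment t s"
          then have "\<bar>x - t\<bar> \<le> d0" using True by (auto simp: closed_segment_eq_real_ivl split: if_splits)
          then show "R' \<le> r x" using d0(3)[of x] by auto
        qed
        also have "\<dots> = (m s - c) \<bullet> nu s" by (simp add: c_def diff_diff_eq2 diff_add_eq)
        finally show ?thesis using s by (simp add: inner_diff_left)
      next
        case False
        then have "cos \<bar>s - t\<bar> \<le> cos d0"
          using s d0 by (intro cos_monotone_0_pi_le) auto
        then have cs: "cos (s - t) \<le> cos d0" by simp
        have "e * (1 - cos d0) \<le> e * (1 - cos (s - t))"
          using cs e(1) by simp
        moreover have "(z - m s) \<bullet> nu s = (z - m t) \<bullet> nu s + (m t - m s) \<bullet> nu s"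
          by (simp add: inner_diff_left)
        moreover have "(z - m t) \<bullet> nu s \<le> norm (z - m t)"
          using norm_cauchy_schwarz[of "z - m t" "nu s"] by simp
        moreover have "norm (z - m t) \<le> e * (1 - cos d0)" using z(1) by (simp add: d_def)
        moreover have "(m t - m s) \<bullet> nu s \<le> - e * (1 - cos (s - t))" by (rule support_gap[OF e])
        ultimately show ?thesis using s by simp
      qed
    qed
    then show ?thesis by (simp add: mem_iff)
  qed
  then show ?thesis using that d by blast
qed

end

section \<open>Chords and translates\<close>

definition rot :: "real^2 \<Rightarrow> real^2" where "rot w = vector [w $ 2, - (w $ 1)]"

lemma rot_tau [simp]: "rot (c *\<^sub>R tau t) = c *\<^sub>R nu t"
  by (simp add: rot_def vec_eq_iff forall_2)

lemma rot_continuous: "continuous_on S rot"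
proof -
  have "linear rot"
    by (intro linearI) (simp_all add: rot_def vec_eq_iff forall_2)
  then show ?thesis by (simp add: linear_continuous_on linear_conv_bounded_linear)
qed

text \<open>The chord \<open>[p, p + w]\<close> of \<open>M\<close> that lies on the clockwise side of \<open>w\<close>: its starting point is
  the extreme point of \<open>M \<inter> (M - w)\<close> in the direction \<open>rot w\<close>.\<close>
definition chord_start :: "(real^2) set \<Rightarrow> real^2 \<Rightarrow> real^2" where
  "chord_start M w = (SOME p. p \<in> M \<and> p + w \<in> M \<and>
     (\<forall>q. q \<in> M \<longrightarrow> q + w \<in> M \<longrightarrow> rot w \<bullet> q \<le> rot w \<bullet> p))"

lemma closedin_sequentialI:
  fixes S T :: "'a::metric_space set"
  assumes "S \<subseteq> T" "\<And>X l. (\<And>n. X n \<in> S) \<Longrightarrow> l \<in> T \<Longrightarrow> X \<longlonglongrightarrow> l \<Longrightarrow> l \<in> S"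
  shows "closedin (top_of_set T) S"
  unfolding closedin_limpt islimpt_sequential using assms by blast

context normal_disc
begin

text \<open>If the midpoint were on the boundary, both points would lie on its support line, against
  uniqueness of the support point.\<close>

lemma midpoint_interior:
  assumes "p \<in> M" "q \<in> M" "p \<noteq> q" shows "(1/2) *\<^sub>R (p + q) \<in> interior M"
proof (rule ccontr)
  assume *: "(1/2) *\<^sub>R (p + q) \<notin> interior M"
  have "(1/2) *\<^sub>R (p + q) \<in> M"
    using convexD[OF convex assms(1,2), of "1/2" "1/2"] by (simp add: scaleR_add_right)
  then have "(1/2) *\<^sub>R (p + q) \<in> frontier M"
    using * closure_subset[of M] by (auto simp: frontier_def)
  then obtain t where t: "(1/2) *\<^sub>R (p + q) = m t" by (auto simp: frontier_eq)
  have "(p - m t) \<bullet> nu t + (q - m t) \<bullet> nu t = 0"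
    unfolding t[symmetric] by (simp add: inner_diff_left inner_add_left)
  then have "(p - m t) \<bullet> nu t \<ge> 0" "(q - m t) \<bullet> nu t \<ge> 0"
    using support[OF assms(1), of t] support[OF assms(2), of t] by linarith+
  then have "p = m t" "q = m t" using support_unique assms by blast+
  then show False using assms(3) by simp
qed

text \<open>The derivative of the height is \<open>r z * sin (t - z)\<close>, positive on the half
  turn before \<open>t\<close>.\<close>

lemma m_proj_strict_mono:
  assumes "t - pi \<le> a" "a < b" "b \<le> t" shows "m a \<bullet> nu t < m b \<bullet> nu t"
proof -
  have "\<exists>z. a < z \<and> z < b \<and> (m b - 0) \<bullet> nu t - (m a - 0) \<bullet> nu t = (b - a) * (r z * sin (t - z))"
    by (rule MVT2[OF assms(2)]) (rule proj_deriv)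
  then obtain z where z: "a < z" "z < b" "(m b - 0) \<bullet> nu t - (m a - 0) \<bullet> nu t = (b - a) * (r z * sin (t - z))"
    by blast
  have "sin (t - z) > 0" using z assms by (intro sin_gt_zero) auto
  then have "(b - a) * (r z * sin (t - z)) > 0" using r_pos[of z] assms(2) by simp
  then show ?thesis using z(3) by simp
qed

text \<open>From a boundary point whose normal lies in this half turn, moving along
  \<open>tau t\<close> does not lower the height along that normal, so strict convexity forbids
  staying in \<open>M\<close>.\<close>

lemma no_chord:
  assumes "c > 0" "t \<le> s" "s \<le> t + pi" shows "m s + c *\<^sub>R tau t \<notin> M"
proof
  assume "m s + c *\<^sub>R tau t \<in> M"
  moreover have "sin (s - t) \<ge> 0" using assms by (intro sin_ge_zero) auto
  then have "(m s + c *\<^sub>R tau t - m s) \<bullet> nu s \<ge> 0" using assms(1) by simp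
  ultimately have "m s + c *\<^sub>R tau t = m s" by (rule support_unique)
  then show False using assms(1) by simp
qed

text \<open>The starting points of chords with given direction and length form an arc. At the height
  of \<open>m s\<close> the segment from \<open>m a\<close> to \<open>m b\<close> contains a point
  \<open>q\<close> ahead of \<open>m s\<close> in direction \<open>tau t\<close>. The end of the
  chord from \<open>q\<close> is in \<open>M\<close>, and the end of the chord from
  \<open>m s\<close> lies between it and \<open>m s\<close>.\<close>

lemma chord_arc:
  assumes c: "c > 0" and "t - pi \<le> a" "a \<le> s" "s \<le> b" "b \<le> t"
    and ab: "m a + c *\<^sub>R tau t \<in> M" "m b + c *\<^sub>R tau t \<in> M"
  shows "m s + c *\<^sub>R tau t \<in> M"
proof (cases "s = a \<or> s = b")
  case False
  then have s: "t - pi < s" "s < t" "a < s" "s < b" using assms by auto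
  have "m a \<bullet> nu t < m s \<bullet> nu t" "m s \<bullet> nu t < m b \<bullet> nu t"
    using s assms by (intro m_proj_strict_mono; simp)+
  define u where "u = (m s \<bullet> nu t - m a \<bullet> nu t) / (m b \<bullet> nu t - m a \<bullet> nu t)"
  have u: "0 \<le> u" "u \<le> 1" "u * (m b \<bullet> nu t - m a \<bullet> nu t) = m s \<bullet> nu t - m a \<bullet> nu t"
    using \<open>m a \<bullet> nu t < m s \<bullet> nu t\<close> \<open>m s \<bullet> nu t < m b \<bullet> nu t\<close> by (auto simp: u_def divide_simps)
  define q where "q = (1 - u) *\<^sub>R m a + u *\<^sub>R m b"
  have q: "q \<in> M" unfolding q_def using convexD_alt[OF convex m_in m_in u(1,2)] .
  have "(1 - u) *\<^sub>R (m a + c *\<^sub>R tau t) + u *\<^sub>R (m b + c *\<^sub>R tau t) = q + c *\<^sub>R tau t"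
    by (simp add: q_def algebra_simps)
  then have qc: "q + c *\<^sub>R tau t \<in> M" using convexD_alt[OF convex ab u(1,2)] by simp
  have "q \<bullet> nu t = m s \<bullet> nu t"
    using u(3) by (simp add: q_def inner_add_left algebra_simps)
  define x where "x = (q - m s) \<bullet> tau t"
  have qs: "q = m s + x *\<^sub>R tau t"
    by (rule frame_eqI[of _ t]) (use \<open>q \<bullet> nu t = m s \<bullet> nu t\<close> in \<open>simp_all add: x_def inner_add_left inner_diff_left\<close>)
  have "(q - m s) \<bullet> nu s = x * sin (s - t)" by (simp add: qs)
  then have "x * sin (s - t) \<le> 0" using support[OF q, of s] by simp
  moreover have "sin (s - t) < 0"
    using sin_gt_zero[of "t - s"] s by (metis diff_gt_0_iff_gt less_diff_eq minus_diff_eq neg_less_0_iff_less sin_minus add.commute diff_less_eq)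
  ultimately have x: "x \<ge> 0" by (metis linorder_not_less mult_neg_neg)
  define v where "v = c / (x + c)"
  have v: "0 \<le> v" "v \<le> 1" "v * (x + c) = c" using c x by (auto simp: v_def)
  have "(1 - v) *\<^sub>R m s + v *\<^sub>R (q + c *\<^sub>R tau t) = m s + (v * (x + c)) *\<^sub>R tau t"
    by (simp add: qs algebra_simps)
  then show ?thesis using convexD_alt[OF convex m_in qc v(1,2), of s] v(3) by simp
qed (use ab in auto)

end

text \<open>The lower bound on the radius of curvature puts a disc of radius \<open>R\<close> into
  \<open>M\<close>. For \<open>w\<close> shorter than \<open>2 * R\<close> the sets \<open>M\<close>
  and its translate by \<open>w\<close> therefore overlap with interior points, and the extreme
  chord \<open>w\<close> exists.\<close>

locale normal_disc_ball = normal_disc +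
  fixes R :: real
  assumes R: "R > 0" "\<And>t. R \<le> r t"
begin

lemma lens_ball:
  assumes "norm w < 2 * R"
  obtains c e where "e > 0" "cball c e \<subseteq> M" "cball (c + w) e \<subseteq> M"
proof -
  define c0 where "c0 = m 0 - R *\<^sub>R nu 0"
  have c0: "cball c0 R \<subseteq> M" unfolding c0_def by (rule cball_subset) (rule R)
  define e where "e = R - norm w / 2"
  have "cball (c0 - (1/2) *\<^sub>R w) e \<subseteq> cball c0 R"
    by (simp add: cball_subset_cball_iff e_def dist_norm)
  moreover have "cball (c0 - (1/2) *\<^sub>R w + w) e \<subseteq> cball c0 R"
  proof -
    have eq: "c0 - (1/2) *\<^sub>R w + w = c0 + (1/2) *\<^sub>R w"
      by (simp add: vec_eq_iff)
    show ?thesis unfolding eq by (simp add: cball_subset_cball_iff e_def dist_norm)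
  qed
  ultimately show ?thesis
    using that[of e "c0 - (1/2) *\<^sub>R w"] c0 assms by (auto simp: e_def)
qed

lemma chord_start:
  assumes "norm w < 2 * R"
  shows "chord_start M w \<in> M" "chord_start M w + w \<in> M"
    "\<And>q. q \<in> M \<Longrightarrow> q + w \<in> M \<Longrightarrow> rot w \<bullet> q \<le> rot w \<bullet> chord_start M w"
proof -
  define S where "S = M \<inter> (\<lambda>q. q + w) -` M"
  have "closed ((\<lambda>q. q + w) -` M)"
    by (intro closed_vimage closed continuous_intros)
  then have cS: "compact S" unfolding S_def by (rule compact_Int_closed[OF compact])
  obtain c e where "e > 0" "cball c e \<subseteq> M" "cball (c + w) e \<subseteq> M"
    using lens_ball[OF assms] .
  then have "c \<in> S" by (auto simp: S_def)
  then have S0: "S \<noteq> {}" by auto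
  have "continuous_on S (\<lambda>q. rot w \<bullet> q)" by (intro continuous_intros)
  then obtain p where "p \<in> S" "\<forall>q\<in>S. rot w \<bullet> q \<le> rot w \<bullet> p"
    using continuous_attains_sup[OF cS S0] by blast
  then have "\<exists>p. p \<in> M \<and> p + w \<in> M \<and> (\<forall>q. q \<in> M \<longrightarrow> q + w \<in> M \<longrightarrow> rot w \<bullet> q \<le> rot w \<bullet> p)"
    by (intro exI[of _ p]) (auto simp: S_def)
  from someI_ex[OF this, folded chord_start_def]
  show "chord_start M w \<in> M" "chord_start M w + w \<in> M"
    "\<And>q. q \<in> M \<Longrightarrow> q + w \<in> M \<Longrightarrow> rot w \<bullet> q \<le> rot w \<bullet> chord_start M w" by blast+
qed

text \<open>With two maximizers, strict convexity makes both end points of the averaged chord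
  interior; this chord could then be pushed further in direction \<open>rot w\<close>.\<close>

lemma chord_start_unique:
  assumes w: "w \<noteq> 0" "norm w < 2 * R" and p: "p \<in> M" "p + w \<in> M"
    and "rot w \<bullet> chord_start M w \<le> rot w \<bullet> p"
  shows "p = chord_start M w"
proof (rule ccontr)
  define Z where "Z = chord_start M w"
  assume "p \<noteq> chord_start M w"
  then have "(1/2) *\<^sub>R (p + Z) \<in> interior M" "(1/2) *\<^sub>R ((p + w) + (Z + w)) \<in> interior M"
    using p chord_start[OF w(2)] by (intro midpoint_interior; simp add: Z_def)+
  moreover define q where "q = (1/2) *\<^sub>R (p + Z)"
  moreover have "(1/2) *\<^sub>R ((p + w) + (Z + w)) = q + w"
    by (simp add: q_def vec_eq_iff field_simps)
  ultimately have "q \<in> interior M" "q + w \<in> interior M" by simp_all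
  then obtain e1 e2 where e: "e1 > 0" "cball q e1 \<subseteq> M" "e2 > 0" "cball (q + w) e2 \<subseteq> M"
    by (meson mem_interior_cball)
  obtain t where t: "w = norm w *\<^sub>R tau t" by (rule polar_tau)
  define e where "e = min e1 e2"
  have "q + e *\<^sub>R nu t \<in> M" "q + e *\<^sub>R nu t + w \<in> M"
    using e by (auto simp: e_def dist_norm subset_iff min_def)
  then have "rot w \<bullet> (q + e *\<^sub>R nu t) \<le> rot w \<bullet> Z"
    unfolding Z_def by (rule chord_start(3)[OF w(2)])
  moreover have "rot w = norm w *\<^sub>R nu t" using arg_cong[OF t, of rot] by simp
  then have "rot w \<bullet> nu t = norm w" by simp
  moreover have "norm w * e > 0" using w e by (simp add: e_def)
  moreover have "rot w \<bullet> q \<ge> rot w \<bullet> Z"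
    using assms(5) by (simp add: q_def Z_def inner_add_right)
  ultimately show False by (simp add: inner_add_right mult.commute)
qed

text \<open>Heights increase with the angle on the half turn before \<open>t\<close>, so the extreme
  chord starts at the last angle at which a chord in direction \<open>tau t\<close> fits.\<close>

lemma chord_start_angle:
  assumes c: "0 < c" "c < 2 * R"
  obtains b where "t - pi < b" "b < t" "chord_start M (c *\<^sub>R tau t) = m b"
    "\<And>s. t - pi \<le> s \<Longrightarrow> s \<le> t + pi \<Longrightarrow> m s + c *\<^sub>R tau t \<in> M \<Longrightarrow> s \<le> b"
    "m b + c *\<^sub>R tau t \<in> frontier M"
proof -
  define w where "w = c *\<^sub>R tau t"
  define Z where "Z = chord_start M w"
  have w: "norm w < 2 * R" "w \<noteq> 0" using c by (simp_all add: w_def)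
  have rw: "rot w = c *\<^sub>R nu t" by (simp add: w_def)
  note Z = chord_start[OF w(1), folded Z_def]
  \<comment> \<open>From an interior start the chord could slide backwards along itself without
    changing its height, against uniqueness. The shift is at most \<open>c\<close>, so the new end
    stays on the old chord.\<close>
  have "Z \<in> frontier M"
  proof (rule ccontr)
    assume "Z \<notin> frontier M"
    then have "Z \<in> interior M" using Z(1) closure_subset[of M] by (auto simp: frontier_def)
    then obtain e where e: "e > 0" "cball Z e \<subseteq> M" by (meson mem_interior_cball)
    define e' where "e' = min e c"
    have e': "0 < e'" "e' \<le> c" "e' \<le> e" using e c by (auto simp: e'_def)
    define q where "q = Z - e' *\<^sub>R tau t"
    have "q \<in> M" using e e' by (auto simp: q_def dist_norm subset_iff)
    moreover have "q + w \<in> M"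
    proof -
      have "(1 - (1 - e' / c)) *\<^sub>R Z + (1 - e' / c) *\<^sub>R (Z + w) = q + w"
        using c(1) by (simp add: q_def w_def algebra_simps)
      then show ?thesis
        using convexD_alt[OF convex Z(1,2), of "1 - e' / c"] e' c by (simp add: field_simps)
    qed
    ultimately have "q = Z"
      unfolding Z_def by (rule chord_start_unique[OF w(2,1)]) (simp add: rw q_def Z_def inner_diff_right)
    then show False using e' by (simp add: q_def)
  qed
  then obtain b0 where b0: "Z = m b0" by (auto simp: frontier_eq)
  obtain b where b: "t - pi \<le> b" "b < t + pi" "m b = m b0" using angle_cases by metis
  have Zb: "Z = m b" using b0 b by simp
  have nb: "\<not> (t \<le> s \<and> s \<le> t + pi)" if "m s + w \<in> M" for s
    using no_chord[OF c(1)] that by (auto simp: w_def)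
  have b': "t - pi < b" "b < t"
  proof -
    show "b < t" using nb[of b] Z(2) Zb b by auto
    show "t - pi < b"
    proof (rule ccontr)
      assume "\<not> t - pi < b"
      then have "b = t - pi" using b by simp
      then have "m (t + pi) = m b" using m_periodic[of "t - pi" 1] by (simp add: add.commute)
      then show False using nb[of "t + pi"] Z(2) Zb by auto
    qed
  qed
  have last: "s \<le> b" if "t - pi \<le> s" "s \<le> t + pi" "m s + c *\<^sub>R tau t \<in> M" for s
  proof (rule ccontr)
    assume "\<not> s \<le> b"
    moreover have "s < t" using nb[of s] that by (auto simp: w_def)
    ultimately have "m b \<bullet> nu t < m s \<bullet> nu t" using b' by (intro m_proj_strict_mono) auto
    moreover have "rot w \<bullet> m s \<le> rot w \<bullet> Z" using Z(3) m_in that by (simp add: w_def)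
    then have "m s \<bullet> nu t \<le> m b \<bullet> nu t" using c(1) by (simp add: rw Zb inner_commute)
    ultimately show False by simp
  qed
  \<comment> \<open>With an interior end, a slightly larger angle would still carry a chord, against
    the maximality of \<open>b\<close>.\<close>
  have "m b + w \<in> frontier M"
  proof (rule ccontr)
    assume "m b + w \<notin> frontier M"
    then have "m b + w \<in> interior M" using Z(2) Zb closure_subset[of M] by (auto simp: frontier_def)
    moreover have "isCont (\<lambda>s. m s + w) b"
      using has_vector_derivative_continuous[OF m_deriv] by (intro continuous_intros)
    ultimately have "\<forall>\<^sub>F s in at b. m s + w \<in> interior M"
      unfolding isCont_def by (metis open_interior topological_tendstoD)
    then obtain d where d: "d > 0" "\<And>s. s \<noteq> b \<Longrightarrow> dist s b < d \<Longrightarrow> m s + w \<in> interior M"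
      by (auto simp: eventually_at)
    define s where "s = min (b + d / 2) t"
    have s: "b < s" "s \<le> t" "dist s b < d" using d b' by (auto simp: s_def dist_real_def)
    then have "m s + c *\<^sub>R tau t \<in> M" using d(2)[of s] interior_subset[of M] by (auto simp: w_def)
    then show False using last[of s] s b' by auto
  qed
  then show ?thesis
    using that[of b] b' last Zb by (simp add: Z_def w_def)
qed

lemma chord_start_frontier:
  assumes "w \<noteq> 0" "norm w < 2 * R"
  shows "chord_start M w \<in> frontier M" "chord_start M w + w \<in> frontier M"
proof -
  obtain t where t: "w = norm w *\<^sub>R tau t" by (rule polar_tau)
  obtain b where b: "chord_start M (norm w *\<^sub>R tau t) = m b" "m b + norm w *\<^sub>R tau t \<in> frontier M"
    by (rule chord_start_angle[of "norm w" t]) (use assms in auto)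
  show "chord_start M w \<in> frontier M" "chord_start M w + w \<in> frontier M"
    using b t[symmetric] frontier_eq by auto
qed

lemma chord_angle_lift:
  assumes "w \<noteq> 0" "norm w < 2 * R" "m s + w \<in> M"
  obtains t b where "w = norm w *\<^sub>R tau t" "t - pi < s" "s < t" "s \<le> b" "b < t" "chord_start M w = m b"
    "\<And>x. s \<le> x \<Longrightarrow> x \<le> b \<Longrightarrow> m x + w \<in> M"
    "\<And>x. s \<le> x \<Longrightarrow> x \<le> t + pi \<Longrightarrow> m x + w \<in> M \<Longrightarrow> x \<le> b"
proof -
  obtain t0 where t0: "w = norm w *\<^sub>R tau t0" by (rule polar_tau)
  obtain n where n: "s - pi < t0 + of_int n * (2 * pi)" "t0 + of_int n * (2 * pi) \<le> s + pi"
  proof -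
    obtain k where "- s - pi \<le> - t0 + of_int k * (2 * pi)" "- t0 + of_int k * (2 * pi) < - s - pi + 2 * pi"
      by (rule angle_reduce)
    then show ?thesis by (intro that[of "- k"]) auto
  qed
  define t where "t = t0 + of_int n * (2 * pi)"
  have t: "w = norm w *\<^sub>R tau t" using t0 by (simp add: t_def)
  have nw: "norm w > 0" using assms(1) by simp
  have s: "t - pi \<le> s" "s < t + pi" using n by (auto simp: t_def)
  have "s < t" using no_chord[OF nw, of t s] s assms(3) t by force
  have "t - pi < s"
  proof (rule ccontr)
    assume "\<not> t - pi < s"
    then have "s = t - pi" using s by simp
    then have "m (t + pi) = m s" using m_periodic[of "t - pi" 1] by (simp add: add.commute)
    then show False using no_chord[OF nw, of t "t + pi"] assms(3) t by simp
  qed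
  obtain b where b: "t - pi < b" "b < t" "chord_start M (norm w *\<^sub>R tau t) = m b"
    "\<And>s. t - pi \<le> s \<Longrightarrow> s \<le> t + pi \<Longrightarrow> m s + norm w *\<^sub>R tau t \<in> M \<Longrightarrow> s \<le> b"
    "m b + norm w *\<^sub>R tau t \<in> frontier M"
    using chord_start_angle[OF nw assms(2), of t] by metis
  have bM: "m b + norm w *\<^sub>R tau t \<in> M" using b(5) closed by (auto simp: frontier_def)
  have sM: "m s + norm w *\<^sub>R tau t \<in> M" using assms(3) t by simp
  show ?thesis
  proof (rule that[OF t \<open>t - pi < s\<close> \<open>s < t\<close> _ b(2)])
    show "s \<le> b" using b(4)[OF _ _ sM] s by simp
    show "chord_start M w = m b" using b(3) t by simp
    show "m x + w \<in> M" if "s \<le> x" "x \<le> b" for x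
      using chord_arc[OF nw _ that _ sM bM] s b(2) t by simp
    show "x \<le> b" if "s \<le> x" "x \<le> t + pi" "m x + w \<in> M" for x
      using b(4)[of x] that s t by simp
  qed
qed

text \<open>When the boundary point moves counterclockwise from \<open>p\<close>, all chords
  \<open>w\<close> stay inside until the smallest lifted angle \<open>b w\<close> is reached. There
  this chord is extreme and all others still fit.\<close>

lemma successor_exists:
  assumes "finite W" "W \<noteq> {}" and W: "\<And>w. w \<in> W \<Longrightarrow> w \<noteq> 0 \<and> norm w < 2 * R"
    and p: "p \<in> frontier M" "\<And>w. w \<in> W \<Longrightarrow> p + w \<in> M"
  shows "\<exists>w\<in>W. \<forall>w'\<in>W. chord_start M w + w' \<in> M"
proof -
  obtain s where s: "p = m s" using p(1) by (auto simp: frontier_eq)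
  have "\<exists>b. s \<le> b \<and> chord_start M w = m b \<and> (\<forall>x. s \<le> x \<longrightarrow> x \<le> b \<longrightarrow> m x + w \<in> M)" if "w \<in> W" for w
  proof -
    have "m s + w \<in> M" using p(2)[OF that] s by simp
    show ?thesis
      by (rule chord_angle_lift[OF _ _ \<open>m s + w \<in> M\<close>]) (use W[OF that] in blast)+
  qed
  then obtain b where b: "\<And>w. w \<in> W \<Longrightarrow> s \<le> b w \<and> chord_start M w = m (b w) \<and> (\<forall>x. s \<le> x \<longrightarrow> x \<le> b w \<longrightarrow> m x + w \<in> M)"
    by metis
  obtain w where w: "w \<in> W" "b w = Min (b ` W)"
  proof -
    have "Min (b ` W) \<in> b ` W" using assms(1,2) by (intro Min_in) auto
    then show ?thesis using that by (metis imageE)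
  qed
  show ?thesis
  proof (intro bexI ballI)
    fix w' assume w': "w' \<in> W"
    have "b w \<le> b w'" using w(2) w' assms(1) by simp
    then show "chord_start M w + w' \<in> M" using b[OF w(1)] b[OF w'] by simp
  qed fact
qed

text \<open>The extreme position of \<open>w1\<close> admits \<open>w2\<close>, so that of
  \<open>w2\<close> lies further on, or at the same place. As it admits \<open>w1\<close> in turn,
  it cannot be beyond the last position for \<open>w1\<close>.\<close>

lemma successor_unique:
  assumes w: "w1 \<noteq> 0" "norm w1 < 2 * R" "w2 \<noteq> 0" "norm w2 < 2 * R"
    and "chord_start M w1 + w2 \<in> M" "chord_start M w2 + w1 \<in> M"
  shows "chord_start M w1 = chord_start M w2"
proof -
  obtain t where t: "w1 = norm w1 *\<^sub>R tau t" by (rule polar_tau)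
  obtain b1 where b1: "t - pi < b1" "b1 < t" "chord_start M w1 = m b1"
    by (rule chord_start_angle[of "norm w1" t]) (use w t[symmetric] in auto)
  have "m b1 + w1 \<in> M" using chord_start(2)[OF w(2)] b1 by simp
  then obtain t1 b where A: "b1 < t1" "b1 \<le> b" "chord_start M w1 = m b"
     "\<And>x. b1 \<le> x \<Longrightarrow> x \<le> t1 + pi \<Longrightarrow> m x + w1 \<in> M \<Longrightarrow> x \<le> b" "b < t1" "t1 - pi < b1"
    by (rule chord_angle_lift[OF w(1,2)]) blast
  have "m b + w2 \<in> M" using assms(5) A(3) by simp
  then obtain t2 b2 where B: "t2 - pi < b" "b \<le> b2" "b2 < t2" "chord_start M w2 = m b2"
    by (rule chord_angle_lift[OF w(3,4)]) blast
  have "m b2 + w1 \<in> M" using assms(6) B(4) by simp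
  \<comment> \<open>Both lifts stay within a half turn, so \<open>b2\<close> lies in the range where
    \<open>b\<close> is known to be the last parameter for \<open>w1\<close>.\<close>
  moreover have "b2 \<le> t1 + pi" using B A by linarith
  ultimately have "b2 \<le> b" using A(4)[of b2] A(2) B(2) by linarith
  then show ?thesis using A(3) B(2,4) by simp
qed

text \<open>A map into a compact set is continuous if its graph is closed. A limit of extreme chords
  is again a chord of \<open>M\<close>, and by uniqueness it remains to see that it is
  extreme.\<close>

lemma chord_start_continuous:
  "continuous_on {w. w \<noteq> 0 \<and> norm w < 2 * R} (chord_start M)"
proof -
  define W where "W = {w :: real^2. w \<noteq> 0 \<and> norm w < 2 * R}"
  have "closedin (top_of_set (W \<times> M)) ((\<lambda>w. (w, chord_start M w)) ` W)"
  proof (rule closedin_sequentialI)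
    show "(\<lambda>w. (w, chord_start M w)) ` W \<subseteq> W \<times> M"
      using chord_start(1) by (auto simp: W_def)
    fix X l assume X: "\<And>n. X n \<in> (\<lambda>w. (w, chord_start M w)) ` W" "l \<in> W \<times> M" "X \<longlonglongrightarrow> l"
    define x where "x = (\<lambda>n. fst (X n))"
    have xn: "x n \<in> W" "snd (X n) = chord_start M (x n)" for n
      using X(1)[of n] by (auto simp: x_def)
    obtain w p where l: "l = (w, p)" "w \<in> W" "p \<in> M" using X(2) by auto
    have x: "x \<longlonglongrightarrow> w" using tendsto_fst[OF X(3)] l by (simp add: x_def)
    have p: "(\<lambda>n. chord_start M (x n)) \<longlonglongrightarrow> p"
      using tendsto_snd[OF X(3)] l by (simp add: xn(2))
    have nw: "w \<noteq> 0" "norm w < 2 * R" using l(2) by (auto simp: W_def)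
    have pw: "p + w \<in> M"
    proof (rule closed_sequentially[OF closed])
      show "chord_start M (x n) + x n \<in> M" for n using chord_start(2) xn(1)[of n] by (auto simp: W_def)
      show "(\<lambda>n. chord_start M (x n) + x n) \<longlonglongrightarrow> p + w" by (intro tendsto_intros p x)
    qed
    have rotx: "(\<lambda>n. rot (x n)) \<longlonglongrightarrow> rot w"
      using continuous_on_tendsto_compose[OF rot_continuous[of UNIV] x] by simp
    obtain c e where ce: "e > 0" "cball c e \<subseteq> M" "cball (c + w) e \<subseteq> M"
      using lens_ball[OF nw(2)] .
    \<comment> \<open>Only chords with both end points interior are certain to persist for nearby
      vectors, so the limit is first compared with these.\<close>
    have le: "rot w \<bullet> q \<le> rot w \<bullet> p" if q: "q \<in> interior M" "q + w \<in> interior M" for q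
    proof (rule tendsto_le[OF trivial_limit_sequentially])
      show "(\<lambda>n. rot (x n) \<bullet> chord_start M (x n)) \<longlonglongrightarrow> rot w \<bullet> p" by (intro tendsto_intros rotx p)
      show "(\<lambda>n. rot (x n) \<bullet> q) \<longlonglongrightarrow> rot w \<bullet> q" by (intro tendsto_intros rotx)
      have "(\<lambda>n. q + x n) \<longlonglongrightarrow> q + w" by (intro tendsto_intros x)
      then have "\<forall>\<^sub>F n in sequentially. q + x n \<in> interior M"
        using q(2) by (metis open_interior topological_tendstoD)
      then show "\<forall>\<^sub>F n in sequentially. rot (x n) \<bullet> q \<le> rot (x n) \<bullet> chord_start M (x n)"
      proof (rule eventually_mono)
        fix n assume "q + x n \<in> interior M"
        then have "q + x n \<in> M" "q \<in> M" using q(1) interior_subset[of M] by blast+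
        then show "rot (x n) \<bullet> q \<le> rot (x n) \<bullet> chord_start M (x n)"
          using chord_start(3)[of "x n" q] xn(1)[of n] by (auto simp: W_def)
      qed
    qed
    define Z where "Z = chord_start M w"
    have Z: "Z \<in> M" "Z + w \<in> M" using chord_start nw by (auto simp: Z_def)
    have cint: "c \<in> interior M" "c + w \<in> interior M" using ce by (auto simp: mem_interior_cball)
    \<comment> \<open>Shrinking towards the interior chord from \<open>c\<close> approximates the
      extreme chord by interior ones.\<close>
    define q where "q = (\<lambda>n. Z - (1 / real (Suc n)) *\<^sub>R (Z - c))"
    have "rot w \<bullet> Z \<le> rot w \<bullet> p"
    proof (rule tendsto_le[OF trivial_limit_sequentially tendsto_const])
      have "q \<longlonglongrightarrow> Z - 0 *\<^sub>R (Z - c)"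
        unfolding q_def using LIMSEQ_inverse_real_of_nat by (intro tendsto_intros) (simp add: inverse_eq_divide)
      then show "(\<lambda>n. rot w \<bullet> q n) \<longlonglongrightarrow> rot w \<bullet> Z" by (intro tendsto_intros) simp
      show "\<forall>\<^sub>F n in sequentially. rot w \<bullet> q n \<le> rot w \<bullet> p"
      proof (intro always_eventually allI le)
        fix n
        show "q n \<in> interior M"
          unfolding q_def by (rule mem_interior_convex_shrink[OF convex cint(1) Z(1)]) auto
        have "q n + w = (Z + w) - (1 / real (Suc n)) *\<^sub>R ((Z + w) - (c + w))" by (simp add: q_def)
        then show "q n + w \<in> interior M"
          by (simp only:) (rule mem_interior_convex_shrink[OF convex cint(2) Z(2)]; simp)
      qed
    qed
    then have "p = Z" unfolding Z_def using chord_start_unique nw l(3) pw by blast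
    then show "l \<in> (\<lambda>w. (w, chord_start M w)) ` W" using l by (auto simp: Z_def)
  qed
  then have "continuous_on W (chord_start M)"
    by (subst continuous_closed_graph_eq[OF compact]) (use chord_start(1) in \<open>auto simp: W_def\<close>)
  then show ?thesis by (simp add: W_def)
qed

end

section \<open>The hull, independence and measurability\<close>

lemma in_L_hull_iff:
  "z \<in> L_hull L X \<longleftrightarrow> (\<forall>v. (\<forall>x\<in>X. x - v \<in> L) \<longrightarrow> z - v \<in> L)"
proof -
  have *: "y \<in> (+) v ` L \<longleftrightarrow> y - v \<in> L" for y v
  proof
    show "y \<in> (+) v ` L" if "y - v \<in> L" using that by (intro image_eqI[of _ _ "y - v"]) auto
  qed auto
  have "z \<in> L_hull L X \<longleftrightarrow> (\<forall>v. X \<subseteq> (+) v ` L \<longrightarrow> z \<in> (+) v ` L)"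
    unfolding L_hull_def by blast
  then show ?thesis by (simp only: subset_iff *) blast
qed

lemma convex_L_hull: "convex L \<Longrightarrow> convex (L_hull L X)"
  unfolding L_hull_def by (auto intro!: convex_Inter convex_translation)

lemma closed_L_hull: "closed L \<Longrightarrow> closed (L_hull L X)"
  unfolding L_hull_def by (auto intro!: closed_Inter closed_translation)

text \<open>On the way from a translate that misses \<open>y\<close> to one that contains
  everything, \<open>y\<close> enters through the boundary; the sample stays inside by
  convexity.\<close>

lemma not_in_L_hull:
  assumes "convex L" "\<And>x. x \<in> insert y X \<Longrightarrow> x - v0 \<in> L" "y \<notin> L_hull L X"
  obtains p where "p \<in> frontier L" "\<And>x. x \<in> X \<Longrightarrow> p + (x - y) \<in> L"
proof -
  obtain v where v: "\<And>x. x \<in> X \<Longrightarrow> x - v \<in> L" "y - v \<notin> L"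
    using assms(3) by (auto simp: in_L_hull_iff)
  have "closed_segment (y - v) (y - v0) \<inter> frontier L \<noteq> {}"
    by (rule connected_Int_frontier) (use assms(2)[of y] v(2) in auto)
  then obtain p where p: "p \<in> frontier L" "p \<in> closed_segment (y - v) (y - v0)" by blast
  then obtain s where s: "0 \<le> s" "s \<le> 1" "p = (1 - s) *\<^sub>R (y - v) + s *\<^sub>R (y - v0)"
    by (auto simp: in_segment)
  have "p + (x - y) \<in> L" if "x \<in> X" for x
  proof -
    have "p + (x - y) = (1 - s) *\<^sub>R (x - v) + s *\<^sub>R (x - v0)"
      by (simp add: s(3) algebra_simps)
    then show ?thesis using convexD_alt[OF assms(1) v(1)[OF that] assms(2)[of x] s(1,2)] that by simp
  qed
  then show ?thesis using that p(1) by blast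
qed

text \<open>The hull is contained in the translate that carries \<open>y\<close> on its boundary.
  This is the converse of \<open>not_in_L_hull\<close> up to the boundary of the hull, a null
  set.\<close>

lemma not_in_interior_L_hull:
  assumes "p \<in> frontier L" "\<And>x. x \<in> X \<Longrightarrow> p + (x - y) \<in> L"
  shows "y \<notin> interior (L_hull L X)"
proof
  assume y: "y \<in> interior (L_hull L X)"
  have "L_hull L X \<subseteq> (+) (y - p) ` L"
    unfolding L_hull_def
  proof (rule Inter_lower, clarify, intro conjI exI subsetI)
    fix x assume "x \<in> X"
    then have "p + (x - y) \<in> L" by (rule assms(2))
    then show "x \<in> (+) (y - p) ` L" by (intro image_eqI[of _ _ "p + (x - y)"]) auto
  qed simp
  then have "y \<in> interior ((+) (y - p) ` L)" using y interior_mono by blast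
  then have "p \<in> interior L" by (auto simp: interior_translation)
  then show False using assms(1) by (simp add: frontier_def)
qed

text \<open>The joint law is a product. Integrating over the coordinate \<open>j\<close> outermost
  leaves, for each of its values, independent conditions on the other points.\<close>

lemma (in prob_space) emeasure_indep_star:
  assumes indep: "indep_vars (\<lambda>_. N) X I" and I: "finite I" "j \<in> I"
    and D: "\<And>i. i \<in> I \<Longrightarrow> distr M N (X i) = U"
    and S: "\<And>i. i \<in> I \<Longrightarrow> S i \<in> sets (N \<Otimes>\<^sub>M N)"
  shows "emeasure M {\<omega>\<in>space M. \<forall>i\<in>I - {j}. (X j \<omega>, X i \<omega>) \<in> S i} =
    (\<integral>\<^sup>+x. (\<Prod>i\<in>I - {j}. emeasure U {y\<in>space N. (x, y) \<in> S i}) \<partial>U)"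
proof -
  have rv: "\<And>i. i \<in> I \<Longrightarrow> X i \<in> measurable M N"
    using indep by (simp add: indep_vars_def)
  define J where "J = I - {j}"
  have IJ: "I = insert j J" "finite J" "j \<notin> J" using I by (auto simp: J_def)
  have sU: "sets U = sets N" using D[OF I(2)] by auto
  have spU: "space U = space N" by (rule sets_eq_imp_space_eq[OF sU])
  have pU: "prob_space U" using prob_space_distr[OF rv[OF I(2)]] D[OF I(2)] by simp
  interpret U: product_sigma_finite "\<lambda>_. U"
    by (simp add: product_sigma_finite_def prob_space_imp_sigma_finite[OF pU])
  \<comment> \<open>The description of independence by the joint law asks for measurable maps at all
    indices, so the family is redefined outside \<open>I\<close>.\<close>
  define X' where "X' = (\<lambda>i. if i \<in> I then X i else X j)"
  have "indep_vars (\<lambda>_. N) X' I"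
    using indep by (subst indep_vars_cong[of I I X' X "\<lambda>_. N" "\<lambda>_. N"]) (auto simp: X'_def)
  moreover have rv': "\<And>i. X' i \<in> measurable M N" using rv I(2) by (auto simp: X'_def)
  moreover have "I \<noteq> {}" using I by auto
  ultimately have eq: "distr M (\<Pi>\<^sub>M i\<in>I. N) (\<lambda>x. \<lambda>i\<in>I. X' i x) = (\<Pi>\<^sub>M i\<in>I. distr M N (X' i))"
    using indep_vars_iff_distr_eq_PiM[where I=I and X=X' and M'="\<lambda>_. N"] by simp
  have "(\<Pi>\<^sub>M i\<in>I. distr M N (X' i)) = (\<Pi>\<^sub>M i\<in>I. U)"
    by (rule PiM_cong) (auto simp: X'_def D)
  then have eq: "distr M (\<Pi>\<^sub>M i\<in>I. N) (\<lambda>x. \<lambda>i\<in>I. X' i x) = (\<Pi>\<^sub>M i\<in>I. U)" using eq by simp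
  define B where "B = {x\<in>space (\<Pi>\<^sub>M i\<in>I. N). \<forall>i\<in>J. (x j, x i) \<in> S i}"
  have B: "B \<in> sets (\<Pi>\<^sub>M i\<in>I. N)"
  proof -
    have "(\<lambda>x. (x j, x i)) \<in> measurable (\<Pi>\<^sub>M i\<in>I. N) (N \<Otimes>\<^sub>M N)" if "i \<in> J" for i
      using that IJ by (intro measurable_Pair measurable_component_singleton) auto
    then have "{x\<in>space (\<Pi>\<^sub>M i\<in>I. N). (x j, x i) \<in> S i} \<in> sets (\<Pi>\<^sub>M i\<in>I. N)" if "i \<in> J" for i
      using measurable_sets[OF _ S[of i], of "\<lambda>x. (x j, x i)" "\<Pi>\<^sub>M i\<in>I. N"] that IJ
      by (simp add: vimage_def Int_def conj_commute)
    then show ?thesis unfolding B_def using IJ(2) by (intro sets.sets_Collect_finite_All) auto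
  qed
  have sPi: "sets (\<Pi>\<^sub>M i\<in>I. U) = sets (\<Pi>\<^sub>M i\<in>I. N)"
    by (rule sets_PiM_cong) (simp_all add: sU)
  have m: "(\<lambda>x. \<lambda>i\<in>I. X' i x) \<in> measurable M (\<Pi>\<^sub>M i\<in>I. N)"
    by (intro measurable_restrict rv')
  have "{\<omega>\<in>space M. \<forall>i\<in>I - {j}. (X j \<omega>, X i \<omega>) \<in> S i} = (\<lambda>x. \<lambda>i\<in>I. X' i x) -` B \<inter> space M"
    using measurable_space[OF m] I(2) by (auto simp: B_def J_def X'_def)
  then have "emeasure M {\<omega>\<in>space M. \<forall>i\<in>I - {j}. (X j \<omega>, X i \<omega>) \<in> S i} = emeasure (\<Pi>\<^sub>M i\<in>I. U) B"
    using emeasure_distr[OF m B] eq by simp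
  also have "\<dots> = (\<integral>\<^sup>+x. indicator B x \<partial>(\<Pi>\<^sub>M i\<in>I. U))"
    using B sPi by simp
  also have "\<dots> = (\<integral>\<^sup>+y. (\<integral>\<^sup>+x. indicator B (x(j := y)) \<partial>(\<Pi>\<^sub>M i\<in>J. U)) \<partial>U)"
    unfolding IJ(1)
  proof (rule U.product_nn_integral_insert_rev[OF IJ(2,3)])
    show "(indicator B :: _ \<Rightarrow> ennreal) \<in> borel_measurable (\<Pi>\<^sub>M i\<in>insert j J. U)"
      using B sPi IJ(1) by (intro borel_measurable_indicator) simp
  qed
  also have "\<dots> = (\<integral>\<^sup>+x. (\<Prod>i\<in>J. emeasure U {y\<in>space N. (x, y) \<in> S i}) \<partial>U)"
  proof (rule nn_integral_cong)
    fix y assume y: "y \<in> space U"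
    have "indicator B (x(j := y)) = (indicator (\<Pi>\<^sub>E i\<in>J. {z\<in>space N. (y, z) \<in> S i}) x :: ennreal)"
      if "x \<in> space (\<Pi>\<^sub>M i\<in>J. U)" for x
    proof -
      have "x(j := y) \<in> B \<longleftrightarrow> x \<in> (\<Pi>\<^sub>E i\<in>J. {z\<in>space N. (y, z) \<in> S i})"
        using that y IJ(1,3) by (auto simp: B_def space_PiM spU PiE_iff extensional_def)
      then show ?thesis by (simp add: indicator_def)
    qed
    then have "(\<integral>\<^sup>+x. indicator B (x(j := y)) \<partial>(\<Pi>\<^sub>M i\<in>J. U)) =
        (\<integral>\<^sup>+x. indicator (\<Pi>\<^sub>E i\<in>J. {z\<in>space N. (y, z) \<in> S i}) x \<partial>(\<Pi>\<^sub>M i\<in>J. U))"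
      by (rule nn_integral_cong)
    also have "\<dots> = (\<Prod>i\<in>J. emeasure U {z\<in>space N. (y, z) \<in> S i})"
    proof -
      have s: "{z\<in>space N. (y, z) \<in> S i} \<in> sets U" if "i \<in> J" for i
      proof -
        have "Pair y -` S i \<in> sets N" using S[of i] that IJ by (intro sets_Pair1) auto
        moreover have "Pair y -` S i = {z\<in>space N. (y, z) \<in> S i}"
          using sets.sets_into_space[OF S[of i]] that IJ by (auto simp: space_pair_measure)
        ultimately show ?thesis by (simp add: sU)
      qed
      then have "(\<integral>\<^sup>+x. indicator (\<Pi>\<^sub>E i\<in>J. {z\<in>space N. (y, z) \<in> S i}) x \<partial>(\<Pi>\<^sub>M i\<in>J. U)) =
        emeasure (\<Pi>\<^sub>M i\<in>J. U) (\<Pi>\<^sub>E i\<in>J. {z\<in>space N. (y, z) \<in> S i})"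
        using IJ(2) by (intro nn_integral_indicator sets_PiM_I_finite) auto
      also have "\<dots> = (\<Prod>i\<in>J. emeasure U {z\<in>space N. (y, z) \<in> S i})"
        using s IJ(2) by (intro U.emeasure_PiM)
      finally show ?thesis .
    qed
    finally show "(\<integral>\<^sup>+x. indicator B (x(j := y)) \<partial>(\<Pi>\<^sub>M i\<in>J. U)) =
        (\<Prod>i\<in>J. emeasure U {z\<in>space N. (y, z) \<in> S i})" .
  qed
  finally show ?thesis by (simp add: J_def)
qed

text \<open>Membership in the hull is expressed through countably many translation vectors, since
  the defining intersection is uncountable.\<close>
lemma not_in_L_hull_countable:
  fixes L :: "(real^2) set"
  assumes L: "compact L" "L \<noteq> {}" and X: "finite X" "X \<noteq> {}"
    and D: "\<And>S. open S \<Longrightarrow> S \<noteq> {} \<Longrightarrow> \<exists>d\<in>D. d \<in> S"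
  shows "y \<notin> L_hull L X \<longleftrightarrow>
    (\<exists>k. \<forall>m. \<exists>v\<in>D. (\<forall>x\<in>X. infdist (x - v) L < 1 / real (Suc m)) \<and> infdist (y - v) L > 1 / real (Suc k))"
proof
  assume "y \<notin> L_hull L X"
  then obtain v where v: "\<And>x. x \<in> X \<Longrightarrow> x - v \<in> L" "y - v \<notin> L" by (auto simp: in_L_hull_iff)
  have "infdist (y - v) L > 0"
    using v(2) L by (metis compact_imp_closed in_closed_iff_infdist_zero infdist_nonneg order_le_less)
  then obtain k where k: "1 / real (Suc k) < infdist (y - v) L"
    using nat_approx_posE by blast
  show "\<exists>k. \<forall>m. \<exists>v\<in>D. (\<forall>x\<in>X. infdist (x - v) L < 1 / real (Suc m)) \<and> infdist (y - v) L > 1 / real (Suc k)"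
  proof (intro exI allI)
    fix m
    define S where "S = (\<Inter>x\<in>X. {v. infdist (x - v) L < 1 / real (Suc m)}) \<inter> {v. 1 / real (Suc k) < infdist (y - v) L}"
    have "open S"
      unfolding S_def using X(1)
      by (intro open_Int open_INT open_Collect_less continuous_intros ballI)
    moreover have "v \<in> S" using v k L(2) by (auto simp: S_def)
    ultimately obtain d where "d \<in> D" "d \<in> S" using D by blast
    then show "\<exists>v\<in>D. (\<forall>x\<in>X. infdist (x - v) L < 1 / real (Suc m)) \<and> infdist (y - v) L > 1 / real (Suc k)"
      by (auto simp: S_def)
  qed
next
  assume "\<exists>k. \<forall>m. \<exists>v\<in>D. (\<forall>x\<in>X. infdist (x - v) L < 1 / real (Suc m)) \<and> infdist (y - v) L > 1 / real (Suc k)"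
  then obtain k v where v: "\<And>m x. x \<in> X \<Longrightarrow> infdist (x - v m) L < 1 / real (Suc m)"
    "\<And>m. infdist (y - v m) L > 1 / real (Suc k)" by metis
  obtain x0 where x0: "x0 \<in> X" using X by blast
  \<comment> \<open>All these vectors bring \<open>x0\<close> within distance 1 of the compact
    \<open>L\<close>, so a subsequence converges. The gap \<open>1 / real (Suc k)\<close>, fixed
    before \<open>m\<close>, keeps \<open>y\<close> outside the limiting translate.\<close>
  have "bounded (range v)"
  proof -
    obtain B where B: "\<And>z. z \<in> L \<Longrightarrow> norm z \<le> B" using L(1) compact_imp_bounded bounded_iff by metis
    have "norm (v m) \<le> norm x0 + (1 + B)" for m
    proof -
      obtain z where z: "z \<in> L" "infdist (x0 - v m) L = dist (x0 - v m) z"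
        using infdist_attains_inf[OF compact_imp_closed[OF L(1)] L(2)] by metis
      have "dist (x0 - v m) z < 1"
      proof -
        have "dist (x0 - v m) z < 1 / real (Suc m)" using v(1)[OF x0, of m] z(2) by simp
        also have "\<dots> \<le> 1" by simp
        finally show ?thesis .
      qed
      then have "norm (x0 - v m) \<le> 1 + B"
        using B[OF z(1)] norm_triangle_ineq2[of "x0 - v m" z] by (simp add: dist_norm)
      moreover have "v m = x0 - (x0 - v m)" by simp
      then have "norm (v m) \<le> norm x0 + norm (x0 - v m)" by (metis norm_triangle_ineq4)
      ultimately show ?thesis by simp
    qed
    then show ?thesis by (auto simp: bounded_iff)
  qed
  then obtain l r where r: "strict_mono r" "(v \<circ> r) \<longlonglongrightarrow> l"
    using bounded_imp_convergent_subsequence by metis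
  have lim: "(\<lambda>m. infdist (x - v (r m)) L) \<longlonglongrightarrow> infdist (x - l) L" for x
    using r(2) unfolding o_def by (intro tendsto_intros)
  have "x - l \<in> L" if "x \<in> X" for x
  proof -
    have "(\<lambda>m. 1 / real (Suc (r m))) \<longlonglongrightarrow> 0"
      using LIMSEQ_subseq_LIMSEQ[OF LIMSEQ_inverse_real_of_nat r(1)] by (simp add: o_def inverse_eq_divide)
    then have "infdist (x - l) L \<le> 0"
      using v(1)[OF that] by (intro LIMSEQ_le[OF lim]) (auto intro!: exI[of _ 0] less_imp_le)
    then show ?thesis
      using L by (metis compact_imp_closed in_closed_iff_infdist_zero infdist_nonneg order_antisym)
  qed
  moreover have "infdist (y - l) L \<ge> 1 / real (Suc k)"
    using v(2) by (intro LIMSEQ_le[OF tendsto_const lim]) (auto intro!: exI[of _ 0] less_imp_le)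
  then have "infdist (y - l) L > 0" by (rule less_le_trans[rotated]) simp
  then have "y - l \<notin> L" by (auto simp: infdist_zero)
  ultimately show "y \<notin> L_hull L X" by (auto simp: in_L_hull_iff)
qed

lemma measurable_not_in_L_hull:
  fixes L :: "(real^2) set"
  assumes L: "compact L" "L \<noteq> {}" and I: "finite I" "I \<noteq> {}"
    and X[measurable]: "\<And>i. i \<in> I \<Longrightarrow> X i \<in> borel_measurable M" and Y[measurable]: "Y \<in> borel_measurable M"
  shows "{\<omega>\<in>space M. Y \<omega> \<notin> L_hull L ((\<lambda>i. X i \<omega>) ` I)} \<in> sets M"
proof -
  obtain D :: "(real^2) set" where D: "countable D" "\<And>S. open S \<Longrightarrow> S \<noteq> {} \<Longrightarrow> \<exists>d\<in>D. d \<in> S"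
    by (rule countable_dense_setE) blast
  have *: "Y \<omega> \<notin> L_hull L ((\<lambda>i. X i \<omega>) ` I) \<longleftrightarrow>
      (\<exists>k. \<forall>m. \<exists>v\<in>D. (\<forall>i\<in>I. infdist (X i \<omega> - v) L < 1 / real (Suc m)) \<and> infdist (Y \<omega> - v) L > 1 / real (Suc k))" for \<omega>
    by (subst not_in_L_hull_countable[OF L _ _ D(2)]) (use I in auto)
  have inf[measurable]: "(\<lambda>x. infdist x L) \<in> borel_measurable borel"
    by (intro borel_measurable_continuous_onI continuous_intros)
  have [measurable]: "(\<lambda>\<omega>. infdist (X i \<omega> - v) L) \<in> borel_measurable M" if "i \<in> I" for i v
    using measurable_compose[OF borel_measurable_diff[OF X[OF that] borel_measurable_const] inf] by simp
  have [measurable]: "(\<lambda>\<omega>. infdist (Y \<omega> - v) L) \<in> borel_measurable M" for v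
    using measurable_compose[OF borel_measurable_diff[OF Y borel_measurable_const] inf] by simp
  show ?thesis
    unfolding *
    by (intro sets.sets_Collect_countable_Ex sets.sets_Collect_countable_All
        sets.sets_Collect_countable_Ex'[OF _ D(1)] sets.sets_Collect_conj
        sets.sets_Collect_finite_All I borel_measurable_less borel_measurable_const) simp_all
qed

section \<open>Expected missing area as a double integral\<close>

locale two_discs = K: normal_disc K k rK + L: normal_disc_ball L l rL R
  for K k rK L l rL R +
  fixes \<rho> :: real
  assumes rK_le: "\<And>t. rK t \<le> \<rho>" and rho_less: "\<rho> < R"
begin

lemma rho_pos: "\<rho> > 0"
  using rK_le[of 0] K.r_pos[of 0] by simp

lemma K_diam: assumes "x \<in> K" "y \<in> K" shows "norm (x - y) \<le> 2 * \<rho>" "norm (x - y) < 2 * R"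
proof -
  define c where "c = k 0 - \<rho> *\<^sub>R nu 0"
  have "x \<in> cball c \<rho>" "y \<in> cball c \<rho>" using K.subset_cball[OF rK_le, of 0] assms by (auto simp: c_def)
  then show "norm (x - y) \<le> 2 * \<rho>" 
    using dist_triangle2[of x y c] by (simp add: dist_norm norm_minus_commute)
  then show "norm (x - y) < 2 * R" using rho_less by simp
qed

lemma K_translate: obtains v0 where "\<And>x. x \<in> K \<Longrightarrow> x - v0 \<in> L"
proof -
  define c where "c = k 0 - \<rho> *\<^sub>R nu 0"
  define c' where "c' = l 0 - R *\<^sub>R nu 0"
  have "x - (c - c') \<in> L" if "x \<in> K" for x
  proof -
    have "x \<in> cball c \<rho>" using K.subset_cball[OF rK_le, of 0] that by (auto simp: c_def)
    moreover have "c' - (x - (c - c')) = c - x" by simp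
    ultimately have "x - (c - c') \<in> cball c' R" using rho_less by (simp add: dist_norm)
    then show ?thesis using L.cball_subset[OF L.R(2), of 0] by (auto simp: c'_def)
  qed
  then show ?thesis by (rule that)
qed

definition A :: real where "A = measure lborel K"

text \<open>A total measurable version of the chord start; 0 is a default value. Distinct points of
  \<open>K\<close> differ by vectors that fall under the first case.\<close>

definition Z :: "real^2 \<Rightarrow> real^2" where
  "Z w = (if w \<noteq> 0 \<and> norm w < 2 * R then chord_start L w else 0)"

text \<open>The probability that a uniform point of \<open>K\<close> falls into the translate of
  \<open>L\<close> by \<open>v\<close>.\<close>

definition g :: "real^2 \<Rightarrow> real" where
  "g v = measure lborel (K \<inter> {z. z - v \<in> L}) / A"

lemma K_sets [measurable]: "K \<in> sets borel" and L_sets [measurable]: "L \<in> sets borel"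
  using K.closed L.closed by (auto intro: borel_closed)

lemma K_finite: "emeasure lborel K < \<infinity>"
  using K.compact by (rule emeasure_compact_finite)

lemma A_pos: "A > 0" and A_eq: "emeasure lborel K = ennreal A"
proof -
  show e: "emeasure lborel K = ennreal A"
    unfolding A_def using K_finite by (intro emeasure_eq_ennreal_measure) auto
  obtain x where "x \<in> interior K" using K.interior_nonempty by blast
  then obtain e where e: "e > 0" "ball x e \<subseteq> K" by (meson mem_interior)
  have "ball x e \<notin> null_sets lborel"
  proof
    assume "ball x e \<in> null_sets lborel"
    then have "negligible (ball x e)"
      by (simp add: negligible_iff_null_sets null_sets_completionI)
    then show False using open_not_negligible[of "ball x e"] e(1) by simp
  qed
  then have "0 < emeasure lborel (ball x e)"
    by (simp add: null_sets_def zero_less_iff_neq_zero)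
  also have "\<dots> \<le> emeasure lborel K" using e by (intro emeasure_mono) auto
  finally show "A > 0" using e by (simp add: \<open>emeasure lborel K = ennreal A\<close>)
qed

lemma Z_measurable [measurable]: "Z \<in> borel_measurable borel"
proof -
  have "{w :: real^2. w \<noteq> 0 \<and> norm w < 2 * R} \<in> sets borel"
    by (intro borel_open open_Collect_conj open_Collect_neq open_Collect_less continuous_intros)
  moreover have "(\<lambda>w. if w \<in> {w. w \<noteq> 0 \<and> norm w < 2 * R} then chord_start L w else 0) \<in> borel_measurable borel"
    by (intro borel_measurable_continuous_on_if calculation L.chord_start_continuous continuous_intros)
  ultimately show ?thesis by (simp add: Z_def[abs_def])
qed

lemma translate_sets: "{z. z - v \<in> L} \<in> sets borel"
  by measurable

lemma emeasure_K_translate: "emeasure lborel (K \<inter> {z. z - v \<in> L}) = ennreal (A * g v)"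
proof -
  have "emeasure lborel (K \<inter> {z. z - v \<in> L}) \<le> emeasure lborel K"
    by (intro emeasure_mono) auto
  also note K_finite
  finally show ?thesis
    using A_pos by (subst emeasure_eq_ennreal_measure) (auto simp: g_def)
qed

lemma g_nonneg: "0 \<le> g v" and g_le_1: "g v \<le> 1"
proof -
  show "0 \<le> g v" using A_pos by (simp add: g_def)
  have "measure lborel (K \<inter> {z. z - v \<in> L}) \<le> A"
    unfolding A_def using K_finite translate_sets by (intro measure_mono_fmeasurable) (auto simp: fmeasurable_def)
  then show "g v \<le> 1" using A_pos by (simp add: g_def)
qed

lemma g_measurable [measurable]: "g \<in> borel_measurable borel"
proof -
  have "(\<lambda>v. emeasure lborel (Pair v -` {(v, z). z \<in> K \<and> z - v \<in> L})) \<in> borel_measurable borel"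
  proof (rule lborel.measurable_emeasure_Pair)
    have "{(v, z). z \<in> K \<and> z - v \<in> L} = {p \<in> space (borel \<Otimes>\<^sub>M lborel). snd p \<in> K \<and> snd p - fst p \<in> L}"
      by (auto simp: space_pair_measure)
    also have "\<dots> \<in> sets (borel \<Otimes>\<^sub>M lborel)" by measurable
    finally show "{(v, z). z \<in> K \<and> z - v \<in> L} \<in> sets (borel \<Otimes>\<^sub>M lborel)" .
  qed
  moreover have "Pair v -` {(v, z). z \<in> K \<and> z - v \<in> L} = K \<inter> {z. z - v \<in> L}" for v by auto
  ultimately have "(\<lambda>v. enn2real (emeasure lborel (K \<inter> {z. z - v \<in> L})) / A) \<in> borel_measurable borel"
    by simp
  then show ?thesis by (simp add: g_def[abs_def] measure_def)
qed

lemma frontier_L_null: "frontier L \<in> null_sets lborel"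
  using negligible_convex_frontier[OF L.convex]
  by (simp add: negligible_iff_null_sets null_sets_completion_iff borel_closed frontier_closed)

lemma null_translate: "N \<in> null_sets lborel \<Longrightarrow> {z :: real^2. a + z \<in> N} \<in> null_sets lborel"
  using null_sets_translation[of N "- a"] by (simp add: add.commute)

end

text \<open>Removes the points for which the certificates do not decide membership in the
  hull.\<close>

lemma L_hull_frontier_null:
  fixes L :: "(real^2) set"
  assumes "convex L" shows "frontier (L_hull L X) \<in> null_sets lborel"
  using negligible_convex_frontier[OF convex_L_hull[OF assms]]
  by (simp add: negligible_iff_null_sets null_sets_completion_iff borel_closed frontier_closed)

locale disc_sample = two_discs K k rK L l rL R \<rho> + P: prob_space P
  for K k rK L l rL R \<rho> and P :: "'w measure" +
  fixes X :: "nat \<Rightarrow> 'w \<Rightarrow> real^2" and n :: nat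
  assumes indep: "prob_space.indep_vars P (\<lambda>_. borel) X UNIV"
    and distr: "\<And>i. distr P borel (X i) = uniform_measure lborel K"
    and n: "n \<ge> 1"
begin

definition I :: "nat set" where "I = {1..n}"

lemma I: "finite I" "I \<noteq> {}" "card I = n" using n by (auto simp: I_def)

lemma X_measurable [measurable]: "X i \<in> borel_measurable P"
  using indep by (auto simp: P.indep_vars_def)

abbreviation H :: "'w \<Rightarrow> (real^2) set" where "H \<omega> \<equiv> L_hull L ((\<lambda>i. X i \<omega>) ` I)"

text \<open>The event that \<open>X j\<close> certifies that \<open>y\<close> is missed: the translate of \<open>L\<close> that has \<open>y\<close> on its boundary
  and the chord from \<open>y\<close> to \<open>X j\<close> on the clockwise side contains the whole sample. If \<open>y\<close> is outside the hull,
  almost surely exactly one index \<open>j\<close> has this property.\<close>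
definition E :: "real^2 \<Rightarrow> nat \<Rightarrow> 'w set" where
  "E y j = {\<omega>\<in>space P. \<forall>i\<in>I - {j}. (X j \<omega>, X i \<omega>) \<in> {(x, x'). Z (x - y) + (x' - y) \<in> L}}"

lemma E_sets: "E y j \<in> sets P"
proof -
  have "E y j = {\<omega>\<in>space P. \<forall>i\<in>I - {j}. Z (X j \<omega> - y) + (X i \<omega> - y) \<in> L}" by (simp add: E_def)
  also have "\<dots> \<in> sets P" using I(1) by measurable
  finally show ?thesis .
qed

lemma emeasure_uniform: "S \<in> sets borel \<Longrightarrow> emeasure (uniform_measure lborel K) S = emeasure lborel (K \<inter> S) / ennreal A"
  by (subst emeasure_uniform_measure) (auto simp: A_eq)

text \<open>Given \<open>X j = x\<close>, the other \<open>n - 1\<close> points must fall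
  independently into the translate of \<open>L\<close> by \<open>y - Z (x - y)\<close>, which places
  the start of the chord at \<open>y\<close>.\<close>

lemma emeasure_E:
  assumes "j \<in> I"
  shows "emeasure P (E y j) = (\<integral>\<^sup>+x. ennreal (g (y - Z (x - y)) ^ (n - 1)) \<partial>uniform_measure lborel K)"
proof -
  have S: "{(x, x'). Z (x - y) + (x' - y) \<in> L} \<in> sets (borel \<Otimes>\<^sub>M borel)"
  proof -
    have "{(x, x'). Z (x - y) + (x' - y) \<in> L} = {p\<in>space (borel \<Otimes>\<^sub>M borel). Z (fst p - y) + (snd p - y) \<in> L}"
      by (auto simp: space_pair_measure)
    also have "\<dots> \<in> sets (borel \<Otimes>\<^sub>M borel)" by measurable
    finally show ?thesis .
  qed
  have "P.indep_vars (\<lambda>_. borel) X I" by (rule P.indep_vars_subset[OF indep]) simp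
  from P.emeasure_indep_star[OF this I(1) assms distr S]
  have "emeasure P (E y j) = (\<integral>\<^sup>+x. (\<Prod>i\<in>I - {j}. emeasure (uniform_measure lborel K)
      {x'\<in>space borel. (x, x') \<in> {(x, x'). Z (x - y) + (x' - y) \<in> L}}) \<partial>uniform_measure lborel K)"
    unfolding E_def .
  also have "\<dots> = (\<integral>\<^sup>+x. ennreal (g (y - Z (x - y)) ^ (n - 1)) \<partial>uniform_measure lborel K)"
  proof (rule nn_integral_cong)
    fix x :: "real^2"
    have "{x'\<in>space borel. (x, x') \<in> {(x, x'). Z (x - y) + (x' - y) \<in> L}} = {z. z - (y - Z (x - y)) \<in> L}"
      by (simp add: algebra_simps)
    moreover have "emeasure (uniform_measure lborel K) {z. z - (y - Z (x - y)) \<in> L} = ennreal (g (y - Z (x - y)))"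
      using A_pos unfolding emeasure_uniform[OF translate_sets] emeasure_K_translate
      by (simp add: divide_ennreal g_nonneg)
    moreover have "card (I - {j}) = n - 1" using assms I by simp
    ultimately show "(\<Prod>i\<in>I - {j}. emeasure (uniform_measure lborel K)
      {x'\<in>space borel. (x, x') \<in> {(x, x'). Z (x - y) + (x' - y) \<in> L}}) = ennreal (g (y - Z (x - y)) ^ (n - 1))"
      by (simp add: ennreal_power g_nonneg)
  qed
  finally show ?thesis .
qed

lemma AE_in_K: "AE \<omega> in P. X i \<omega> \<in> K"
proof (rule AE_distrD[OF X_measurable])
  show "AE x in distr P borel (X i). x \<in> K" unfolding distr by (rule AE_uniform_measureI) auto
qed

lemma AE_neq: "AE \<omega> in P. X i \<omega> \<noteq> y"
proof (rule AE_distrD[OF X_measurable])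
  show "AE x in distr P borel (X i). x \<noteq> y"
    unfolding distr using AE_lborel_singleton[of y] by (intro AE_uniform_measureI) auto
qed

text \<open>Excludes ties: two certificates for the same \<open>y\<close> would put one sample point
  on the boundary of the translate determined by the other.\<close>

lemma AE_frontier: assumes "i \<noteq> j" shows "AE \<omega> in P. Z (X j \<omega> - y) + (X i \<omega> - y) \<notin> frontier L"
proof -
  have F: "frontier L \<in> sets borel" by (simp add: borel_closed)
  have S: "{(x, x'). Z (x - y) + (x' - y) \<in> frontier L} \<in> sets (borel \<Otimes>\<^sub>M borel)"
  proof -
    have "{(x, x'). Z (x - y) + (x' - y) \<in> frontier L} = {p\<in>space (borel \<Otimes>\<^sub>M borel). Z (fst p - y) + (snd p - y) \<in> frontier L}"
      by (auto simp: space_pair_measure)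
    also have "\<dots> \<in> sets (borel \<Otimes>\<^sub>M borel)" using F by measurable
    finally show ?thesis .
  qed
  have "P.indep_vars (\<lambda>_. borel) X {i, j}" by (rule P.indep_vars_subset[OF indep]) simp
  from P.emeasure_indep_star[OF this _ _ distr S, of j]
  have "emeasure P {\<omega>\<in>space P. \<forall>a\<in>{i, j} - {j}. (X j \<omega>, X a \<omega>) \<in> {(x, x'). Z (x - y) + (x' - y) \<in> frontier L}} =
     (\<integral>\<^sup>+x. (\<Prod>a\<in>{i, j} - {j}. emeasure (uniform_measure lborel K)
      {x'\<in>space borel. (x, x') \<in> {(x, x'). Z (x - y) + (x' - y) \<in> frontier L}}) \<partial>uniform_measure lborel K)"
    by simp
  also have "{i, j} - {j} = {i}" using assms by auto
  also have "(\<integral>\<^sup>+x. (\<Prod>a\<in>{i}. emeasure (uniform_measure lborel K)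
      {x'\<in>space borel. (x, x') \<in> {(x, x'). Z (x - y) + (x' - y) \<in> frontier L}}) \<partial>uniform_measure lborel K)
      = (\<integral>\<^sup>+x. 0 \<partial>uniform_measure lborel K)"
  proof (rule nn_integral_cong)
    fix x :: "real^2"
    have "{x'\<in>space borel. (x, x') \<in> {(x, x'). Z (x - y) + (x' - y) \<in> frontier L}} = {z. (Z (x - y) - y) + z \<in> frontier L}"
      by (simp add: algebra_simps)
    moreover have N: "{z. (Z (x - y) - y) + z \<in> frontier L} \<in> null_sets lborel"
      by (rule null_translate[OF frontier_L_null])
    moreover have "K \<inter> {z. (Z (x - y) - y) + z \<in> frontier L} \<in> null_sets lborel"
      using null_set_Int1[OF N, of K] by (simp add: Int_commute)
    moreover have "emeasure (uniform_measure lborel K) {z. (Z (x - y) - y) + z \<in> frontier L} = 0"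
      using emeasure_uniform[of "{z. (Z (x - y) - y) + z \<in> frontier L}"] null_setsD2[OF N] calculation(3)
      by (simp add: null_setsD1)
    ultimately show "(\<Prod>a\<in>{i}. emeasure (uniform_measure lborel K)
      {x'\<in>space borel. (x, x') \<in> {(x, x'). Z (x - y) + (x' - y) \<in> frontier L}}) = 0"
      by simp
  qed
  finally have "emeasure P {\<omega>\<in>space P. Z (X j \<omega> - y) + (X i \<omega> - y) \<in> frontier L} = 0" by simp
  moreover have "{\<omega>\<in>space P. Z (X j \<omega> - y) + (X i \<omega> - y) \<in> frontier L} \<in> sets P" using F by measurable
  ultimately show ?thesis by (subst AE_iff_measurable[OF _ refl]) auto
qed

text \<open>By \<open>successor_unique\<close>, chords of two certifying points share their start,
  so one of the points would lie on the boundary of the other's translate. The events are thus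
  almost surely disjoint.\<close>

lemma successor_sum:
  assumes y: "y \<in> K"
  shows "(\<integral>\<^sup>+\<omega>. indicator (\<Union>j\<in>I. E y j) \<omega> \<partial>P) = (\<Sum>j\<in>I. emeasure P (E y j))"
proof -
  have "AE \<omega> in P. \<forall>i\<in>I. X i \<omega> \<in> K \<and> X i \<omega> \<noteq> y \<and> (\<forall>j\<in>I - {i}. Z (X j \<omega> - y) + (X i \<omega> - y) \<notin> frontier L)"
    using I(1) AE_in_K AE_neq AE_frontier by (intro AE_finite_allI AE_conjI) auto
  then have "AE \<omega> in P. indicator (\<Union>j\<in>I. E y j) \<omega> = (\<Sum>j\<in>I. indicator (E y j) \<omega> :: ennreal)"
  proof eventually_elim
    case (elim \<omega>)
    have w: "X i \<omega> - y \<noteq> 0" "norm (X i \<omega> - y) < 2 * R" if "i \<in> I" for i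
      using elim that K_diam(2)[OF _ y] by auto
    have "i = j" if "i \<in> I" "j \<in> I" "\<omega> \<in> E y i" "\<omega> \<in> E y j" for i j
    proof (rule ccontr)
      assume ne: "i \<noteq> j"
      have "chord_start L (X i \<omega> - y) + (X j \<omega> - y) \<in> L" "chord_start L (X j \<omega> - y) + (X i \<omega> - y) \<in> L"
        using that ne w by (auto simp: E_def Z_def)
      from L.successor_unique[OF w[OF that(1)] w[OF that(2)] this]
      have "Z (X i \<omega> - y) + (X j \<omega> - y) \<in> frontier L"
        using L.chord_start_frontier(2)[OF w[OF that(2)]] w[OF that(1)] by (simp add: Z_def)
      then show False using elim that ne by blast
    qed
    then have "disjoint_family_on (\<lambda>j. E y j \<inter> {\<omega>}) I"
      by (auto simp: disjoint_family_on_def)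
    then show ?case
    proof (cases "\<exists>j\<in>I. \<omega> \<in> E y j")
      case True
      then obtain j where j: "j \<in> I" "\<omega> \<in> E y j" by blast
      have "(\<Sum>i\<in>I. indicator (E y i) \<omega> :: ennreal) = (\<Sum>i\<in>I. if i = j then 1 else 0)"
        using j \<open>\<And>i j. i \<in> I \<Longrightarrow> j \<in> I \<Longrightarrow> \<omega> \<in> E y i \<Longrightarrow> \<omega> \<in> E y j \<Longrightarrow> i = j\<close>
        by (intro sum.cong) (auto simp: indicator_def)
      also have "\<dots> = 1" using I(1) j by simp
      finally show ?thesis using j by (auto simp: indicator_def)
    qed (auto simp: indicator_def)
  qed
  then have "(\<integral>\<^sup>+\<omega>. indicator (\<Union>j\<in>I. E y j) \<omega> \<partial>P) = (\<integral>\<^sup>+\<omega>. (\<Sum>j\<in>I. indicator (E y j) \<omega>) \<partial>P)"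
    by (rule nn_integral_cong_AE)
  also have "\<dots> = (\<Sum>j\<in>I. emeasure P (E y j))"
    using E_sets by (subst nn_integral_sum) auto
  finally show ?thesis .
qed

text \<open>Sliding to the first extreme chord turns a separating translate into a certificate.
  Conversely, the certifying translate has \<open>y\<close> on its boundary, and boundary points of
  the hull are excluded.\<close>

lemma missing_iff:
  assumes "\<And>i. i \<in> I \<Longrightarrow> X i \<omega> \<in> K" "\<omega> \<in> space P"
    and y: "y \<in> K" "y \<notin> (\<lambda>i. X i \<omega>) ` I" "y \<notin> frontier (H \<omega>)"
  shows "y \<notin> H \<omega> \<longleftrightarrow> \<omega> \<in> (\<Union>j\<in>I. E y j)"
proof -
  define W where "W = (\<lambda>i. X i \<omega> - y) ` I"
  have W: "finite W" "W \<noteq> {}" "\<And>w. w \<in> W \<Longrightarrow> w \<noteq> 0 \<and> norm w < 2 * R"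
    using I assms K_diam(2)[OF _ y(1)] by (auto simp: W_def)
  show ?thesis
  proof
    assume "y \<notin> H \<omega>"
    obtain v0 where v0: "\<And>x. x \<in> K \<Longrightarrow> x - v0 \<in> L" using K_translate by blast
    obtain p where p: "p \<in> frontier L" "\<And>x. x \<in> (\<lambda>i. X i \<omega>) ` I \<Longrightarrow> p + (x - y) \<in> L"
      by (rule not_in_L_hull[OF L.convex _ \<open>y \<notin> H \<omega>\<close>]) (use v0 assms(1) y in auto)
    then have "\<exists>w\<in>W. \<forall>w'\<in>W. chord_start L w + w' \<in> L"
      by (intro L.successor_exists[OF W]) (auto simp: W_def)
    then obtain w where w: "w \<in> W" "\<And>w'. w' \<in> W \<Longrightarrow> chord_start L w + w' \<in> L" by blast
    then obtain j where j: "j \<in> I" "w = X j \<omega> - y" by (auto simp: W_def)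
    have "Z w = chord_start L w" using W(3)[OF w(1)] by (simp add: Z_def)
    moreover have "X i \<omega> - y \<in> W" if "i \<in> I" for i using that by (auto simp: W_def)
    ultimately have "\<omega> \<in> E y j"
      using w(2) j(2) assms(2) by (auto simp: E_def)
    then show "\<omega> \<in> (\<Union>j\<in>I. E y j)" using j(1) by blast
  next
    assume "\<omega> \<in> (\<Union>j\<in>I. E y j)"
    then obtain j where j: "j \<in> I" "\<omega> \<in> E y j" by blast
    define w where "w = X j \<omega> - y"
    have w: "w \<noteq> 0" "norm w < 2 * R" using W(3)[of w] j(1) by (auto simp: W_def w_def)
    have "chord_start L w + (x - y) \<in> L" if x: "x \<in> (\<lambda>i. X i \<omega>) ` I" for x
    proof -
      obtain i where i: "i \<in> I" "x = X i \<omega>" using x by blast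
      show ?thesis
        using j i L.chord_start(2)[OF w(2)] w by (cases "i = j") (auto simp: E_def Z_def w_def)
    qed
    from not_in_interior_L_hull[OF L.chord_start_frontier(1)[OF w] this]
    show "y \<notin> H \<omega>" using y(3) closure_subset[of "H \<omega>"] by (auto simp: frontier_def)
  qed
qed

text \<open>Fubini exchanges the sample and the missed point. The \<open>n\<close> certificates have
  equal probability, and the uniform density contributes \<open>1 / A\<close>.\<close>

lemma nn_expectation:
  "(\<integral>\<^sup>+\<omega>. emeasure lborel (K - H \<omega>) \<partial>P) = ennreal (real n / A) *
    (\<integral>\<^sup>+y. \<integral>\<^sup>+x. indicator K y * indicator K x * ennreal (g (y - Z (x - y)) ^ (n - 1)) \<partial>lborel \<partial>lborel)"
proof -
  interpret pair_sigma_finite P lborel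
    by (simp add: pair_sigma_finite_def P.sigma_finite_measure_axioms sigma_finite_lborel)
  have H_sets: "K - H \<omega> \<in> sets borel" for \<omega>
    using closed_L_hull[OF L.closed] by (auto intro: borel_closed)
  \<comment> \<open>The certificates are jointly measurable in sample and point, so this set stands
    in for the missing region when the integrals are exchanged.\<close>
  have Q: "{p\<in>space (P \<Otimes>\<^sub>M lborel). \<exists>j\<in>I. \<forall>i\<in>I - {j}. Z (X j (fst p) - snd p) + (X i (fst p) - snd p) \<in> L}
      \<in> sets (P \<Otimes>\<^sub>M lborel)" (is "?Q \<in> _")
    using I(1) by measurable
  have Qe: "indicator ?Q (\<omega>, y) = (indicator (\<Union>j\<in>I. E y j) \<omega> :: ennreal)" if "\<omega> \<in> space P" for \<omega> y
    using that by (auto simp: E_def indicator_def space_pair_measure)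
  have mQ: "(\<lambda>p. indicator K (snd p) * indicator ?Q p :: ennreal) \<in> borel_measurable (P \<Otimes>\<^sub>M lborel)"
    using Q by measurable
  have "AE \<omega> in P. emeasure lborel (K - H \<omega>) = (\<integral>\<^sup>+y. indicator K y * indicator ?Q (\<omega>, y) \<partial>lborel)"
  proof -
    have "AE \<omega> in P. \<forall>i\<in>I. X i \<omega> \<in> K"
      using I(1) AE_in_K by (intro AE_finite_allI) auto
    then show ?thesis
      using AE_space
    proof eventually_elim
      case (elim \<omega>)
      have "AE y in lborel. indicator (K - H \<omega>) y = (indicator K y * indicator ?Q (\<omega>, y) :: ennreal)"
      proof -
        have "(\<lambda>i. X i \<omega>) ` I \<in> null_sets lborel"
          using I(1) by (intro countable_imp_null_set_lborel) (auto intro: countable_finite)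
        from AE_not_in[OF this] AE_not_in[OF L_hull_frontier_null[OF L.convex, of "(\<lambda>i. X i \<omega>) ` I"]]
        show ?thesis
        proof eventually_elim
          case (elim y)
          show ?case
          proof (cases "y \<in> K")
            case True
            have "y \<notin> H \<omega> \<longleftrightarrow> \<omega> \<in> (\<Union>j\<in>I. E y j)"
              using \<open>\<forall>i\<in>I. X i \<omega> \<in> K\<close> \<open>\<omega> \<in> space P\<close> True elim by (intro missing_iff) auto
            then show ?thesis using True Qe[OF \<open>\<omega> \<in> space P\<close>, of y] by (simp add: indicator_def)
          qed simp
        qed
      qed
      then have "(\<integral>\<^sup>+y. indicator (K - H \<omega>) y \<partial>lborel) = (\<integral>\<^sup>+y. indicator K y * indicator ?Q (\<omega>, y) \<partial>lborel)"
        by (rule nn_integral_cong_AE)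
      then show ?case using H_sets by simp
    qed
  qed
  then have "(\<integral>\<^sup>+\<omega>. emeasure lborel (K - H \<omega>) \<partial>P) = (\<integral>\<^sup>+\<omega>. \<integral>\<^sup>+y. indicator K y * indicator ?Q (\<omega>, y) \<partial>lborel \<partial>P)"
    by (rule nn_integral_cong_AE)
  also have "\<dots> = (\<integral>\<^sup>+y. \<integral>\<^sup>+\<omega>. indicator K y * indicator ?Q (\<omega>, y) \<partial>P \<partial>lborel)"
    using Fubini[OF mQ] by simp
  also have "\<dots> = (\<integral>\<^sup>+y. indicator K y * (of_nat n * (\<integral>\<^sup>+x. ennreal (g (y - Z (x - y)) ^ (n - 1)) \<partial>uniform_measure lborel K)) \<partial>lborel)"
  proof (rule nn_integral_cong)
    fix y :: "real^2"
    have "(\<integral>\<^sup>+\<omega>. indicator K y * indicator ?Q (\<omega>, y) \<partial>P) = (\<integral>\<^sup>+\<omega>. indicator K y * indicator (\<Union>j\<in>I. E y j) \<omega> \<partial>P)"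
      by (rule nn_integral_cong) (simp only: Qe)
    also have "\<dots> = indicator K y * (\<integral>\<^sup>+\<omega>. indicator (\<Union>j\<in>I. E y j) \<omega> \<partial>P)"
      using E_sets I(1) by (intro nn_integral_cmult) auto
    also have "\<dots> = indicator K y * (\<Sum>j\<in>I. emeasure P (E y j))"
      by (cases "y \<in> K") (simp_all only: successor_sum, simp)
    also have "(\<Sum>j\<in>I. emeasure P (E y j)) = of_nat n * (\<integral>\<^sup>+x. ennreal (g (y - Z (x - y)) ^ (n - 1)) \<partial>uniform_measure lborel K)"
      by (simp add: emeasure_E I(3))
    finally show "(\<integral>\<^sup>+\<omega>. indicator K y * indicator ?Q (\<omega>, y) \<partial>P) = indicator K y * (of_nat n * (\<integral>\<^sup>+x. ennreal (g (y - Z (x - y)) ^ (n - 1)) \<partial>uniform_measure lborel K))" .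
  qed
  also have "\<dots> = (\<integral>\<^sup>+y. ennreal (real n / A) * (\<integral>\<^sup>+x. indicator K y * indicator K x * ennreal (g (y - Z (x - y)) ^ (n - 1)) \<partial>lborel) \<partial>lborel)"
  proof (rule nn_integral_cong)
    fix y :: "real^2"
    define J where "J = (\<integral>\<^sup>+x. ennreal (g (y - Z (x - y)) ^ (n - 1)) * indicator K x \<partial>lborel)"
    have "(\<integral>\<^sup>+x. ennreal (g (y - Z (x - y)) ^ (n - 1)) \<partial>uniform_measure lborel K) = J / ennreal A"
      unfolding J_def A_eq[symmetric] by (rule nn_integral_uniform_measure) auto
    moreover have "(\<integral>\<^sup>+x. indicator K y * indicator K x * ennreal (g (y - Z (x - y)) ^ (n - 1)) \<partial>lborel) = indicator K y * J"
      unfolding J_def by (subst nn_integral_cmult[symmetric]) (auto simp: ac_simps)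
    moreover have "of_nat n * (J / ennreal A) = ennreal (real n / A) * J"
      using A_pos by (simp add: divide_ennreal_def inverse_ennreal ennreal_of_nat_eq_real_of_nat ennreal_mult
        ac_simps divide_inverse)
    ultimately show "indicator K y * (of_nat n * (\<integral>\<^sup>+x. ennreal (g (y - Z (x - y)) ^ (n - 1)) \<partial>uniform_measure lborel K))
      = ennreal (real n / A) * (\<integral>\<^sup>+x. indicator K y * indicator K x * ennreal (g (y - Z (x - y)) ^ (n - 1)) \<partial>lborel)"
      by (simp only: mult.left_commute)
  qed
  also have "\<dots> = ennreal (real n / A) *
    (\<integral>\<^sup>+y. \<integral>\<^sup>+x. indicator K y * indicator K x * ennreal (g (y - Z (x - y)) ^ (n - 1)) \<partial>lborel \<partial>lborel)"
    by (intro nn_integral_cmult) measurable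
  finally show ?thesis .
qed

text \<open>The passage to the nonnegative integral needs measurability of the missing area in the
  sample, which comes from joint measurability of hull membership.\<close>

lemma expectation_eq:
  "(\<integral>\<omega>. area (K - H \<omega>) \<partial>P) = enn2real (\<integral>\<^sup>+\<omega>. emeasure lborel (K - H \<omega>) \<partial>P)"
proof -
  have "emeasure lborel (K - H \<omega>) \<le> emeasure lborel K" for \<omega>
    by (intro emeasure_mono) auto
  then have fin: "emeasure lborel (K - H \<omega>) = ennreal (area (K - H \<omega>))" for \<omega>
    using K_finite by (intro emeasure_eq_ennreal_measure) (metis infinity_ennreal_def leD top.not_eq_extremum)
  have "{p\<in>space (P \<Otimes>\<^sub>M borel). snd p \<notin> L_hull L ((\<lambda>i. X i (fst p)) ` I)} \<in> sets (P \<Otimes>\<^sub>M borel)"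
    using L.compact L.m_in I by (intro measurable_not_in_L_hull[where X = "\<lambda>i p. X i (fst p)"]) auto
  then have "(UNIV \<times> K) \<inter> {p\<in>space (P \<Otimes>\<^sub>M borel). snd p \<notin> L_hull L ((\<lambda>i. X i (fst p)) ` I)} \<in> sets (P \<Otimes>\<^sub>M borel)"
    (is "?Q \<in> _")
  proof -
    have "{p\<in>space (P \<Otimes>\<^sub>M borel). snd p \<in> K} \<in> sets (P \<Otimes>\<^sub>M borel)" by measurable
    from sets.Int[OF this \<open>{p\<in>space (P \<Otimes>\<^sub>M borel). snd p \<notin> L_hull L ((\<lambda>i. X i (fst p)) ` I)} \<in> sets (P \<Otimes>\<^sub>M borel)\<close>]
    show ?thesis by (rule back_subst[where P="\<lambda>x. x \<in> sets (P \<Otimes>\<^sub>M borel)"]) auto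
  qed
  then have "?Q \<in> sets (P \<Otimes>\<^sub>M lborel)" by (simp cong: sets_pair_measure_cong)
  then have "(\<lambda>\<omega>. emeasure lborel (Pair \<omega> -` ?Q)) \<in> borel_measurable P"
    by (rule lborel.measurable_emeasure_Pair)
  moreover have "Pair \<omega> -` ?Q = K - H \<omega>" if "\<omega> \<in> space P" for \<omega>
    using that by (auto simp: space_pair_measure)
  ultimately have "(\<lambda>\<omega>. emeasure lborel (K - H \<omega>)) \<in> borel_measurable P"
    by (simp cong: measurable_cong)
  then have "(\<lambda>\<omega>. area (K - H \<omega>)) \<in> borel_measurable P"
    unfolding measure_def by measurable
  then have "(\<integral>\<omega>. area (K - H \<omega>) \<partial>P) = enn2real (\<integral>\<^sup>+\<omega>. ennreal (area (K - H \<omega>)) \<partial>P)"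
    by (intro integral_eq_nn_integral) auto
  then show ?thesis by (simp only: fin)
qed

end

section \<open>Integral transformations\<close>

lemma mult_cos_sin: "z * (cos t * cos t) + z * (sin t * sin t) = z" for z t :: real
  using sin_cos_squared_add3[of t] by (metis distrib_left mult.right_neutral)

text \<open>Lebesgue measure is determined by its values on boxes. On a box, the image measure of
  the density \<open>J\<close> is the area of the image of the preimage, which is the box up to a
  negligible set.\<close>

lemma nn_integral_change_of_variables_real2:
  fixes G :: "real^2 \<Rightarrow> real^2" and f :: "real^2 \<Rightarrow> ennreal"
  assumes D [measurable]: "D \<in> sets borel" and G [measurable]: "G \<in> borel_measurable borel"
    and deriv: "\<And>x. x \<in> D \<Longrightarrow> (G has_derivative G' x) (at x)" and inj: "inj_on G D"
    and img: "negligible (- G ` D)"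
    and J: "\<And>x. x \<in> D \<Longrightarrow> \<bar>det (matrix (G' x))\<bar> = J x" and [measurable]: "J \<in> borel_measurable borel"
    and f [measurable]: "f \<in> borel_measurable borel"
  shows "(\<integral>\<^sup>+w. f w \<partial>lborel) = (\<integral>\<^sup>+x. f (G x) * (ennreal (J x) * indicator D x) \<partial>lborel)"
proof -
  define N where "N = distr (density lborel (\<lambda>x. ennreal (J x) * indicator D x)) borel G"
  have "emeasure N (box l u) = emeasure lborel (box l u)" for l u
  proof -
    define S where "S = D \<inter> G -` box l u"
    have S: "S \<in> sets borel"
      unfolding S_def using measurable_sets[OF G, of "box l u"] by (intro sets.Int D) (auto simp: borel_open)
    have GS: "G ` S = box l u \<inter> G ` D" by (auto simp: S_def)
    have neg: "negligible (box l u - G ` S \<union> (G ` S - box l u))"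
      by (rule negligible_subset[OF img]) (auto simp: GS)
    have "G ` S \<in> lmeasurable" "measure lebesgue (G ` S) = measure lebesgue (box l u)"
      using lmeasurable_negligible_symdiff[OF _ neg] measure_negligible_symdiff[OF _ neg] by auto
    then have "((\<lambda>x. \<bar>det (matrix (G' x))\<bar>) has_integral measure lebesgue (box l u)) S"
      using S deriv inj
      by (subst has_measure_differentiable_image[of S G G', symmetric])
        (auto simp: S_def intro: has_derivative_at_withinI inj_on_subset)
    then have hi: "(J has_integral measure lebesgue (box l u)) S"
      by (rule has_integral_eq[rotated]) (simp add: J S_def)
    have Jn: "J x \<ge> 0" if "x \<in> S" for x using J[of x] that by (auto simp: S_def)
    have "emeasure N (box l u) = (\<integral>\<^sup>+x. (ennreal (J x) * indicator D x) * indicator (G -` box l u) x \<partial>lborel)"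
      unfolding N_def
      using measurable_sets[OF G, of "box l u"]
      by (subst emeasure_distr) (auto simp: emeasure_density borel_open)
    also have "\<dots> = (\<integral>\<^sup>+x. ennreal (J x) * indicator S x \<partial>lborel)"
      by (intro nn_integral_cong) (auto simp: S_def indicator_def)
    also have "\<dots> = ennreal (measure lebesgue (box l u))"
      by (rule nn_integral_has_integral_lebesgue'[OF Jn hi])
    also have "\<dots> = emeasure lborel (box l u)"
      using emeasure_bounded_finite[of "box l u"] by (simp add: emeasure_eq_ennreal_measure less_top)
    finally show ?thesis .
  qed
  then have "lborel = N"
    by (intro lborel_eqI) (auto simp: N_def emeasure_lborel_box)
  then have "(\<integral>\<^sup>+w. f w \<partial>lborel) = (\<integral>\<^sup>+w. f w \<partial>N)" by simp
  also have "\<dots> = (\<integral>\<^sup>+x. f (G x) \<partial>density lborel (\<lambda>x. ennreal (J x) * indicator D x))"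
    unfolding N_def by (subst nn_integral_distr) auto
  also have "\<dots> = (\<integral>\<^sup>+x. (ennreal (J x) * indicator D x) * f (G x) \<partial>lborel)"
    by (subst nn_integral_density) auto
  finally show ?thesis by (simp add: mult.commute)
qed

lemma vec2_measurable [measurable]: "(\<lambda>p. vector [fst p, snd p] :: real^2) \<in> borel_measurable borel"
proof (rule borel_measurable_continuous_onI)
  have "(\<lambda>p. vector [fst p, snd p] :: real^2) = (\<lambda>p. fst p *\<^sub>R axis 1 1 + snd p *\<^sub>R axis 2 1)"
    by (rule ext) (simp add: vec_eq_iff forall_2 axis_def)
  then show "continuous_on UNIV (\<lambda>p. vector [fst p, snd p] :: real^2)"
    by (simp only:) (intro continuous_intros)
qed

lemma nn_integral_real2:
  fixes f :: "real^2 \<Rightarrow> ennreal"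
  assumes [measurable]: "f \<in> borel_measurable borel"
  shows "(\<integral>\<^sup>+x. f x \<partial>lborel) = (\<integral>\<^sup>+b. \<integral>\<^sup>+a. f (vector [a, b]) \<partial>lborel \<partial>lborel)"
proof -
  let ?V = "\<lambda>p. vector [fst p, snd p] :: real^2"
  have m: "?V \<in> measurable (lborel \<Otimes>\<^sub>M lborel) borel"
    using vec2_measurable by (simp add: borel_prod[symmetric] cong: measurable_cong_sets sets_pair_measure_cong)
  define N where "N = distr (lborel \<Otimes>\<^sub>M lborel) borel ?V"
  have "emeasure N (box l u) = emeasure lborel (box l u)" if "\<And>b. b \<in> Basis \<Longrightarrow> l \<bullet> b \<le> u \<bullet> b" for l u :: "real^2"
  proof -
    have lu: "l $ 1 \<le> u $ 1" "l $ 2 \<le> u $ 2"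
      using that[of "axis 1 1"] that[of "axis 2 1"] by (simp_all add: inner_axis axis_in_Basis_iff)
    have "emeasure N (box l u) = emeasure (lborel \<Otimes>\<^sub>M lborel) (?V -` box l u \<inter> space (lborel \<Otimes>\<^sub>M lborel))"
      unfolding N_def using m by (intro emeasure_distr) (auto simp: borel_open)
    also have "?V -` box l u \<inter> space (lborel \<Otimes>\<^sub>M lborel) = {l $ 1<..<u $ 1} \<times> {l $ 2<..<u $ 2}"
      by (auto simp: mem_box_cart forall_2 space_pair_measure)
    also have "emeasure (lborel \<Otimes>\<^sub>M lborel) \<dots> = ennreal ((u $ 1 - l $ 1) * (u $ 2 - l $ 2))"
      using lu by (subst lborel.emeasure_pair_measure_Times) (auto simp: ennreal_mult)
    also have "\<dots> = emeasure lborel (box l u)"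
    proof -
      have "(\<Prod>b\<in>Basis. (u - l) \<bullet> b) = (\<Prod>i\<in>UNIV. u $ i - l $ i)"
        unfolding Basis_vec_def
        by (simp add: UNION_singleton_eq_range prod.reindex inj_on_def axis_eq_axis inner_axis)
      then show ?thesis using that by (simp add: emeasure_lborel_box_eq UNIV_2)
    qed
    finally show ?thesis .
  qed
  then have "lborel = N"
    by (intro lborel_eqI) (auto simp: N_def emeasure_lborel_box_eq)
  then have "(\<integral>\<^sup>+x. f x \<partial>lborel) = (\<integral>\<^sup>+x. f x \<partial>N)" by simp
  also have "\<dots> = (\<integral>\<^sup>+p. f (?V p) \<partial>(lborel \<Otimes>\<^sub>M lborel))"
    unfolding N_def by (rule nn_integral_distr[OF m]) auto
  also have "\<dots> = (\<integral>\<^sup>+b. \<integral>\<^sup>+a. f (?V (a, b)) \<partial>lborel \<partial>lborel)"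
    by (rule lborel_pair.nn_integral_snd[symmetric]) (use measurable_compose[OF m assms] in simp)
  finally show ?thesis by simp
qed

lemma linear_real2_coords: "linear (\<lambda>h :: real^2. h $ 1 *\<^sub>R p + h $ 2 *\<^sub>R q)"
  by (intro linearI) (simp_all add: algebra_simps)

lemma det_real2_coords:
  "det (matrix (\<lambda>h :: real^2. h $ 1 *\<^sub>R p + h $ 2 *\<^sub>R q)) = p $ 1 * q $ 2 - q $ 1 * p $ (2::2)" for p q :: "real^2"
  by (simp add: det_2 matrix_def axis_def)

text \<open>The scales are \<open>d\<close> along the tangent and \<open>d\<^sup>2\<close> along the
  inner normal; their product is the Jacobian.\<close>

lemma nn_integral_frame:
  fixes f :: "real^2 \<Rightarrow> ennreal"
  assumes f [measurable]: "f \<in> borel_measurable borel" and d: "d > 0"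
  shows "(\<integral>\<^sup>+x. f x \<partial>lborel) =
    ennreal (d ^ 3) * (\<integral>\<^sup>+b. \<integral>\<^sup>+a. f (p + (d * a) *\<^sub>R tau t - (d\<^sup>2 * b) *\<^sub>R nu t) \<partial>lborel \<partial>lborel)"
proof -
  define G where "G = (\<lambda>x :: real^2. p + (d * x $ 1) *\<^sub>R tau t - (d\<^sup>2 * x $ 2) *\<^sub>R nu t)"
  define G' where "G' = (\<lambda>h :: real^2. h $ 1 *\<^sub>R (d *\<^sub>R tau t) + h $ 2 *\<^sub>R (- (d\<^sup>2) *\<^sub>R nu t))"
  have cG: "continuous_on UNIV G"
    unfolding G_def by (intro continuous_intros)
  have mG [measurable]: "G \<in> borel_measurable borel" by (rule borel_measurable_continuous_onI[OF cG])
  have GG': "G x = p + G' x" for x by (simp add: G_def G'_def algebra_simps)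
  have deriv: "(G has_derivative G') (at x)" for x
  proof -
    have "(G' has_derivative G') (at x)"
      using linear_real2_coords unfolding G'_def by (intro linear_imp_has_derivative)
    then have "((\<lambda>x. p + G' x) has_derivative G') (at x)"
      by (auto intro!: derivative_eq_intros)
    then show ?thesis by (simp add: GG'[abs_def])
  qed
  have coords: "(G x - p) \<bullet> tau t = d * x $ 1" "(G x - p) \<bullet> nu t = - (d\<^sup>2 * x $ 2)" for x
    by (simp_all add: G_def inner_diff_left inner_add_left)
  have inj: "inj_on G UNIV"
  proof (rule inj_onI)
    fix x y assume "G x = G y"
    then have "d * x $ 1 = d * y $ 1" "d\<^sup>2 * x $ 2 = d\<^sup>2 * y $ 2"
      using coords by (metis, metis neg_equal_iff_equal)
    then show "x = y" using d by (auto simp: vec_eq_iff forall_2)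
  qed
  have surj: "G ` UNIV = UNIV"
  proof -
    have "\<exists>x. y = G x" for y
    proof (intro exI[of _ "vector [((y - p) \<bullet> tau t) / d, - ((y - p) \<bullet> nu t) / d\<^sup>2]"])
      show "y = G (vector [((y - p) \<bullet> tau t) / d, - ((y - p) \<bullet> nu t) / d\<^sup>2])"
        by (rule frame_eqI[of _ t]) (use d in \<open>simp_all add: G_def inner_add_left inner_diff_left\<close>)
    qed
    then show ?thesis by auto
  qed
  have det: "\<bar>det (matrix G')\<bar> = d ^ 3"
  proof -
    have "det (matrix G') = d ^ 3"
      unfolding G'_def det_real2_coords
      using mult_cos_sin[of "d * d * d" t]
      by (simp add: algebra_simps power3_eq_cube power2_eq_square)
    then show ?thesis using d by simp
  qed
  have "(\<integral>\<^sup>+x. f x \<partial>lborel) = (\<integral>\<^sup>+x. f (G x) * (ennreal (d ^ 3) * indicator UNIV x) \<partial>lborel)"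
    by (rule nn_integral_change_of_variables_real2[OF _ mG deriv inj _ det _ f]) (use surj in auto)
  also have "\<dots> = (\<integral>\<^sup>+x. ennreal (d ^ 3) * f (G x) \<partial>lborel)" by (simp add: mult.commute)
  also have "\<dots> = ennreal (d ^ 3) * (\<integral>\<^sup>+x. f (G x) \<partial>lborel)"
    by (intro nn_integral_cmult) auto
  also have "(\<integral>\<^sup>+x. f (G x) \<partial>lborel) = (\<integral>\<^sup>+b. \<integral>\<^sup>+a. f (G (vector [a, b])) \<partial>lborel \<partial>lborel)"
    by (rule nn_integral_real2) auto
  finally show ?thesis by (simp add: G_def)
qed

lemma nn_integral_polar:
  fixes f :: "real^2 \<Rightarrow> ennreal"
  assumes f [measurable]: "f \<in> borel_measurable borel"
  shows "(\<integral>\<^sup>+x. f x \<partial>lborel) =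
    (\<integral>\<^sup>+t. indicator {0<..<2*pi} t * (\<integral>\<^sup>+r. indicator {0<..} r * (ennreal r * f (r *\<^sub>R tau t)) \<partial>lborel) \<partial>lborel)"
proof -
  define D where "D = {x :: real^2. 0 < x $ 1 \<and> 0 < x $ 2 \<and> x $ 2 < 2 * pi}"
  define G where "G = (\<lambda>x :: real^2. x $ 1 *\<^sub>R tau (x $ 2))"
  define G' where "G' = (\<lambda>(x :: real^2) (h :: real^2). h $ 1 *\<^sub>R tau (x $ 2) + h $ 2 *\<^sub>R (- (x $ 1) *\<^sub>R nu (x $ 2)))"
  have D [measurable]: "D \<in> sets borel"
    unfolding D_def by (intro borel_open open_Collect_conj open_Collect_less continuous_intros)
  have cG: "continuous_on UNIV G"
    unfolding G_def by (intro continuous_intros continuous_on_compose2[OF tau_continuous[of UNIV]]) auto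
  have mG [measurable]: "G \<in> borel_measurable borel" by (rule borel_measurable_continuous_onI[OF cG])
  have deriv: "(G has_derivative G' x) (at x)" for x
  proof -
    have 2: "((\<lambda>x. tau (x $ 2)) has_derivative (\<lambda>h. h $ 2 *\<^sub>R (- nu (x $ 2)))) (at x)"
      using has_derivative_compose[of "\<lambda>x. x $ 2" "\<lambda>h. h $ 2" x UNIV tau "\<lambda>h. h *\<^sub>R (- nu (x $ 2))"]
        tau_has_vector_derivative[of "x $ 2" UNIV]
      by (simp add: has_vector_derivative_def bounded_linear_imp_has_derivative bounded_linear_vec_nth)
    show ?thesis
      unfolding G_def G'_def
      by (rule has_derivative_eq_rhs, rule has_derivative_scaleR[OF _ 2],
          rule bounded_linear_imp_has_derivative[OF bounded_linear_vec_nth])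
        (simp add: fun_eq_iff algebra_simps)
  qed
  have inj: "inj_on G D"
  proof (rule inj_onI)
    fix x y assume xy: "x \<in> D" "y \<in> D" "G x = G y"
    have "norm (G x) = x $ 1" "norm (G y) = y $ 1" using xy(1,2) by (auto simp: G_def D_def)
    then have 1: "x $ 1 = y $ 1" using xy(3) by metis
    then have "tau (x $ 2) = tau (y $ 2)" using xy by (auto simp: G_def D_def)
    then have "cos (x $ 2 - y $ 2) = 1" by (metis cos_zero diff_self frame_inner(2))
    then obtain n :: int where n: "x $ 2 - y $ 2 = of_int n * (2 * pi)" by (auto simp: cos_one_2pi_int)
    have "\<bar>x $ 2 - y $ 2\<bar> < 2 * pi" using xy by (auto simp: D_def)
    then have "\<bar>of_int n\<bar> * (2 * pi) < 1 * (2 * pi)" unfolding n by (simp add: abs_mult)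
    then have "\<bar>real_of_int n\<bar> < 1" by (subst (asm) mult_less_cancel_right_pos) auto
    then have "n = 0" by linarith
    then show "x = y" using 1 n by (simp add: vec_eq_iff forall_2)
  qed
  \<comment> \<open>The open angular interval omits the ray in direction \<open>tau 0\<close>;
    together with the origin it lies on the line of vanishing first coordinate.\<close>
  have img: "negligible (- G ` D)"
  proof (rule negligible_subset)
    show "negligible {w :: real^2. axis 1 1 \<bullet> w = 0}"
      by (rule negligible_hyperplane) (simp add: axis_eq_0_iff)
    show "- G ` D \<subseteq> {w :: real^2. axis 1 1 \<bullet> w = 0}"
    proof
      fix w :: "real^2" assume w: "w \<in> - G ` D"
      show "w \<in> {w. axis 1 1 \<bullet> w = 0}"
      proof (rule ccontr)
        assume "w \<notin> {w. axis 1 1 \<bullet> w = 0}"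
        then have w1: "w $ 1 \<noteq> 0" by (simp add: inner_axis inner_commute)
        obtain t0 where t0: "w = norm w *\<^sub>R tau t0" by (rule polar_tau)
        obtain n where n: "0 \<le> t0 + of_int n * (2 * pi)" "t0 + of_int n * (2 * pi) < 0 + 2 * pi"
          by (rule angle_reduce)
        define t where "t = t0 + of_int n * (2 * pi)"
        have wt: "w = norm w *\<^sub>R tau t" using t0 by (simp add: t_def)
        have "t \<noteq> 0"
        proof
          assume "t = 0"
          then have "w $ 1 = 0" using arg_cong[OF wt, of "\<lambda>x. x $ 1"] by simp
          then show False using w1 by simp
        qed
        then have "vector [norm w, t] \<in> D" using n w1 by (auto simp: D_def t_def)
        moreover have "w = G (vector [norm w, t])" using wt by (simp add: G_def)
        ultimately show False using w by blast
      qed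
    qed
  qed
  have det: "\<bar>det (matrix (G' x))\<bar> = x $ 1" if "x \<in> D" for x
  proof -
    have "det (matrix (G' x)) = x $ 1"
      unfolding G'_def det_real2_coords by (simp add: algebra_simps mult_cos_sin)
    then show ?thesis using that by (simp add: D_def)
  qed
  have [measurable]: "(\<lambda>x :: real^2. x $ i) \<in> borel_measurable borel" for i
    by (intro borel_measurable_continuous_onI continuous_intros)
  have "(\<integral>\<^sup>+x. f x \<partial>lborel) = (\<integral>\<^sup>+x. f (G x) * (ennreal (x $ 1) * indicator D x) \<partial>lborel)"
    by (rule nn_integral_change_of_variables_real2[OF D mG deriv inj img det _ f]) auto
  also have "\<dots> = (\<integral>\<^sup>+t. \<integral>\<^sup>+r. f (G (vector [r, t])) * (ennreal (vector [r, t] $ (1::2)) * indicator D (vector [r, t])) \<partial>lborel \<partial>lborel)"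
    using D by (intro nn_integral_real2) measurable
  also have "\<dots> = (\<integral>\<^sup>+t. \<integral>\<^sup>+r. indicator {0<..<2*pi} t * (indicator {0<..} r * (ennreal r * f (r *\<^sub>R tau t))) \<partial>lborel \<partial>lborel)"
    by (intro nn_integral_cong) (auto simp: G_def D_def indicator_def mult.commute)
  also have "\<dots> = (\<integral>\<^sup>+t. indicator {0<..<2*pi} t * (\<integral>\<^sup>+r. indicator {0<..} r * (ennreal r * f (r *\<^sub>R tau t)) \<partial>lborel) \<partial>lborel)"
  proof (intro nn_integral_cong nn_integral_cmult)
    fix t :: real
    have [measurable]: "(\<lambda>r. f (r *\<^sub>R tau t)) \<in> borel_measurable borel"
      by (rule measurable_compose[OF _ f]) (intro borel_measurable_continuous_onI continuous_intros)
    show "(\<lambda>r. indicator {0<..} r * (ennreal r * f (r *\<^sub>R tau t))) \<in> borel_measurable lborel" by measurable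
  qed
  finally show ?thesis .
qed

section \<open>Explicit integrals for the parabolic limit\<close>

text \<open>The area of a segment of height \<open>t\<close> of a parabola of curvature
  \<open>D\<close> is two thirds of the rectangle with sides \<open>2 * R\<close> and
  \<open>t\<close>.\<close>

lemma nn_integral_parabola:
  fixes D t c :: real
  assumes D: "D > 0" and t: "t \<ge> 0"
  shows "(\<integral>\<^sup>+x. ennreal (max 0 (t - D / 2 * (x - c)\<^sup>2)) \<partial>lborel) = ennreal (4 / 3 * sqrt (2 / D) * t powr (3/2))"
proof -
  define R where "R = sqrt (2 * t / D)"
  have R: "R \<ge> 0" "R\<^sup>2 = 2 * t / D" using D t by (simp_all add: R_def)
  have tR: "t = D * R\<^sup>2 / 2" using R D by (simp add: field_simps)
  define F where "F = (\<lambda>x. t * x - D / 6 * (x - c) ^ 3)"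
  have "(\<integral>\<^sup>+x. ennreal (max 0 (t - D / 2 * (x - c)\<^sup>2)) \<partial>lborel)
      = (\<integral>\<^sup>+x. ennreal (t - D / 2 * (x - c)\<^sup>2) * indicator {c - R..c + R} x \<partial>lborel)"
  proof (rule nn_integral_cong)
    fix x :: real
    have "x \<in> {c - R..c + R} \<longleftrightarrow> \<bar>x - c\<bar> \<le> R" by auto
    also have "\<dots> \<longleftrightarrow> (x - c)\<^sup>2 \<le> R\<^sup>2" by (rule power2_le_iff_abs_le[OF R(1), symmetric])
    also have "\<dots> \<longleftrightarrow> D / 2 * (x - c)\<^sup>2 \<le> t" unfolding tR using D by (simp add: field_simps)
    finally show "ennreal (max 0 (t - D / 2 * (x - c)\<^sup>2)) = ennreal (t - D / 2 * (x - c)\<^sup>2) * indicator {c - R..c + R} x"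
      by (auto simp: indicator_def max_def)
  qed
  also have "\<dots> = ennreal (F (c + R) - F (c - R))"
  proof (rule nn_integral_FTC_Icc)
    show "(F has_real_derivative t - D / 2 * (x - c)\<^sup>2) (at x)" for x
      unfolding F_def
      by (auto intro!: derivative_eq_intros simp: power2_eq_square)
    show "0 \<le> t - D / 2 * (x - c)\<^sup>2" if "x \<in> {c - R..c + R}" for x
    proof -
      have "\<bar>x - c\<bar> \<le> R" using that by auto
      then have "(x - c)\<^sup>2 \<le> R\<^sup>2" using power2_le_iff_abs_le[OF R(1)] by blast
      then show ?thesis unfolding tR using D by (simp add: field_simps)
    qed
  qed (use R in auto)
  also have "F (c + R) - F (c - R) = 2 / 3 * D * R ^ 3"
    unfolding F_def by (simp add: tR power2_eq_square power3_eq_cube field_simps)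
  also have "2 / 3 * D * R ^ 3 = 4 / 3 * sqrt (2 / D) * t powr (3/2)"
  proof -
    have "t powr (3/2) = t powr 1 * t powr (1/2)"
      unfolding powr_add[symmetric] by simp
    also have "\<dots> = t * sqrt t" using t by (simp add: powr_half_sqrt)
    finally have "4 / 3 * sqrt (2 / D) * t powr (3/2) = 4 / 3 * t * (sqrt (2 / D) * sqrt t)" by simp
    also have "sqrt (2 / D) * sqrt t = R"
      unfolding R_def real_sqrt_mult[symmetric] by simp
    also have "4 / 3 * t * R = 2 / 3 * D * R ^ 3"
      unfolding tR by (simp add: power2_eq_square power3_eq_cube)
    finally show ?thesis by simp
  qed
  finally show ?thesis .
qed

text \<open>The substitution \<open>s = c * t powr (3/2)\<close> in Euler's integral for
  \<open>Gamma (5/3)\<close>.\<close>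

lemma nn_integral_Gamma_substitution:
  fixes c :: real
  assumes c: "c > 0"
  shows "(\<integral>\<^sup>+t. ennreal (t powr (3/2) * exp (- c * t powr (3/2))) * indicator {0<..} t \<partial>lborel)
    = ennreal (2 / 3 * c powr (-5/3) * Gamma (5/3))"
proof -
  define f where "f = (\<lambda>s :: real. s powr (2/3) * exp (- s))"
  define g where "g = (\<lambda>t :: real. c * t powr (3/2))"
  define g' where "g' = (\<lambda>t :: real. c * (3 / 2 * t powr (1/2)))"
  have img: "g ` {0<..} = {0<..}"
  proof (intro subset_antisym subsetI)
    fix s :: real assume s: "s \<in> {0<..}"
    have "((s / c) powr (2/3)) powr (3/2) = s / c"
      using s c by (simp add: powr_powr)
    then have "s = g ((s / c) powr (2/3))" using c by (simp add: g_def)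
    moreover have "(s / c) powr (2/3) \<in> {0<..}" using s c by simp
    ultimately show "s \<in> g ` {0<..}" by blast
  qed (use c in \<open>auto simp: g_def\<close>)
  have inj: "inj_on g {0<..}"
  proof (rule inj_onI)
    fix x y assume "x \<in> {0<..}" "y \<in> {0<..}" "g x = g y"
    then have "x powr (3/2) = y powr (3/2)" using c by (simp add: g_def)
    then have "(x powr (3/2)) powr (2/3) = (y powr (3/2)) powr (2/3)" by simp
    then show "x = y" using \<open>x \<in> {0<..}\<close> \<open>y \<in> {0<..}\<close> by (simp add: powr_powr)
  qed
  have deriv: "(g has_field_derivative g' t) (at t within {0<..})" if "t \<in> {0<..}" for t
    using that unfolding g_def g'_def by (auto intro!: derivative_eq_intros)
  have "((\<lambda>t. t powr (5/3 - 1) / exp t) has_integral Gamma (5/3 :: real)) {0..}"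
    by (rule Gamma_integral_real) simp
  then have "(f has_integral Gamma (5/3)) {0..}" by (simp add: f_def exp_minus field_simps)
  then have fi: "(f has_integral Gamma (5/3)) {0<..}"
    by (subst has_integral_spike_set_eq[of _ "{0..}"]) (auto intro: negligible_subset[of "{0}"])
  have "f absolutely_integrable_on {0<..}"
    by (rule nonnegative_absolutely_integrable_1) (use fi in \<open>auto simp: f_def\<close>)
  then have "f absolutely_integrable_on g ` {0<..} \<and> integral (g ` {0<..}) f = Gamma (5/3)"
    using fi by (simp add: img integral_unique)
  then have "(\<lambda>t. \<bar>g' t\<bar> *\<^sub>R f (g t)) absolutely_integrable_on {0<..} \<and> integral {0<..} (\<lambda>t. \<bar>g' t\<bar> *\<^sub>R f (g t)) = Gamma (5/3)"
    by (subst has_absolute_integral_change_of_variables_real[OF _ deriv inj]) auto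
  then have hi: "((\<lambda>t. \<bar>g' t\<bar> *\<^sub>R f (g t)) has_integral Gamma (5/3)) {0<..}"
    by (metis has_integral_integral set_lebesgue_integral_eq_integral(1))
  have eq: "2 / 3 * c powr (-5/3) * (\<bar>g' t\<bar> *\<^sub>R f (g t)) = t powr (3/2) * exp (- c * t powr (3/2))" if "t \<in> {0<..}" for t
  proof -
    have t: "t > 0" using that by simp
    have "(c * t powr (3/2)) powr (2/3) = c powr (2/3) * t"
      using c t by (simp add: powr_mult powr_powr)
    then have "2 / 3 * c powr (-5/3) * (\<bar>g' t\<bar> *\<^sub>R f (g t))
        = (c powr (-5/3) * c * c powr (2/3)) * (t powr (1/2) * t) * exp (- c * t powr (3/2))"
      using c t by (simp add: g'_def f_def g_def)
    also have "c powr (-5/3) * c * c powr (2/3) = c powr (-5/3) * c powr 1 * c powr (2/3)" using c by simp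
    also have "\<dots> = 1" unfolding powr_add[symmetric] using c by simp
    also have "t powr (1/2) * t = t powr (1/2) * t powr 1" using t by simp
    also have "\<dots> = t powr (3/2)" unfolding powr_add[symmetric] by simp
    finally show ?thesis by simp
  qed
  have "((\<lambda>t. 2 / 3 * c powr (-5/3) * (\<bar>g' t\<bar> *\<^sub>R f (g t))) has_integral 2 / 3 * c powr (-5/3) * Gamma (5/3)) {0<..}"
    using has_integral_mult_right[OF hi] by blast
  then have "((\<lambda>t. t powr (3/2) * exp (- c * t powr (3/2))) has_integral 2 / 3 * c powr (-5/3) * Gamma (5/3)) {0<..}"
    by (rule has_integral_eq[rotated]) (rule eq)
  then show ?thesis
    by (intro nn_integral_has_integral_lebesgue') auto
qed

text \<open>The pairs describe chords of length \<open>r\<close> and midpoint \<open>x\<close>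
  inside an interval of half width \<open>R\<close>; the weight \<open>r\<close> comes from polar
  coordinates.\<close>

lemma nn_integral_triangle:
  fixes R :: real assumes R: "R \<ge> 0"
  shows "(\<integral>\<^sup>+r. indicator {0<..} r * (ennreal r * (\<integral>\<^sup>+x. indicator {x. \<bar>x\<bar> + r / 2 < R} x \<partial>lborel)) \<partial>lborel)
    = ennreal (4 / 3 * R ^ 3)"
proof -
  have "(\<integral>\<^sup>+x. indicator {x. \<bar>x\<bar> + r / 2 < R} x \<partial>lborel) = ennreal (max 0 (2 * (R - r / 2)))" for r
  proof -
    have "{x. \<bar>x\<bar> + r / 2 < R} = {- (R - r / 2)<..<R - r / 2}" by auto
    then show ?thesis by (cases "r / 2 \<le> R") (auto simp: max_def not_le emeasure_lborel_Ioo)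
  qed
  then have "(\<integral>\<^sup>+r. indicator {0<..} r * (ennreal r * (\<integral>\<^sup>+x. indicator {x. \<bar>x\<bar> + r / 2 < R} x \<partial>lborel)) \<partial>lborel)
      = (\<integral>\<^sup>+r. indicator {0<..} r * (ennreal r * ennreal (max 0 (2 * (R - r / 2)))) \<partial>lborel)"
    by (simp only:)
  also have "\<dots> = (\<integral>\<^sup>+r. ennreal (r * (2 * R - r)) * indicator {0..2 * R} r \<partial>lborel)"
    by (intro nn_integral_cong) (auto simp: indicator_def max_def ennreal_mult[symmetric] not_less)
  also have "\<dots> = ennreal ((R * (2 * R)\<^sup>2 - (2 * R) ^ 3 / 3) - (R * 0\<^sup>2 - 0 ^ 3 / 3))"
  proof (rule nn_integral_FTC_Icc)
    show "((\<lambda>r. R * r\<^sup>2 - r ^ 3 / 3) has_real_derivative x * (2 * R - x)) (at x)" for x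
      by (auto intro!: derivative_eq_intros simp: power2_eq_square algebra_simps)
  qed (use R in auto)
  also have "(R * (2 * R)\<^sup>2 - (2 * R) ^ 3 / 3) - (R * 0\<^sup>2 - 0 ^ 3 / 3) = 4 / 3 * R ^ 3"
    by (simp add: power2_eq_square power3_eq_cube)
  finally show ?thesis .
qed

text \<open>Here \<open>\<kappa>\<close> and \<open>\<mu>\<close> play the role of the curvatures of \<open>K\<close> and \<open>L\<close>; a chord of length \<open>r\<close>, at depth
  \<open>b\<close>, starts at abscissa \<open>a\<close>, and \<open>cap_height\<close> is the height of the cap cut off by the arc through its end points.\<close>
definition cap_height :: "real \<Rightarrow> real \<Rightarrow> real \<Rightarrow> real \<Rightarrow> real \<Rightarrow> real" where
  "cap_height \<kappa> \<mu> r a b = b - \<mu> * r\<^sup>2 / 8 + \<mu> * \<kappa> / (2 * (\<kappa> - \<mu>)) * (a + r / 2)\<^sup>2"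

text \<open>The parabola of \<open>L\<close> through both end points of the chord minus that of
  \<open>K\<close> is a parabola of curvature \<open>\<kappa> - \<mu>\<close> and height
  \<open>cap_height\<close>. Relative to its vertex, the midpoint of the chord has abscissa
  \<open>\<kappa> / (\<kappa> - \<mu>) * (a + r / 2)\<close>. Both end points lie inside
  \<open>K\<close> iff the difference is positive at the one farther from the vertex.\<close>

lemma cap_height_iff:
  assumes "\<kappa> > \<mu>" "\<mu> > 0" "r > 0"
  shows "(\<kappa> * a\<^sup>2 / 2 < b \<and> \<kappa> * (a + r)\<^sup>2 / 2 < b) \<longleftrightarrow>
    (\<kappa> - \<mu>) / 2 * (\<bar>\<kappa> / (\<kappa> - \<mu>) * (a + r / 2)\<bar> + r / 2)\<^sup>2 < cap_height \<kappa> \<mu> r a b"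
proof -
  define m where "m = a + r / 2"
  define D where "D = \<kappa> - \<mu>"
  have D: "D > 0" "\<mu> = \<kappa> - D" "\<kappa> > 0" using assms by (auto simp: D_def)
  have "(\<kappa> * a\<^sup>2 / 2 < b \<and> \<kappa> * (a + r)\<^sup>2 / 2 < b) \<longleftrightarrow> \<kappa> * (\<bar>m\<bar> + r / 2)\<^sup>2 / 2 < b"
  proof -
    have "\<kappa> * (\<bar>m\<bar> + r / 2)\<^sup>2 / 2 = max (\<kappa> * a\<^sup>2 / 2) (\<kappa> * (a + r)\<^sup>2 / 2)"
    proof (cases "m \<ge> 0")
      case True
      then have "\<bar>a\<bar> \<le> \<bar>a + r\<bar>" using assms(3) by (auto simp: m_def)
      then have "a\<^sup>2 \<le> (a + r)\<^sup>2" by (simp add: abs_le_square_iff)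
      moreover have "\<bar>m\<bar> + r / 2 = a + r" using True by (simp add: m_def)
      ultimately show ?thesis using D(3) by (simp add: max_def)
    next
      case False
      then have "\<bar>a + r\<bar> \<le> \<bar>a\<bar>" using assms(3) by (auto simp: m_def)
      then have "(a + r)\<^sup>2 \<le> a\<^sup>2" by (simp add: abs_le_square_iff)
      moreover have "\<bar>m\<bar> + r / 2 = - a" using False by (simp add: m_def)
      ultimately show ?thesis using D(3) by (simp add: max_def)
    qed
    then show ?thesis by auto
  qed
  also have "\<dots> \<longleftrightarrow> D / 2 * (\<kappa> / D * \<bar>m\<bar> + r / 2)\<^sup>2 < b - \<mu> * r\<^sup>2 / 8 + \<mu> * \<kappa> / (2 * D) * m\<^sup>2"
  proof -
    define x where "x = \<bar>m\<bar>"
    have m: "m\<^sup>2 = x\<^sup>2" by (simp add: x_def)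
    have "D / 2 * (\<kappa> / D * x + r / 2)\<^sup>2 = \<kappa>\<^sup>2 / (2 * D) * x\<^sup>2 + \<kappa> * x * r / 2 + D * r\<^sup>2 / 8"
      using D(1) by (simp add: power2_eq_square field_simps)
    moreover have "\<mu> * \<kappa> / (2 * D) * x\<^sup>2 = \<kappa>\<^sup>2 / (2 * D) * x\<^sup>2 - \<kappa> * x\<^sup>2 / 2"
      using D(1) unfolding D(2) by (simp add: power2_eq_square field_simps)
    moreover have "\<mu> * r\<^sup>2 / 8 = \<kappa> * r\<^sup>2 / 8 - D * r\<^sup>2 / 8"
      unfolding D(2) by (simp add: field_simps)
    moreover have "\<kappa> * (x + r / 2)\<^sup>2 / 2 = \<kappa> * x\<^sup>2 / 2 + \<kappa> * x * r / 2 + \<kappa> * r\<^sup>2 / 8"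
      by (simp add: power2_eq_square field_simps)
    ultimately show ?thesis unfolding m x_def[symmetric] by linarith
  qed
  finally show ?thesis
    using D by (simp add: cap_height_def m_def[symmetric] D_def[symmetric] abs_mult)
qed

text \<open>The cap height \<open>t\<close> and the abscissa of the chord midpoint relative to the
  vertex replace \<open>b\<close> and \<open>a\<close>, with Jacobian
  \<open>(\<kappa> - \<mu>) / \<kappa>\<close>. The exponential then depends on \<open>t\<close>
  alone, the pairs of length and midpoint give \<open>nn_integral_triangle\<close>, and a Gamma
  integral over \<open>t\<close> remains.\<close>

lemma limit_integral:
  fixes \<kappa> \<mu> c :: real
  assumes "\<kappa> > \<mu>" "\<mu> > 0" "c > 0"
  shows "(\<integral>\<^sup>+r. indicator {0<..} r * (ennreal r * (\<integral>\<^sup>+b. \<integral>\<^sup>+a.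
      indicator {a. \<kappa> * a\<^sup>2 / 2 < b \<and> \<kappa> * (a + r)\<^sup>2 / 2 < b} a * ennreal (exp (- c * cap_height \<kappa> \<mu> r a b powr (3/2)))
      \<partial>lborel \<partial>lborel)) \<partial>lborel)
    = ennreal ((\<kappa> - \<mu>) / \<kappa> * (4 / 3 * (2 / (\<kappa> - \<mu>)) powr (3/2) * (2 / 3 * c powr (-5/3) * Gamma (5/3))))"
proof -
  define D where "D = \<kappa> - \<mu>"
  have D: "D > 0" and k: "\<kappa> > 0" using assms by (auto simp: D_def)
  define e where "e = (\<lambda>t. exp (- c * t powr (3/2)) :: real)"
  have [measurable]: "e \<in> borel_measurable borel" unfolding e_def by measurable
  define s where "s = (\<lambda>x r. D / 2 * (\<bar>x\<bar> + r / 2)\<^sup>2 :: real)"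
  have inner: "(\<integral>\<^sup>+b. \<integral>\<^sup>+a. indicator {a. \<kappa> * a\<^sup>2 / 2 < b \<and> \<kappa> * (a + r)\<^sup>2 / 2 < b} a * ennreal (e (cap_height \<kappa> \<mu> r a b)) \<partial>lborel \<partial>lborel)
      = ennreal (D / \<kappa>) * (\<integral>\<^sup>+t. \<integral>\<^sup>+x. indicator {x. s x r < t} x * ennreal (e t) \<partial>lborel \<partial>lborel)" if r: "r > 0" for r
  proof -
    define w where "w = (\<lambda>a. - (\<mu> * r\<^sup>2 / 8) + \<mu> * \<kappa> / (2 * D) * (a + r / 2)\<^sup>2)"
    have ch: "cap_height \<kappa> \<mu> r a b = b + w a" for a b by (simp add: cap_height_def w_def D_def)
    have "(\<integral>\<^sup>+b. \<integral>\<^sup>+a. indicator {a. \<kappa> * a\<^sup>2 / 2 < b \<and> \<kappa> * (a + r)\<^sup>2 / 2 < b} a * ennreal (e (cap_height \<kappa> \<mu> r a b)) \<partial>lborel \<partial>lborel)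
        = (\<integral>\<^sup>+b. \<integral>\<^sup>+a. indicator {0<..} (b + w a - s (\<kappa> / D * (a + r / 2)) r) * ennreal (e (b + w a)) \<partial>lborel \<partial>lborel)"
      unfolding ch[symmetric] s_def D_def using cap_height_iff[OF assms(1,2) r]
      by (intro nn_integral_cong) (auto simp: indicator_def)
    also have "\<dots> = (\<integral>\<^sup>+a. \<integral>\<^sup>+b. indicator {0<..} (b + w a - s (\<kappa> / D * (a + r / 2)) r) * ennreal (e (b + w a)) \<partial>lborel \<partial>lborel)"
      unfolding w_def s_def by (intro lborel_pair.Fubini') measurable
    also have "\<dots> = (\<integral>\<^sup>+a. \<integral>\<^sup>+t. indicator {0<..} (t - s (\<kappa> / D * (a + r / 2)) r) * ennreal (e t) \<partial>lborel \<partial>lborel)"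
    proof (rule nn_integral_cong)
      fix a :: real
      show "(\<integral>\<^sup>+b. indicator {0<..} (b + w a - s (\<kappa> / D * (a + r / 2)) r) * ennreal (e (b + w a)) \<partial>lborel)
          = (\<integral>\<^sup>+t. indicator {0<..} (t - s (\<kappa> / D * (a + r / 2)) r) * ennreal (e t) \<partial>lborel)"
        by (subst (2) nn_integral_real_affine[where c = 1 and t = "w a"]) (auto simp: add.commute)
    qed
    also have "\<dots> = (\<integral>\<^sup>+t. \<integral>\<^sup>+a. indicator {0<..} (t - s (\<kappa> / D * (a + r / 2)) r) * ennreal (e t) \<partial>lborel \<partial>lborel)"
      unfolding s_def by (intro lborel_pair.Fubini'[symmetric]) measurable
    also have "\<dots> = (\<integral>\<^sup>+t. ennreal (D / \<kappa>) * (\<integral>\<^sup>+x. indicator {x. s x r < t} x * ennreal (e t) \<partial>lborel) \<partial>lborel)"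
    proof (rule nn_integral_cong)
      fix t :: real
      have "(\<integral>\<^sup>+a. indicator {0<..} (t - s (\<kappa> / D * (a + r / 2)) r) * ennreal (e t) \<partial>lborel)
          = ennreal \<bar>D / \<kappa>\<bar> * (\<integral>\<^sup>+x. indicator {0<..} (t - s (\<kappa> / D * ((- r / 2 + D / \<kappa> * x) + r / 2)) r) * ennreal (e t) \<partial>lborel)"
        unfolding s_def using D k by (intro nn_integral_real_affine) auto
      also have "(\<lambda>x. \<kappa> / D * ((- r / 2 + D / \<kappa> * x) + r / 2)) = (\<lambda>x. x)" using D k by auto
      then have "(\<integral>\<^sup>+x. indicator {0<..} (t - s (\<kappa> / D * ((- r / 2 + D / \<kappa> * x) + r / 2)) r) * ennreal (e t) \<partial>lborel)
          = (\<integral>\<^sup>+x. indicator {x. s x r < t} x * ennreal (e t) \<partial>lborel)"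
        by (intro nn_integral_cong) (auto simp: indicator_def fun_eq_iff)
      finally show "(\<integral>\<^sup>+a. indicator {0<..} (t - s (\<kappa> / D * (a + r / 2)) r) * ennreal (e t) \<partial>lborel)
          = ennreal (D / \<kappa>) * (\<integral>\<^sup>+x. indicator {x. s x r < t} x * ennreal (e t) \<partial>lborel)"
        using D k by simp
    qed
    also have "\<dots> = ennreal (D / \<kappa>) * (\<integral>\<^sup>+t. \<integral>\<^sup>+x. indicator {x. s x r < t} x * ennreal (e t) \<partial>lborel \<partial>lborel)"
      unfolding s_def by (intro nn_integral_cmult) measurable
    finally show ?thesis .
  qed
  have "(\<integral>\<^sup>+r. indicator {0<..} r * (ennreal r * (\<integral>\<^sup>+b. \<integral>\<^sup>+a.
      indicator {a. \<kappa> * a\<^sup>2 / 2 < b \<and> \<kappa> * (a + r)\<^sup>2 / 2 < b} a * ennreal (e (cap_height \<kappa> \<mu> r a b))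
      \<partial>lborel \<partial>lborel)) \<partial>lborel)
    = (\<integral>\<^sup>+r. ennreal (D / \<kappa>) * (\<integral>\<^sup>+t. ennreal (e t) * (indicator {0<..} r * (ennreal r * (\<integral>\<^sup>+x. indicator {x. s x r < t} x \<partial>lborel))) \<partial>lborel) \<partial>lborel)"
  proof (rule nn_integral_cong)
    fix r :: real
    show "indicator {0<..} r * (ennreal r * (\<integral>\<^sup>+b. \<integral>\<^sup>+a.
      indicator {a. \<kappa> * a\<^sup>2 / 2 < b \<and> \<kappa> * (a + r)\<^sup>2 / 2 < b} a * ennreal (e (cap_height \<kappa> \<mu> r a b))
      \<partial>lborel \<partial>lborel)) = ennreal (D / \<kappa>) * (\<integral>\<^sup>+t. ennreal (e t) * (indicator {0<..} r * (ennreal r * (\<integral>\<^sup>+x. indicator {x. s x r < t} x \<partial>lborel))) \<partial>lborel)"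
    proof (cases "r > 0")
      case True
      have "(\<integral>\<^sup>+x. indicator {x. s x r < t} x * ennreal (e t) \<partial>lborel) = (\<integral>\<^sup>+x. indicator {x. s x r < t} x \<partial>lborel) * ennreal (e t)" for t
        unfolding s_def by (intro nn_integral_multc) measurable
      then have "ennreal r * (\<integral>\<^sup>+t. \<integral>\<^sup>+x. indicator {x. s x r < t} x * ennreal (e t) \<partial>lborel \<partial>lborel)
          = ennreal r * (\<integral>\<^sup>+t. (\<integral>\<^sup>+x. indicator {x. s x r < t} x \<partial>lborel) * ennreal (e t) \<partial>lborel)"
        by presburger
      also have "\<dots> = (\<integral>\<^sup>+t. ennreal r * ((\<integral>\<^sup>+x. indicator {x. s x r < t} x \<partial>lborel) * ennreal (e t)) \<partial>lborel)"
        unfolding s_def by (rule nn_integral_cmult[symmetric]) measurable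
      also have "\<dots> = (\<integral>\<^sup>+t. ennreal (e t) * (ennreal r * (\<integral>\<^sup>+x. indicator {x. s x r < t} x \<partial>lborel)) \<partial>lborel)"
        by (intro nn_integral_cong) (simp only: mult.commute mult.left_commute)
      finally show ?thesis
        using True unfolding inner[OF True] by (simp add: mult.left_commute[of "ennreal r"])
    qed simp
  qed
  also have "\<dots> = ennreal (D / \<kappa>) * (\<integral>\<^sup>+r. \<integral>\<^sup>+t. ennreal (e t) * (indicator {0<..} r * (ennreal r * (\<integral>\<^sup>+x. indicator {x. s x r < t} x \<partial>lborel))) \<partial>lborel \<partial>lborel)"
    unfolding s_def by (intro nn_integral_cmult) measurable
  also have "(\<integral>\<^sup>+r. \<integral>\<^sup>+t. ennreal (e t) * (indicator {0<..} r * (ennreal r * (\<integral>\<^sup>+x. indicator {x. s x r < t} x \<partial>lborel))) \<partial>lborel \<partial>lborel)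
      = (\<integral>\<^sup>+t. \<integral>\<^sup>+r. ennreal (e t) * (indicator {0<..} r * (ennreal r * (\<integral>\<^sup>+x. indicator {x. s x r < t} x \<partial>lborel))) \<partial>lborel \<partial>lborel)"
    unfolding s_def by (intro lborel_pair.Fubini'[symmetric]) measurable
  also have "\<dots> = (\<integral>\<^sup>+t. ennreal (4 / 3 * (2 / D) powr (3/2)) * (ennreal (t powr (3/2) * exp (- c * t powr (3/2))) * indicator {0<..} t) \<partial>lborel)"
  proof (rule nn_integral_cong)
    fix t :: real
    have "(\<integral>\<^sup>+r. ennreal (e t) * (indicator {0<..} r * (ennreal r * (\<integral>\<^sup>+x. indicator {x. s x r < t} x \<partial>lborel))) \<partial>lborel)
       = ennreal (e t) * (\<integral>\<^sup>+r. indicator {0<..} r * (ennreal r * (\<integral>\<^sup>+x. indicator {x. s x r < t} x \<partial>lborel)) \<partial>lborel)"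
      unfolding s_def by (intro nn_integral_cmult) measurable
    also have "\<dots> = ennreal (4 / 3 * (2 / D) powr (3/2)) * (ennreal (t powr (3/2) * exp (- c * t powr (3/2))) * indicator {0<..} t)"
    proof (cases "t > 0")
      case True
      \<comment> \<open>Half width of the parabola of curvature \<open>D\<close> at height
        \<open>t\<close>.\<close>
      define R where "R = sqrt (2 * t / D)"
      have R: "R \<ge> 0" "R\<^sup>2 = 2 * t / D" using D True by (simp_all add: R_def)
      have "s x r < t \<longleftrightarrow> \<bar>x\<bar> + r / 2 < R" if "r > 0" for x r
      proof -
        have "s x r < t \<longleftrightarrow> (\<bar>x\<bar> + r / 2)\<^sup>2 < R\<^sup>2" unfolding R(2) s_def using D by (simp add: field_simps)
        also have "\<dots> \<longleftrightarrow> \<bar>x\<bar> + r / 2 < R" using R(1) that by (simp add: power_mono_iff not_le[symmetric])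
        finally show ?thesis .
      qed
      then have "(\<integral>\<^sup>+r. indicator {0<..} r * (ennreal r * (\<integral>\<^sup>+x. indicator {x. s x r < t} x \<partial>lborel)) \<partial>lborel)
          = (\<integral>\<^sup>+r. indicator {0<..} r * (ennreal r * (\<integral>\<^sup>+x. indicator {x. \<bar>x\<bar> + r / 2 < R} x \<partial>lborel)) \<partial>lborel)"
        by (intro nn_integral_cong) (auto simp: indicator_def intro!: nn_integral_cong)
      also have "\<dots> = ennreal (4 / 3 * R ^ 3)" by (rule nn_integral_triangle[OF R(1)])
      also have "R ^ 3 = (2 / D) powr (3/2) * t powr (3/2)"
      proof -
        have "R = (2 * t / D) powr (1/2)" using D True by (simp add: R_def powr_half_sqrt)
        then have "R ^ 3 = ((2 * t / D) powr (1/2)) powr 3" using D True by (simp add: powr_numeral)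
        also have "\<dots> = (2 / D * t) powr (3/2)" by (simp add: powr_powr mult.commute)
        also have "\<dots> = (2 / D) powr (3/2) * t powr (3/2)"
          using D True powr_mult[of "2 / D" t "3/2"] by simp
        finally show ?thesis .
      qed
      finally show ?thesis
        using True D by (simp add: e_def ennreal_mult[symmetric] mult.commute mult.left_commute)
    next
      case False
      have "\<not> s x r < t" for x r
      proof -
        have "0 \<le> s x r" using D by (simp add: s_def)
        then show ?thesis using False by simp
      qed
      then show ?thesis using False by simp
    qed
    finally show "(\<integral>\<^sup>+r. ennreal (e t) * (indicator {0<..} r * (ennreal r * (\<integral>\<^sup>+x. indicator {x. s x r < t} x \<partial>lborel))) \<partial>lborel)
       = ennreal (4 / 3 * (2 / D) powr (3/2)) * (ennreal (t powr (3/2) * exp (- c * t powr (3/2))) * indicator {0<..} t)" .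
  qed
  also have "\<dots> = ennreal (4 / 3 * (2 / D) powr (3/2)) * ennreal (2 / 3 * c powr (-5/3) * Gamma (5/3))"
    unfolding nn_integral_Gamma_substitution[OF assms(3), symmetric] by (intro nn_integral_cmult) measurable
  also have "ennreal (D / \<kappa>) * (ennreal (4 / 3 * (2 / D) powr (3/2)) * ennreal (2 / 3 * c powr (-5/3) * Gamma (5/3)))
      = ennreal (D / \<kappa> * (4 / 3 * (2 / D) powr (3/2) * (2 / 3 * c powr (-5/3) * Gamma (5/3))))"
    using D k Gamma_real_pos[of "5/3"] by (simp add: ennreal_mult[symmetric])
  finally show ?thesis by (simp add: e_def D_def)
qed

section \<open>Asymptotics near the boundary\<close>

context normal_disc
begin

lemma in_outer_disc:
  assumes "z \<in> M" "\<And>s. r s \<le> R"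
  shows "((z - m t) \<bullet> tau t)\<^sup>2 + ((m t - z) \<bullet> nu t)\<^sup>2 \<le> 2 * R * ((m t - z) \<bullet> nu t)"
proof -
  define x where "x = (z - m t) \<bullet> tau t"
  define h where "h = (m t - z) \<bullet> nu t"
  have "z \<in> cball (m t - R *\<^sub>R nu t) R" using subset_cball[OF assms(2)] assms(1) by blast
  then have "norm (z - (m t - R *\<^sub>R nu t)) \<le> R" by (simp add: dist_norm norm_minus_commute)
  then have "(norm (z - (m t - R *\<^sub>R nu t)))\<^sup>2 \<le> R\<^sup>2" by (simp add: power_mono)
  moreover have "(z - (m t - R *\<^sub>R nu t)) \<bullet> tau t = x" "(z - (m t - R *\<^sub>R nu t)) \<bullet> nu t = R - h"
    by (simp_all add: x_def h_def inner_diff_left)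
  ultimately have "x\<^sup>2 + (R - h)\<^sup>2 \<le> R\<^sup>2" by (simp only: frame_norm_sq[of _ t])
  then show ?thesis unfolding x_def[symmetric] h_def[symmetric] by (simp add: power2_eq_square algebra_simps)
qed

lemma in_inner_disc:
  assumes "((z - m t) \<bullet> tau t)\<^sup>2 + ((m t - z) \<bullet> nu t)\<^sup>2 \<le> 2 * R * ((m t - z) \<bullet> nu t)"
    and R: "R > 0" "\<And>s. R \<le> r s"
  shows "z \<in> M"
proof -
  define x where "x = (z - m t) \<bullet> tau t"
  define h where "h = (m t - z) \<bullet> nu t"
  have "(z - (m t - R *\<^sub>R nu t)) \<bullet> tau t = x" "(z - (m t - R *\<^sub>R nu t)) \<bullet> nu t = R - h"
    by (simp_all add: x_def h_def inner_diff_left)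
  then have "(norm (z - (m t - R *\<^sub>R nu t)))\<^sup>2 = x\<^sup>2 + (R - h)\<^sup>2"
    by (simp only: frame_norm_sq[of _ t])
  also have "\<dots> \<le> R\<^sup>2"
    using assms(1) unfolding x_def[symmetric] h_def[symmetric] by (simp add: power2_eq_square algebra_simps)
  finally have "(norm (z - (m t - R *\<^sub>R nu t)))\<^sup>2 \<le> R\<^sup>2" .
  then have "norm (z - (m t - R *\<^sub>R nu t)) \<le> R" by (rule power2_le_imp_le) (use R(1) in simp)
  then have "z \<in> cball (m t - R *\<^sub>R nu t) R" by (simp add: dist_norm norm_minus_commute)
  then show ?thesis using cball_subset[OF R(2)] by blast
qed

lemma r_bounded_above: obtains B where "\<And>t. r t \<le> B"
proof -
  obtain x where x: "x \<in> {0..2 * pi}" "\<And>y. y \<in> {0..2 * pi} \<Longrightarrow> r y \<le> r x"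
    using continuous_attains_sup[of "{0..2 * pi}" r] continuous_on_subset[OF r_cont] by auto
  have "r t \<le> r x" for t
  proof -
    obtain n where "0 \<le> t + of_int n * (2 * pi)" "t + of_int n * (2 * pi) < 0 + 2 * pi"
      by (rule angle_reduce)
    then show ?thesis using x(2)[of "t + of_int n * (2 * pi)"] by (simp add: r_periodic)
  qed
  then show ?thesis by (rule that)
qed

definition pt :: "real \<Rightarrow> real \<Rightarrow> real \<Rightarrow> real^2" where
  "pt t x h = m t + x *\<^sub>R tau t - h *\<^sub>R nu t"

lemma pt_coords [simp]: "(pt t x h - m t) \<bullet> tau t = x" "(m t - pt t x h) \<bullet> nu t = h"
  by (simp_all add: pt_def inner_diff_left inner_add_left)

lemma pt_eq: "z = pt t ((z - m t) \<bullet> tau t) ((m t - z) \<bullet> nu t)"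
proof -
  have "z - m t = ((z - m t) \<bullet> tau t) *\<^sub>R tau t + ((z - m t) \<bullet> nu t) *\<^sub>R nu t" by (rule frame_expand)
  moreover have "(m t - z) \<bullet> nu t = - ((z - m t) \<bullet> nu t)" by (simp add: inner_diff_left)
  ultimately show ?thesis unfolding pt_def by (simp add: algebra_simps)
qed

lemma pt_add: "pt t x h + u *\<^sub>R tau t = pt t (x + u) h"
  by (simp add: pt_def algebra_simps)

lemma pt_norm: "(norm (pt t x h - m t))\<^sup>2 = x\<^sup>2 + h\<^sup>2"
  by (simp add: frame_norm_sq[of _ t] pt_def inner_diff_left inner_add_left)

lemma pt_outer: "pt t x h \<in> M \<Longrightarrow> (\<And>s. r s \<le> R) \<Longrightarrow> x\<^sup>2 + h\<^sup>2 \<le> 2 * R * h"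
  using in_outer_disc[of "pt t x h" R t] by simp

lemma pt_inner: "x\<^sup>2 + h\<^sup>2 \<le> 2 * R * h \<Longrightarrow> R > 0 \<Longrightarrow> (\<And>s. R \<le> r s) \<Longrightarrow> pt t x h \<in> M"
  using in_inner_disc[of "pt t x h" t R] by simp

lemma pt_depth: "pt t x h \<in> M \<Longrightarrow> h \<ge> 0"
  using support[of "pt t x h" t] pt_coords(2)[of t x h] by (simp add: inner_diff_left)

lemma pt_norm_tendsto:
  assumes "x \<longlonglongrightarrow> 0" "h \<longlonglongrightarrow> 0"
  shows "(\<lambda>n. norm (pt t (x n) (h n) - m t)) \<longlonglongrightarrow> 0"
proof -
  have "norm (pt t (x n) (h n) - m t) = sqrt ((x n)\<^sup>2 + (h n)\<^sup>2)" for n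
    unfolding pt_norm[symmetric, of "x n" "h n" t] by simp
  moreover have "(\<lambda>n. sqrt ((x n)\<^sup>2 + (h n)\<^sup>2)) \<longlonglongrightarrow> sqrt (0\<^sup>2 + 0\<^sup>2)"
    by (intro tendsto_intros assms)
  ultimately show ?thesis by simp
qed

text \<open>A radius slightly below \<open>r t\<close> still satisfies the strict inequality at the
  limit, and the parabola of that radius lies in \<open>M\<close> near \<open>m t\<close>. The
  coordinates may vary with \<open>n\<close> because those of the chords of \<open>L\<close>
  do.\<close>

lemma parabolic_in:
  assumes d: "d \<longlonglongrightarrow> 0" "\<And>n. d n > 0" and x: "x \<longlonglongrightarrow> x0" and h: "h \<longlonglongrightarrow> h0"
    and "x0\<^sup>2 < 2 * r t * h0"
  shows "\<forall>\<^sub>F n in sequentially. pt t (d n * x n) ((d n)\<^sup>2 * h n) \<in> M"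
proof -
  have h0: "h0 > 0"
  proof (rule ccontr)
    assume "\<not> h0 > 0"
    then have "2 * r t * h0 \<le> 0" using r_pos[of t] by (intro mult_nonneg_nonpos) auto
    then show False using assms(5) zero_le_power2[of x0] by linarith
  qed
  define R where "R = (x0\<^sup>2 / (2 * h0) + r t) / 2"
  have "x0\<^sup>2 / (2 * h0) < r t" using assms(5) h0 by (simp add: field_simps)
  then have R: "x0\<^sup>2 / (2 * h0) < R" "R < r t" by (auto simp: R_def)
  have "x0\<^sup>2 / (2 * h0) \<ge> 0" using h0 by simp
  then have R0: "R > 0" using R(1) by linarith
  have xR: "x0\<^sup>2 < 2 * R * h0" using R(1) h0 by (simp add: field_simps)
  obtain e where e: "e > 0"
    "\<And>z. norm (z - m t) < e \<Longrightarrow> ((z - m t) \<bullet> tau t)\<^sup>2 \<le> 2 * R * ((m t - z) \<bullet> nu t) \<Longrightarrow> z \<in> M"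
    using osculation_inner[OF R0 R(2)] by blast
  have "(\<lambda>n. d n * x n) \<longlonglongrightarrow> 0 * x0" "(\<lambda>n. (d n)\<^sup>2 * h n) \<longlonglongrightarrow> 0\<^sup>2 * h0"
    by (intro tendsto_intros d x h)+
  then have "(\<lambda>n. norm (pt t (d n * x n) ((d n)\<^sup>2 * h n) - m t)) \<longlonglongrightarrow> 0"
    by (intro pt_norm_tendsto) simp_all
  then have 1: "\<forall>\<^sub>F n in sequentially. norm (pt t (d n * x n) ((d n)\<^sup>2 * h n) - m t) < e"
    using e(1) by (rule order_tendstoD(2))
  have "(\<lambda>n. 2 * R * h n - (x n)\<^sup>2) \<longlonglongrightarrow> 2 * R * h0 - x0\<^sup>2" by (intro tendsto_intros x h)
  then have "\<forall>\<^sub>F n in sequentially. 0 < 2 * R * h n - (x n)\<^sup>2"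
    by (rule order_tendstoD(1)) (use xR in simp)
  then show ?thesis using 1
  proof eventually_elim
    case (elim n)
    have "(d n * x n)\<^sup>2 \<le> 2 * R * ((d n)\<^sup>2 * h n)"
      using mult_left_mono[of "(x n)\<^sup>2" "2 * R * h n" "(d n)\<^sup>2"] elim(1) by (simp add: power_mult_distrib mult.left_commute)
    then show ?case by (intro e(2) elim(2)) simp
  qed
qed

text \<open>Near \<open>m t\<close> the set stays inside a parabola of radius slightly above
  \<open>r t\<close>, which the points eventually violate.\<close>

lemma parabolic_out:
  assumes d: "d \<longlonglongrightarrow> 0" "\<And>n. d n > 0" and x: "x \<longlonglongrightarrow> x0" and h: "h \<longlonglongrightarrow> h0"
    and "x0\<^sup>2 > 2 * r t * h0"
  shows "\<forall>\<^sub>F n in sequentially. pt t (d n * x n) ((d n)\<^sup>2 * h n) \<notin> M"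
proof -
  obtain R where R: "r t < R" "x0\<^sup>2 > 2 * R * h0"
  \<comment> \<open>Dividing by \<open>h0\<close> needs positive depth; for nonpositive
    \<open>h0\<close> any larger radius preserves the inequality.\<close>
  proof (cases "h0 > 0")
    case True
    define R where "R = (x0\<^sup>2 / (2 * h0) + r t) / 2"
    have "x0\<^sup>2 / (2 * h0) > r t" using assms(5) True by (simp add: field_simps)
    then have "x0\<^sup>2 / (2 * h0) > R" "R > r t" by (auto simp: R_def)
    then show ?thesis using that[of R] True by (simp add: field_simps)
  next
    case False
    show ?thesis
    proof (rule that[of "r t + 1"])
      have "2 * (r t + 1) * h0 \<le> 2 * r t * h0" using False by (simp add: algebra_simps)
      then show "2 * (r t + 1) * h0 < x0\<^sup>2" using assms(5) by simp
    qed simp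
  qed
  obtain e where e: "e > 0"
    "\<And>z. z \<in> M \<Longrightarrow> norm (z - m t) < e \<Longrightarrow> ((z - m t) \<bullet> tau t)\<^sup>2 \<le> 2 * R * ((m t - z) \<bullet> nu t)"
    using osculation_outer[OF R(1)] by blast
  have "(\<lambda>n. d n * x n) \<longlonglongrightarrow> 0 * x0" "(\<lambda>n. (d n)\<^sup>2 * h n) \<longlonglongrightarrow> 0\<^sup>2 * h0"
    by (intro tendsto_intros d x h)+
  then have "(\<lambda>n. norm (pt t (d n * x n) ((d n)\<^sup>2 * h n) - m t)) \<longlonglongrightarrow> 0"
    by (intro pt_norm_tendsto) simp_all
  then have 1: "\<forall>\<^sub>F n in sequentially. norm (pt t (d n * x n) ((d n)\<^sup>2 * h n) - m t) < e"
    using e(1) by (rule order_tendstoD(2))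
  have "(\<lambda>n. (x n)\<^sup>2 - 2 * R * h n) \<longlonglongrightarrow> x0\<^sup>2 - 2 * R * h0" by (intro tendsto_intros x h)
  then have "\<forall>\<^sub>F n in sequentially. 0 < (x n)\<^sup>2 - 2 * R * h n"
    by (rule order_tendstoD(1)) (use R in simp)
  then show ?thesis using 1
  proof eventually_elim
    case (elim n)
    have "(d n)\<^sup>2 * (2 * R * h n) < (d n)\<^sup>2 * (x n)\<^sup>2"
      using elim(1) d(2)[of n] by (intro mult_strict_left_mono) auto
    then have "\<not> (d n * x n)\<^sup>2 \<le> 2 * R * ((d n)\<^sup>2 * h n)" by (simp add: power_mult_distrib mult.left_commute)
    then show ?case using e(2)[OF _ elim(2)] by auto
  qed
qed

text \<open>The disc of radius \<open>e\<close> touching at \<open>m t\<close> contains a rectangle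
  of half width \<open>q\<close> between the depths \<open>h' / 2\<close> and \<open>h'\<close>. The
  factor in \<open>h' = e / (2 * R) * h\<close> ensures \<open>h' \<le> e\<close>, so that both
  squares in the disc inequality are at most \<open>e\<close> times the depth.\<close>

lemma cap_area:
  assumes e: "0 < e" "\<And>s. e \<le> r s" and R: "\<And>s. r s \<le> R" and h: "0 < h" "h \<le> 2 * R"
  shows "ennreal (sqrt (e / 2) * (e / (2 * R) * h) powr (3/2)) \<le> emeasure lborel (M \<inter> {z. (m t - z) \<bullet> nu t < h})"
proof -
  have eR: "e \<le> R" using e(2)[of 0] R[of 0] by simp
  define h' where "h' = e / (2 * R) * h"
  have R0: "R > 0" using e eR by simp
  have h': "0 < h'" "h' \<le> e" "h' \<le> h"
  proof -
    show "0 < h'" using e h R0 by (simp add: h'_def)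
    have "e / (2 * R) * h \<le> e / (2 * R) * (2 * R)" using e h R0 by (intro mult_left_mono) auto
    then show "h' \<le> e" using R0 by (simp add: h'_def)
    have "e / (2 * R) \<le> 1" using eR R0 by simp
    then show "h' \<le> h" using mult_right_mono[of "e / (2 * R)" 1 h] h by (simp add: h'_def)
  qed
  define q where "q = sqrt (e * h' / 2)"
  have q: "q \<ge> 0" "q\<^sup>2 = e * h' / 2" using e h' by (simp_all add: q_def)
  define S where "S = M \<inter> {z. (m t - z) \<bullet> nu t < h}"
  have S: "S \<in> sets borel"
    unfolding S_def using closed by (intro sets.Int borel_closed borel_open open_Collect_less continuous_intros) auto
  have "pt t a b \<in> S" if "b \<in> {h'/2<..<h'}" "a \<in> {-q..q}" for a b
  proof -
    have "\<bar>a\<bar> \<le> q" using that by auto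
    then have "a\<^sup>2 \<le> q\<^sup>2" using power2_le_iff_abs_le[OF q(1)] by blast
    moreover have "b * b \<le> e * b" using that h' by (intro mult_right_mono) auto
    moreover have "e * (h' / 2) \<le> e * b" using that e by (intro mult_left_mono) auto
    ultimately have "a\<^sup>2 + b\<^sup>2 \<le> 2 * e * b" using q(2) by (simp add: power2_eq_square)
    then have "pt t a b \<in> M" by (rule pt_inner) (use e in auto)
    then show ?thesis using that h' by (simp add: S_def)
  qed
  then have "(\<integral>\<^sup>+b. \<integral>\<^sup>+a. indicator {h'/2<..<h'} b * indicator {-q..q} a \<partial>lborel \<partial>lborel)
      \<le> (\<integral>\<^sup>+b. \<integral>\<^sup>+a. indicator S (pt t a b) \<partial>lborel \<partial>lborel)"
    by (intro nn_integral_mono) (auto simp: indicator_def)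
  also have "\<dots> = emeasure lborel S"
    using nn_integral_frame[of "indicator S" 1 "m t" t] S by (simp add: pt_def)
  also have "(\<integral>\<^sup>+b. \<integral>\<^sup>+a. indicator {h'/2<..<h'} b * indicator {-q..q} a \<partial>lborel \<partial>lborel)
      = (\<integral>\<^sup>+b. indicator {h'/2<..<h'} b * ennreal (2 * q) \<partial>lborel)"
    using q(1) by (intro nn_integral_cong) (simp add: nn_integral_cmult)
  also have "\<dots> = ennreal (h' / 2) * ennreal (2 * q)"
    using h' by (subst nn_integral_multc) auto
  also have "\<dots> = ennreal (h' * q)" using h' q by (simp add: ennreal_mult[symmetric])
  also have "h' * q = sqrt (e / 2) * h' powr (3/2)"
  proof -
    have "h' powr (3/2) = h' powr 1 * h' powr (1/2)" unfolding powr_add[symmetric] by simp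
    also have "\<dots> = h' * sqrt h'" using h' by (simp add: powr_half_sqrt)
    finally have "h' powr (3/2) = h' * sqrt h'" .
    moreover have "q = sqrt (e / 2) * sqrt h'"
      unfolding q_def real_sqrt_mult[symmetric] by simp
    ultimately show ?thesis by simp
  qed
  finally show ?thesis by (simp add: h'_def S_def)
qed

end

section \<open>Chords of \<open>L\<close> and bounds for the missing area\<close>

context two_discs
begin

lemma R_pos: "R > 0" and R_gt: "\<rho> < R" "0 < R - \<rho>"
  using L.R(1) rho_pos rho_less by auto

lemma Z_eq: assumes "0 < q" "q < 2 * R" shows "Z (q *\<^sub>R tau t) = chord_start L (q *\<^sub>R tau t)"
  using assms by (simp add: Z_def)

text \<open>The sagitta of the extreme chord of length \<open>q\<close>; together with
  \<open>off\<close> these are the coordinates of its start in the frame at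
  \<open>l t\<close>.\<close>

definition sag :: "real \<Rightarrow> real \<Rightarrow> real" where "sag t q = (l t - Z (q *\<^sub>R tau t)) \<bullet> nu t"
definition off :: "real \<Rightarrow> real \<Rightarrow> real" where "off t q = (Z (q *\<^sub>R tau t) - l t) \<bullet> tau t"

lemma Z_pt: "Z (q *\<^sub>R tau t) = L.pt t (off t q) (sag t q)"
  unfolding sag_def off_def by (rule L.pt_eq)

lemma Z_chord:
  assumes "0 < q" "q < 2 * R"
  shows "L.pt t (off t q) (sag t q) \<in> L" "L.pt t (off t q + q) (sag t q) \<in> L"
    "\<And>x s. L.pt t x s \<in> L \<Longrightarrow> L.pt t (x + q) s \<in> L \<Longrightarrow> sag t q \<le> s"
proof -
  have n: "norm (q *\<^sub>R tau t) < 2 * R" using assms by simp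
  show "L.pt t (off t q) (sag t q) \<in> L" "L.pt t (off t q + q) (sag t q) \<in> L"
    using L.chord_start(1,2)[OF n] unfolding Z_eq[OF assms, symmetric] Z_pt L.pt_add by auto
  fix x s assume "L.pt t x s \<in> L" "L.pt t (x + q) s \<in> L"
  then have "rot (q *\<^sub>R tau t) \<bullet> L.pt t x s \<le> rot (q *\<^sub>R tau t) \<bullet> Z (q *\<^sub>R tau t)"
    unfolding Z_eq[OF assms] by (intro L.chord_start(3)[OF n]) (simp_all add: L.pt_add)
  then have "L.pt t x s \<bullet> nu t \<le> Z (q *\<^sub>R tau t) \<bullet> nu t" using assms(1) by (simp add: inner_commute)
  then show "sag t q \<le> s"
    using L.pt_coords(2)[of t x s] by (simp add: sag_def inner_diff_left)
qed

text \<open>A chord placed symmetrically at depth \<open>s\<close> in the disc of radius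
  \<open>R\<close> inside \<open>L\<close> competes with the extreme chord, which has the least
  depth.\<close>

lemma sag_le:
  assumes "0 < q" "q < 2 * R" "q\<^sup>2 / 4 + s\<^sup>2 \<le> 2 * R * s"
  shows "sag t q \<le> s"
proof (rule Z_chord(3)[OF assms(1,2)])
  show "L.pt t (- q / 2) s \<in> L" "L.pt t (- q / 2 + q) s \<in> L"
    using assms(3) L.R by (auto intro!: L.pt_inner[of _ _ R] simp: power2_eq_square field_simps)
qed

lemma sag_nonneg: "0 < q \<Longrightarrow> q < 2 * R \<Longrightarrow> 0 \<le> sag t q"
  using L.pt_depth Z_chord(1) by blast

text \<open>A chord of \<open>K\<close> at depth \<open>h\<close> obeys the inequality of the disc
  of radius \<open>\<rho>\<close>, so its length fits into the disc of radius \<open>R\<close>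
  already at depth \<open>\<rho> / R * h\<close>. The factor below 1 is the gain from the curvature
  gap.\<close>

lemma sag_le_depth:
  assumes "0 < q" "K.pt t x h \<in> K" "K.pt t (x + q) h \<in> K"
  shows "q < 2 * R" "sag t q \<le> \<rho> / R * h"
proof -
  have "K.pt t (x + q) h - K.pt t x h = q *\<^sub>R tau t"
    using K.pt_add[of t x h q] by (simp add: algebra_simps)
  then show q: "q < 2 * R"
    using K_diam(2)[OF assms(3,2)] assms(1) by simp
  have 1: "x\<^sup>2 + h\<^sup>2 \<le> 2 * \<rho> * h" "(x + q)\<^sup>2 + h\<^sup>2 \<le> 2 * \<rho> * h"
    using K.pt_outer rK_le assms by blast+
  have "q\<^sup>2 / 4 \<le> (x\<^sup>2 + (x + q)\<^sup>2) / 2"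
    using zero_le_power2[of "2 * x + q"] by (simp add: power2_eq_square field_simps)
  then have "q\<^sup>2 / 4 \<le> 2 * \<rho> * h - h\<^sup>2" using 1 by simp
  moreover have "(\<rho> / R * h)\<^sup>2 \<le> h\<^sup>2"
  proof -
    have "\<bar>\<rho> / R * h\<bar> \<le> \<bar>h\<bar>"
      using rho_pos R_pos R_gt mult_right_mono[of "\<rho> / R" 1 "\<bar>h\<bar>"] by (simp add: abs_mult)
    then show ?thesis by (rule abs_le_square_iff[THEN iffD1])
  qed
  ultimately have "q\<^sup>2 / 4 + (\<rho> / R * h)\<^sup>2 \<le> 2 * R * (\<rho> / R * h)"
    using R_pos by simp
  then show "sag t q \<le> \<rho> / R * h" by (rule sag_le[OF assms(1) q])
qed

lemma pt_translate:
  "K.pt t x h - (K.pt t a b - Z (q *\<^sub>R tau t)) = L.pt t (x - a + off t q) (h - b + sag t q)"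
  unfolding Z_pt by (simp add: K.pt_def L.pt_def algebra_simps)

lemma g_eq: "emeasure lborel (K - {z. z - v \<in> L}) = ennreal (A * (1 - g v))"
proof -
  have "emeasure lborel (K - {z. z - v \<in> L}) = emeasure lborel (K - (K \<inter> {z. z - v \<in> L}))"
    by (rule arg_cong[where f = "emeasure lborel"]) auto
  also have "\<dots> = emeasure lborel K - emeasure lborel (K \<inter> {z. z - v \<in> L})"
    using translate_sets by (intro emeasure_Diff) (auto simp: emeasure_K_translate)
  also have "\<dots> = ennreal (A - A * g v)"
    unfolding A_eq emeasure_K_translate using A_pos g_nonneg by (simp add: ennreal_minus)
  finally show ?thesis by (simp add: algebra_simps)
qed

text \<open>Points of the translate have depth at least \<open>h - sag t q\<close>, so the whole cap
  of \<open>K\<close> of depth \<open>(1 - \<rho> / R) * h\<close> is missed, and its area is at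
  least a multiple of \<open>h powr (3/2)\<close>.\<close>

lemma g_upper:
  obtains c where "c > 0"
    "\<And>t q x h. 0 < q \<Longrightarrow> K.pt t x h \<in> K \<Longrightarrow> K.pt t (x + q) h \<in> K \<Longrightarrow>
      g (K.pt t x h - Z (q *\<^sub>R tau t)) \<le> 1 - c * h powr (3/2)"
proof -
  obtain e where e: "e > 0" "\<And>t. e \<le> rK t" by (rule K.r_bounded_below) blast
  define u where "u = 1 - \<rho> / R"
  have u: "0 < u" "u \<le> 1" using R_gt R_pos rho_pos by (auto simp: u_def)
  define c where "c = sqrt (e / 2) * (e / (2 * \<rho>) * u) powr (3/2) / A"
  have c: "c > 0" using e rho_pos u A_pos by (simp add: c_def)
  have "g (K.pt t x h - Z (q *\<^sub>R tau t)) \<le> 1 - c * h powr (3/2)"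
    if q: "0 < q" and x: "K.pt t x h \<in> K" "K.pt t (x + q) h \<in> K" for t q x h
  proof -
    have 1: "x\<^sup>2 + h\<^sup>2 \<le> 2 * \<rho> * h" "(x + q)\<^sup>2 + h\<^sup>2 \<le> 2 * \<rho> * h"
      using K.pt_outer rK_le x by blast+
    have h0: "h > 0"
    proof -
      have "h \<ge> 0" using K.pt_depth[OF x(1)] .
      moreover have "h \<noteq> 0"
      proof
        assume "h = 0"
        then have "x\<^sup>2 \<le> 0" "(x + q)\<^sup>2 \<le> 0" using 1 by auto
        then show False using q by simp
      qed
      ultimately show ?thesis by simp
    qed
    have "h\<^sup>2 \<le> 2 * \<rho> * h" using 1(1) zero_le_power2[of x] by linarith
    then have "h * h \<le> 2 * \<rho> * h" by (simp add: power2_eq_square)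
    then have h2: "h \<le> 2 * \<rho>" using h0 by simp
    have s: "sag t q \<le> \<rho> / R * h" using sag_le_depth[OF q x] by simp
    define v where "v = K.pt t x h - Z (q *\<^sub>R tau t)"
    have "K \<inter> {z. (k t - z) \<bullet> nu t < u * h} \<subseteq> K - {z. z - v \<in> L}"
    proof
      fix z assume z: "z \<in> K \<inter> {z. (k t - z) \<bullet> nu t < u * h}"
      define x' where "x' = (z - k t) \<bullet> tau t"
      define h' where "h' = (k t - z) \<bullet> nu t"
      have zpt: "z = K.pt t x' h'" unfolding x'_def h'_def by (rule K.pt_eq)
      have zv: "z - v = L.pt t (x' - x + off t q) (h' - h + sag t q)"
        unfolding v_def zpt by (rule pt_translate)
      have "h' - h + sag t q < 0" using z s by (simp add: h'_def u_def left_diff_distrib)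
      then have "z - v \<notin> L" unfolding zv using L.pt_depth[of t] by fastforce
      then show "z \<in> K - {z. z - v \<in> L}" using z by simp
    qed
    then have "emeasure lborel (K \<inter> {z. (k t - z) \<bullet> nu t < u * h}) \<le> emeasure lborel (K - {z. z - v \<in> L})"
      using translate_sets by (intro emeasure_mono) auto
    moreover have "ennreal (sqrt (e / 2) * (e / (2 * \<rho>) * (u * h)) powr (3/2))
        \<le> emeasure lborel (K \<inter> {z. (k t - z) \<bullet> nu t < u * h})"
    proof (rule K.cap_area[OF e rK_le])
      show "0 < u * h" using u h0 by simp
      have "u * h \<le> 1 * h" using u h0 by (intro mult_right_mono) auto
      then show "u * h \<le> 2 * \<rho>" using h2 by simp
    qed
    ultimately have "ennreal (sqrt (e / 2) * (e / (2 * \<rho>) * (u * h)) powr (3/2)) \<le> ennreal (A * (1 - g v))"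
      unfolding g_eq by (rule order_trans[rotated])
    then have "sqrt (e / 2) * (e / (2 * \<rho>) * (u * h)) powr (3/2) \<le> A * (1 - g v)"
      using A_pos g_le_1[of v] by (subst (asm) ennreal_le_iff) auto
    moreover have "(e / (2 * \<rho>) * (u * h)) powr (3/2) = (e / (2 * \<rho>) * u) powr (3/2) * h powr (3/2)"
      using powr_mult[of "e / (2 * \<rho>) * u" h "3/2"] e rho_pos u h0 by (simp add: mult.assoc)
    ultimately have "A * (c * h powr (3/2)) \<le> A * (1 - g v)"
      using A_pos by (simp add: c_def)
    then show ?thesis using A_pos by (simp add: v_def)
  qed
  then show ?thesis using that c by blast
qed

end

text \<open>Two discs of different radii touching at the same point separate at a rate linear in the
  depth, so a small shift of the larger one uncovers only small depths. With tangential shift of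
  order \<open>d\<close> and normal shift of order \<open>d\<^sup>2\<close>, the missing region
  stays in a fixed box at the parabolic scale.\<close>

lemma disc_difference_depth:
  fixes x h p1 p2 \<rho> R :: real
  assumes "0 < \<rho>" "\<rho> < R" and 1: "x\<^sup>2 + h\<^sup>2 \<le> 2 * \<rho> * h"
    and 2: "\<not> (x - p1)\<^sup>2 + (h - p2)\<^sup>2 \<le> 2 * R * (h - p2)"
  shows "0 \<le> h" "x\<^sup>2 \<le> 2 * \<rho> * h"
    "(R - \<rho>) * h \<le> (2 * R + 4 * \<rho>) * \<bar>p2\<bar> + p2\<^sup>2 + (1 + 2 * \<rho> / (R - \<rho>)) * p1\<^sup>2"
proof -
  have "0 \<le> 2 * \<rho> * h" using 1 zero_le_power2[of x] zero_le_power2[of h] by linarith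
  then show h: "0 \<le> h" using assms(1) by (simp add: zero_le_mult_iff)
  show x: "x\<^sup>2 \<le> 2 * \<rho> * h" using 1 zero_le_power2[of h] by linarith
  have "h\<^sup>2 \<le> 2 * \<rho> * h" using 1 zero_le_power2[of x] by linarith
  then have h2: "h \<le> 2 * \<rho>" using h assms(1) by (cases "h = 0") (auto simp: power2_eq_square)
  \<comment> \<open>Weight in Young's inequality for the mixed term \<open>x * p1\<close>: its cost
    \<open>(R - \<rho>) * h\<close> is half of the available
    \<open>2 * (R - \<rho>) * h\<close>.\<close>
  define e where "e = (R - \<rho>) / (2 * \<rho>)"
  have e: "e > 0" "e * (2 * \<rho>) = R - \<rho>" "1 / e = 2 * \<rho> / (R - \<rho>)" using assms by (simp_all add: e_def)
  have "0 \<le> (e * x + p1)\<^sup>2 / e" using e by simp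
  also have "\<dots> = e * x\<^sup>2 + 2 * x * p1 + p1\<^sup>2 * (1 / e)"
    using e(1) by (simp add: power2_eq_square field_simps)
  finally have a: "- 2 * x * p1 \<le> e * x\<^sup>2 + p1\<^sup>2 * (2 * \<rho> / (R - \<rho>))" using e(3) by simp
  have "e * x\<^sup>2 \<le> e * (2 * \<rho> * h)" using x e(1) by (intro mult_left_mono) auto
  also have "e * (2 * \<rho> * h) = (R - \<rho>) * h" using e(2) by (metis mult.assoc)
  finally have b: "e * x\<^sup>2 \<le> (R - \<rho>) * h" .
  have "- (h * p2) \<le> h * \<bar>p2\<bar>" using h by (metis abs_ge_minus_self mult_left_mono mult_minus_right)
  also have "h * \<bar>p2\<bar> \<le> 2 * \<rho> * \<bar>p2\<bar>" using h2 by (intro mult_right_mono) auto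
  finally have c: "- 2 * (h * p2) \<le> 4 * \<rho> * \<bar>p2\<bar>" by simp
  have d: "R * p2 \<le> R * \<bar>p2\<bar>" using assms by (intro mult_left_mono) auto
  have "2 * R * (h - p2) < (x - p1)\<^sup>2 + (h - p2)\<^sup>2" using 2 by simp
  also have "\<dots> = (x\<^sup>2 + h\<^sup>2) - 2 * x * p1 + p1\<^sup>2 - 2 * (h * p2) + p2\<^sup>2"
    by (simp add: power2_eq_square algebra_simps)
  finally have f: "2 * R * h - 2 * R * p2 < 2 * \<rho> * h - 2 * x * p1 + p1\<^sup>2 - 2 * (h * p2) + p2\<^sup>2"
    using 1 by (simp add: right_diff_distrib)
  have "(R - \<rho>) * h = R * h - \<rho> * h" by (simp add: left_diff_distrib)
  then have "(R - \<rho>) * h \<le> 2 * R * \<bar>p2\<bar> + p1\<^sup>2 * (2 * \<rho> / (R - \<rho>)) + p1\<^sup>2 + 4 * \<rho> * \<bar>p2\<bar> + p2\<^sup>2"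
    using a b c d f by linarith
  then show "(R - \<rho>) * h \<le> (2 * R + 4 * \<rho>) * \<bar>p2\<bar> + p2\<^sup>2 + (1 + 2 * \<rho> / (R - \<rho>)) * p1\<^sup>2"
    by (simp add: distrib_right distrib_left mult.commute)
qed

lemma finite_square_eq: "finite {x :: real. (x - c)\<^sup>2 = d}"
proof (rule finite_subset)
  show "{x. (x - c)\<^sup>2 = d} \<subseteq> {c + sqrt d, c - sqrt d}"
  proof
    fix x assume "x \<in> {x. (x - c)\<^sup>2 = d}"
    then have "sqrt d = \<bar>x - c\<bar>" by auto
    then show "x \<in> {c + sqrt d, c - sqrt d}" by (auto simp: abs_if split: if_splits)
  qed
qed simp

lemma AE_finite: "finite S \<Longrightarrow> AE x :: real in lborel. x \<notin> S"
  by (intro AE_not_in countable_imp_null_set_lborel) (auto intro: countable_finite)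

lemma exists_greater_near:
  assumes "isCont f (x :: real)" "a < f x" obtains y where "x < y" "a < (f y :: real)"
proof -
  have "(f \<longlongrightarrow> f x) (at_right x)"
    using assms(1) by (simp add: isCont_def filterlim_at_split)
  then have "\<forall>\<^sub>F y in at_right x. a < f y \<and> x < y"
    using assms(2) by (intro eventually_conj order_tendstoD(1) eventually_at_right_less)
  then have "\<exists>y. a < f y \<and> x < y"
    by (intro eventually_happens'[where F = "at_right x"]) simp_all
  then show ?thesis using that by blast
qed

text \<open>The logarithm is squeezed by \<open>- u - 2 * u ^ 2 \<le> ln (1 - u) \<le> - u\<close>.
  Replacing \<open>n\<close> by \<open>n - 1\<close> costs only \<open>u n\<close>, which tends to
  0.\<close>

lemma power_exp_limit:
  fixes u :: "nat \<Rightarrow> real"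
  assumes u: "(\<lambda>n. real n * u n) \<longlonglongrightarrow> x" and nonneg: "\<And>n. 0 \<le> u n"
  shows "(\<lambda>n. (1 - u n) ^ (n - 1)) \<longlonglongrightarrow> exp (- x)"
proof -
  have "(\<lambda>n. (real n * u n) * (1 / real n)) \<longlonglongrightarrow> x * 0"
    by (intro tendsto_mult u lim_1_over_n)
  moreover have "\<forall>\<^sub>F n in sequentially. (real n * u n) * (1 / real n) = u n"
    by (rule eventually_mono[OF eventually_gt_at_top[of 0]]) simp
  ultimately have "u \<longlonglongrightarrow> x * 0" by (rule Lim_transform_eventually)
  then have u0: "u \<longlonglongrightarrow> 0" by (simp only: mult_zero_right)
  have s: "(\<lambda>n. real (n - 1) * u n) \<longlonglongrightarrow> x"
  proof (rule Lim_transform_eventually)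
    have "(\<lambda>n. real n * u n - u n) \<longlonglongrightarrow> x - 0" by (intro tendsto_diff u u0)
    then show "(\<lambda>n. real n * u n - u n) \<longlonglongrightarrow> x" by simp
    show "\<forall>\<^sub>F n in sequentially. real n * u n - u n = real (n - 1) * u n"
      by (rule eventually_mono[OF eventually_ge_at_top[of 1]]) (simp add: of_nat_diff algebra_simps)
  qed
  have "(\<lambda>n. real (n - 1) * ln (1 - u n)) \<longlonglongrightarrow> - x"
  proof (rule tendsto_sandwich)
    have "(\<lambda>n. - (real (n - 1) * u n) - 2 * (real (n - 1) * u n) * u n) \<longlonglongrightarrow> - x - 2 * x * 0"
      by (intro tendsto_intros s u0)
    then show "(\<lambda>n. - (real (n - 1) * u n) - 2 * (real (n - 1) * u n) * u n) \<longlonglongrightarrow> - x" by simp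
    show "(\<lambda>n. - (real (n - 1) * u n)) \<longlonglongrightarrow> - x" by (intro tendsto_intros s)
    have small: "\<forall>\<^sub>F n in sequentially. u n < 1/2" using u0 by (rule order_tendstoD(2)) simp
    show "\<forall>\<^sub>F n in sequentially. - (real (n - 1) * u n) - 2 * (real (n - 1) * u n) * u n \<le> real (n - 1) * ln (1 - u n)"
      using small
    proof eventually_elim
      case (elim n)
      have "- u n - 2 * (u n)\<^sup>2 \<le> ln (1 - u n)"
        using ln_one_minus_pos_lower_bound[of "u n"] nonneg[of n] elim by simp
      from mult_left_mono[OF this, of "real (n - 1)"] show ?case
        by (simp add: power2_eq_square algebra_simps)
    qed
    show "\<forall>\<^sub>F n in sequentially. real (n - 1) * ln (1 - u n) \<le> - (real (n - 1) * u n)"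
      using small
    proof eventually_elim
      case (elim n)
      have "ln (1 - u n) \<le> - u n"
        using ln_one_minus_pos_upper_bound[of "u n"] nonneg[of n] elim by simp
      from mult_left_mono[OF this, of "real (n - 1)"] show ?case by simp
    qed
  qed
  then have "(\<lambda>n. exp (real (n - 1) * ln (1 - u n))) \<longlonglongrightarrow> exp (- x)" by (intro tendsto_intros)
  then show ?thesis
  proof (rule Lim_transform_eventually)
    have "\<forall>\<^sub>F n in sequentially. u n < 1" using u0 by (rule order_tendstoD(2)) simp
    then show "\<forall>\<^sub>F n in sequentially. exp (real (n - 1) * ln (1 - u n)) = (1 - u n) ^ (n - 1)"
      by (rule eventually_mono) (simp add: exp_of_nat_mult)
  qed
qed

section \<open>Parabolic limits of chords and caps\<close>

context two_discs
begin

text \<open>In the limit \<open>L\<close> is a parabola, whose chords parallel to the tangent are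
  symmetric about the axis. A symmetric competitor bounds the sagitta from above; having both end
  points in an outer parabola bounds it from below and forces the symmetry.\<close>

lemma chord_limits:
  assumes q: "q > 0" and d: "d \<longlonglongrightarrow> 0" "\<And>n. d n > 0"
  shows "(\<lambda>n. sag t (d n * q) / (d n)\<^sup>2) \<longlonglongrightarrow> q\<^sup>2 / (8 * rL t)" (is ?sag)
    and "(\<lambda>n. off t (d n * q) / d n) \<longlonglongrightarrow> - q / 2" (is ?off)
proof -
  define \<sigma> where "\<sigma> = (\<lambda>n. sag t (d n * q) / (d n)\<^sup>2)"
  define \<xi> where "\<xi> = (\<lambda>n. off t (d n * q) / d n)"
  have so: "sag t (d n * q) = (d n)\<^sup>2 * \<sigma> n" "off t (d n * q) = d n * \<xi> n" for n
    using d(2)[of n] by (simp_all add: \<sigma>_def \<xi>_def)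
  have dq: "(\<lambda>n. d n * q) \<longlonglongrightarrow> 0" using tendsto_mult_right[OF d(1), of q] by simp
  have dq2: "\<forall>\<^sub>F n in sequentially. 0 < d n * q \<and> d n * q < 2 * R"
    using order_tendstoD(2)[OF dq, of "2 * R"] R_pos d(2) q by simp
  have rp: "rL t > 0" by (rule L.r_pos)
  have upper: "\<forall>\<^sub>F n in sequentially. \<sigma> n \<le> q\<^sup>2 / (8 * R0)" if R0: "0 < R0" "R0 < rL t" for R0
  proof -
    define h where "h = q\<^sup>2 / (8 * R0)"
    have "R0 * (2 * h) = q\<^sup>2 / 4" using R0 by (simp add: h_def)
    moreover have "R0 * (2 * h) < rL t * (2 * h)" using R0 q by (intro mult_strict_right_mono) (auto simp: h_def)
    ultimately have h: "(q / 2)\<^sup>2 < 2 * rL t * h" by (simp add: power2_eq_square)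
    have "\<forall>\<^sub>F n in sequentially. L.pt t (d n * (- q / 2)) ((d n)\<^sup>2 * h) \<in> L"
      by (rule L.parabolic_in[OF d tendsto_const tendsto_const]) (use h in simp)
    moreover have "\<forall>\<^sub>F n in sequentially. L.pt t (d n * (q / 2)) ((d n)\<^sup>2 * h) \<in> L"
      by (rule L.parabolic_in[OF d tendsto_const tendsto_const]) (use h in simp)
    ultimately show ?thesis using dq2
    proof eventually_elim
      case (elim n)
      have eq: "d n * (- q / 2) + d n * q = d n * (q / 2)" by (simp add: field_simps)
      have "sag t (d n * q) \<le> (d n)\<^sup>2 * h"
      proof (rule Z_chord(3))
        show "0 < d n * q" "d n * q < 2 * R" using elim by auto
        show "L.pt t (d n * (- q / 2)) ((d n)\<^sup>2 * h) \<in> L" by (rule elim(1))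
        show "L.pt t (d n * (- q / 2) + d n * q) ((d n)\<^sup>2 * h) \<in> L" unfolding eq by (rule elim(2))
      qed
      then have "\<sigma> n \<le> h" using d(2)[of n] by (simp add: so)
      then show ?case by (simp add: h_def)
    qed
  qed
  \<comment> \<open>The crude bound from the disc of radius \<open>R\<close> shows that the chord
    shrinks to \<open>l t\<close>, as required by the outer osculation estimate, which is valid only
    near that point.\<close>
  have sag0: "(\<lambda>n. sag t (d n * q)) \<longlonglongrightarrow> 0"
  proof (rule tendsto_sandwich[OF _ _ tendsto_const])
    show "\<forall>\<^sub>F n in sequentially. 0 \<le> sag t (d n * q)"
      using dq2 by (rule eventually_mono) (simp add: sag_nonneg)
    show "\<forall>\<^sub>F n in sequentially. sag t (d n * q) \<le> (d n * q)\<^sup>2 / (4 * R)"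
      using dq2
    proof eventually_elim
      case (elim n)
      define x where "x = (d n * q)\<^sup>2"
      have "x \<le> (2 * R)\<^sup>2" unfolding x_def using elim by (intro power_mono) auto
      then have "x * x \<le> x * (4 * R\<^sup>2)" using zero_le_power2[of "d n * q"] by (intro mult_left_mono) (auto simp: x_def)
      then have "x / 4 + (x / (4 * R))\<^sup>2 \<le> 2 * R * (x / (4 * R))"
        using R_pos by (simp add: power2_eq_square field_simps)
      then show ?case using sag_le[of "d n * q"] elim by (simp add: x_def)
    qed
    have "(\<lambda>n. (d n * q)\<^sup>2 / (4 * R)) \<longlonglongrightarrow> 0\<^sup>2 / (4 * R)" using R_pos by (intro tendsto_intros dq) auto
    then show "(\<lambda>n. (d n * q)\<^sup>2 / (4 * R)) \<longlonglongrightarrow> 0" by simp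
  qed
  have off0: "(\<lambda>n. off t (d n * q)) \<longlonglongrightarrow> 0"
  proof -
    obtain B where B: "\<And>t. rL t \<le> B" by (rule L.r_bounded_above) blast
    have "(\<lambda>n. (off t (d n * q))\<^sup>2) \<longlonglongrightarrow> 0"
    proof (rule tendsto_sandwich[OF _ _ tendsto_const])
      show "\<forall>\<^sub>F n in sequentially. 0 \<le> (off t (d n * q))\<^sup>2" by simp
      show "\<forall>\<^sub>F n in sequentially. (off t (d n * q))\<^sup>2 \<le> 2 * B * sag t (d n * q)"
        using dq2
      proof eventually_elim
        case (elim n)
        have "(off t (d n * q))\<^sup>2 + (sag t (d n * q))\<^sup>2 \<le> 2 * B * sag t (d n * q)"
          using L.pt_outer[OF Z_chord(1) B] elim by blast
        then show ?case using zero_le_power2[of "sag t (d n * q)"] by linarith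
      qed
      show "(\<lambda>n. 2 * B * sag t (d n * q)) \<longlonglongrightarrow> 0" using tendsto_mult_left[OF sag0, of "2 * B"] by simp
    qed
    then have "(\<lambda>n. sqrt ((off t (d n * q))\<^sup>2)) \<longlonglongrightarrow> sqrt 0" by (rule tendsto_real_sqrt)
    then show ?thesis by (simp add: tendsto_rabs_zero_iff)
  qed
  \<comment> \<open>The parabola inequalities at the two end points are averaged: the mean of the
    squares is the square of the centred offset plus \<open>q\<^sup>2 / 4\<close>.\<close>
  have lower: "\<forall>\<^sub>F n in sequentially. (\<xi> n + q / 2)\<^sup>2 + q\<^sup>2 / 4 \<le> 2 * R1 * \<sigma> n" if R1: "rL t < R1" for R1
  proof -
    obtain e where e: "e > 0"
      "\<And>z. z \<in> L \<Longrightarrow> norm (z - l t) < e \<Longrightarrow> ((z - l t) \<bullet> tau t)\<^sup>2 \<le> 2 * R1 * ((l t - z) \<bullet> nu t)"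
      using L.osculation_outer[OF R1] by blast
    have "(\<lambda>n. off t (d n * q) + d n * q) \<longlonglongrightarrow> 0" using tendsto_add[OF off0 dq] by simp
    from order_tendstoD(2)[OF L.pt_norm_tendsto[OF this sag0, of t] e(1)]
      order_tendstoD(2)[OF L.pt_norm_tendsto[OF off0 sag0, of t] e(1)] dq2
    show ?thesis
    proof eventually_elim
      case (elim n)
      have "(off t (d n * q))\<^sup>2 \<le> 2 * R1 * sag t (d n * q)" "(off t (d n * q) + d n * q)\<^sup>2 \<le> 2 * R1 * sag t (d n * q)"
        using e(2)[OF Z_chord(1)[of "d n * q" t]] e(2)[OF Z_chord(2)[of "d n * q" t]] elim by simp_all
      then have "(d n)\<^sup>2 * (\<xi> n)\<^sup>2 \<le> (d n)\<^sup>2 * (2 * R1 * \<sigma> n)" "(d n)\<^sup>2 * (\<xi> n + q)\<^sup>2 \<le> (d n)\<^sup>2 * (2 * R1 * \<sigma> n)"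
      proof -
        have "(d n)\<^sup>2 * (\<xi> n)\<^sup>2 = (d n * \<xi> n)\<^sup>2" by (simp add: power_mult_distrib)
        moreover have "(d n)\<^sup>2 * (\<xi> n + q)\<^sup>2 = (d n * \<xi> n + d n * q)\<^sup>2"
          by (simp only: power_mult_distrib distrib_left[symmetric])
        moreover have "(d n)\<^sup>2 * (2 * R1 * \<sigma> n) = 2 * R1 * ((d n)\<^sup>2 * \<sigma> n)" by simp
        ultimately show "(d n)\<^sup>2 * (\<xi> n)\<^sup>2 \<le> (d n)\<^sup>2 * (2 * R1 * \<sigma> n)" "(d n)\<^sup>2 * (\<xi> n + q)\<^sup>2 \<le> (d n)\<^sup>2 * (2 * R1 * \<sigma> n)"
          using \<open>(off t (d n * q))\<^sup>2 \<le> 2 * R1 * sag t (d n * q)\<close> \<open>(off t (d n * q) + d n * q)\<^sup>2 \<le> 2 * R1 * sag t (d n * q)\<close>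
          unfolding so by linarith+
      qed
      then have "(\<xi> n)\<^sup>2 \<le> 2 * R1 * \<sigma> n" "(\<xi> n + q)\<^sup>2 \<le> 2 * R1 * \<sigma> n"
        using d(2)[of n] by simp_all
      then show ?case by (simp add: power2_eq_square field_simps)
    qed
  qed
  show sag: ?sag
    unfolding \<sigma>_def[symmetric]
  proof (rule order_tendstoI)
    fix a assume a: "a < q\<^sup>2 / (8 * rL t)"
    have "isCont (\<lambda>r. q\<^sup>2 / (8 * r)) (rL t)" using rp by (intro continuous_intros) auto
    from exists_greater_near[OF this a] obtain R1 where R1: "rL t < R1" "a < q\<^sup>2 / (8 * R1)" by blast
    show "\<forall>\<^sub>F n in sequentially. a < \<sigma> n"
      using lower[OF R1(1)]
    proof eventually_elim
      case (elim n)
      have "q\<^sup>2 / 4 \<le> 2 * R1 * \<sigma> n" using elim zero_le_power2[of "\<xi> n + q / 2"] by linarith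
      then have "q\<^sup>2 / (8 * R1) \<le> \<sigma> n" using R1(1) rp by (simp add: field_simps)
      then show ?case using R1(2) by simp
    qed
  next
    fix a assume a: "a > q\<^sup>2 / (8 * rL t)"
    \<comment> \<open>Perturbing the curvature upwards makes the radius smaller, as
      \<open>upper\<close> requires.\<close>
    have "isCont (\<lambda>s. - (q\<^sup>2 * s / 8)) (1 / rL t)" by (intro continuous_intros) simp
    moreover have "- a < - (q\<^sup>2 * (1 / rL t) / 8)" using a by simp
    ultimately obtain s where s: "1 / rL t < s" "- a < - (q\<^sup>2 * s / 8)"
      by (rule exists_greater_near)
    have s0: "s > 0" using s(1) rp by (meson less_trans zero_less_divide_1_iff)
    then have "1 / s < rL t" using s(1) rp by (simp add: field_simps)
    then have "\<forall>\<^sub>F n in sequentially. \<sigma> n \<le> q\<^sup>2 / (8 * (1 / s))" using s0 by (intro upper) auto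
    then show "\<forall>\<^sub>F n in sequentially. \<sigma> n < a"
      by (rule eventually_mono) (use s s0 in \<open>simp add: field_simps\<close>)
  qed
  have "(\<lambda>n. (\<xi> n + q / 2)\<^sup>2) \<longlonglongrightarrow> 0"
  proof (rule order_tendstoI)
    fix a :: real assume "a > 0"
    define R1 where "R1 = rL t * (1 + 2 * a / q\<^sup>2)"
    have R1: "rL t < R1" using rp q \<open>a > 0\<close> by (simp add: R1_def)
    have "(\<lambda>n. 2 * R1 * \<sigma> n - q\<^sup>2 / 4) \<longlonglongrightarrow> 2 * R1 * (q\<^sup>2 / (8 * rL t)) - q\<^sup>2 / 4"
      using sag unfolding \<sigma>_def[symmetric] by (intro tendsto_intros)
    moreover have "2 * R1 * (q\<^sup>2 / (8 * rL t)) - q\<^sup>2 / 4 < a"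
      using rp q \<open>a > 0\<close> by (simp add: R1_def field_simps)
    ultimately have "\<forall>\<^sub>F n in sequentially. 2 * R1 * \<sigma> n - q\<^sup>2 / 4 < a" by (rule order_tendstoD(2))
    then show "\<forall>\<^sub>F n in sequentially. (\<xi> n + q / 2)\<^sup>2 < a"
      using lower[OF R1] by eventually_elim linarith
  next
    fix a :: real assume "a < 0"
    then show "\<forall>\<^sub>F n in sequentially. a < (\<xi> n + q / 2)\<^sup>2"
      by (intro always_eventually allI) (rule less_le_trans[OF _ zero_le_power2])
  qed
  then have "(\<lambda>n. sqrt ((\<xi> n + q / 2)\<^sup>2)) \<longlonglongrightarrow> sqrt 0" by (rule tendsto_real_sqrt)
  then have "(\<lambda>n. \<xi> n + q / 2) \<longlonglongrightarrow> 0" by (simp add: tendsto_rabs_zero_iff)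
  then have "(\<lambda>n. \<xi> n + q / 2 - q / 2) \<longlonglongrightarrow> 0 - q / 2" by (intro tendsto_intros)
  then show ?off by (simp add: \<xi>_def)
qed

text \<open>In scaled frame coordinates the part of \<open>K\<close> outside the translate
  converges, away from two parabolas, to the region between them, and it stays in a fixed box.
  Dominated convergence yields the area of a parabolic segment.\<close>

lemma missing_area_limit:
  assumes q: "q > 0" and d: "d \<longlonglongrightarrow> 0" "\<And>n. d n > 0"
    and \<kappa>: "\<kappa> = 1 / rK t" and \<mu>: "\<mu> = 1 / rL t"
    and ab: "\<kappa> * a\<^sup>2 / 2 < b" "\<kappa> * (a + q)\<^sup>2 / 2 < b"
  shows "(\<lambda>n. A * (1 - g (K.pt t (d n * a) ((d n)\<^sup>2 * b) - Z ((d n * q) *\<^sub>R tau t))) / (d n) ^ 3)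
    \<longlonglongrightarrow> 4 / 3 * sqrt (2 / (\<kappa> - \<mu>)) * cap_height \<kappa> \<mu> q a b powr (3/2)"
proof -
  define \<sigma> where "\<sigma> = (\<lambda>n. sag t (d n * q) / (d n)\<^sup>2)"
  define \<xi> where "\<xi> = (\<lambda>n. off t (d n * q) / d n)"
  have so: "sag t (d n * q) = (d n)\<^sup>2 * \<sigma> n" "off t (d n * q) = d n * \<xi> n" for n
    using d(2)[of n] by (simp_all add: \<sigma>_def \<xi>_def)
  have lim: "\<sigma> \<longlonglongrightarrow> \<mu> * q\<^sup>2 / 8" "\<xi> \<longlonglongrightarrow> - q / 2"
    unfolding \<sigma>_def \<xi>_def using chord_limits[OF q d, of t] by (simp_all add: \<mu> mult.commute)
  have rp: "rK t > 0" "rL t > 0" by (rule K.r_pos, rule L.r_pos)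
  have pos: "\<mu> > 0" "\<kappa> > \<mu>"
  proof -
    show "\<mu> > 0" using rp by (simp add: \<mu>)
    have "rK t < rL t" using rK_le[of t] L.R(2)[of t] rho_less by linarith
    then show "\<kappa> > \<mu>" using rp by (simp add: \<kappa> \<mu> frac_less2)
  qed
  define v where "v = (\<lambda>n. K.pt t (d n * a) ((d n)\<^sup>2 * b) - Z ((d n * q) *\<^sub>R tau t))"
  define S where "S = (\<lambda>n. {z. z \<in> K \<and> z - v n \<notin> L})"
  define F where "F = (\<lambda>n \<beta> \<alpha>. indicator (S n) (K.pt t (d n * \<alpha>) ((d n)\<^sup>2 * \<beta>)) :: ennreal)"
  define m where "m = a + q / 2"
  \<comment> \<open>The region inside the parabola of \<open>K\<close> and outside that of
    \<open>L\<close>, shifted so as to pass through both end points of the chord.\<close>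
  define G where "G = (\<lambda>\<beta> \<alpha>. indicator {p. (fst p)\<^sup>2 < 2 * rK t * snd p \<and> 2 * rL t * (snd p - b + \<mu> * q\<^sup>2 / 8) < (fst p - m)\<^sup>2} (\<alpha>, \<beta>) :: ennreal)"
  have S [measurable]: "S n \<in> sets borel" for n
  proof -
    have "S n = {z\<in>space borel. z \<in> K \<and> z - v n \<notin> L}" by (simp add: S_def)
    also have "\<dots> \<in> sets borel" by measurable
    finally show ?thesis .
  qed
  have Smem: "K.pt t (d n * \<alpha>) ((d n)\<^sup>2 * \<beta>) \<in> S n \<longleftrightarrow> K.pt t (d n * \<alpha>) ((d n)\<^sup>2 * \<beta>) \<in> K \<and>
      L.pt t (d n * (\<alpha> - a + \<xi> n)) ((d n)\<^sup>2 * (\<beta> - b + \<sigma> n)) \<notin> L" for n \<alpha> \<beta>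
  proof -
    have "K.pt t (d n * \<alpha>) ((d n)\<^sup>2 * \<beta>) - v n = L.pt t (d n * \<alpha> - d n * a + off t (d n * q)) ((d n)\<^sup>2 * \<beta> - (d n)\<^sup>2 * b + sag t (d n * q))"
      unfolding v_def by (rule pt_translate)
    also have "\<dots> = L.pt t (d n * (\<alpha> - a + \<xi> n)) ((d n)\<^sup>2 * (\<beta> - b + \<sigma> n))"
      unfolding so by (simp add: algebra_simps)
    finally show ?thesis by (simp add: S_def)
  qed
  have ptm [measurable]: "(\<lambda>p. K.pt t (d n * fst p) ((d n)\<^sup>2 * snd p)) \<in> borel_measurable borel" for n
    unfolding K.pt_def by (intro borel_measurable_continuous_onI continuous_intros)
  have F2 [measurable]: "(\<lambda>p. F n (fst p) (snd p)) \<in> borel_measurable (lborel \<Otimes>\<^sub>M lborel)" for n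
    unfolding F_def K.pt_def by measurable
  have F1 [measurable]: "F n \<beta> \<in> borel_measurable borel" for n \<beta>
    unfolding F_def K.pt_def by measurable
  have G2 [measurable]: "(\<lambda>p. G (fst p) (snd p)) \<in> borel_measurable (lborel \<Otimes>\<^sub>M lborel)"
    unfolding G_def indicator_def by simp measurable
  have G1 [measurable]: "G \<beta> \<in> borel_measurable borel" for \<beta>
    unfolding G_def indicator_def by simp measurable
  \<comment> \<open>Up to the factors \<open>d n\<close> and \<open>(d n)\<^sup>2\<close>, these are
    the shifts between the touching discs of \<open>K\<close> and \<open>L\<close>; they are bounded
    because they converge.\<close>
  obtain C0 where C0: "\<And>n. \<bar>a - \<xi> n\<bar> \<le> C0" "\<And>n. \<bar>b - \<sigma> n\<bar> \<le> C0" "\<And>n. d n \<le> C0"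
  proof -
    have "Bseq (\<lambda>n. a - \<xi> n)" "Bseq (\<lambda>n. b - \<sigma> n)" "Bseq d"
      using tendsto_diff[OF tendsto_const lim(2), of a] tendsto_diff[OF tendsto_const lim(1), of b] d(1)
      by (auto intro!: convergent_imp_Bseq convergentI)
    then obtain c1 c2 c3 where c: "\<And>n. norm (a - \<xi> n) \<le> c1" "\<And>n. norm (b - \<sigma> n) \<le> c2" "\<And>n. norm (d n) \<le> c3"
      unfolding Bseq_def by blast
    show ?thesis
    proof (rule that[of "max c1 (max c2 c3)"])
      show "d n \<le> max c1 (max c2 c3)" for n using c(3)[of n] by simp
    qed (use c in \<open>auto simp: le_max_iff_disj\<close>)
  qed
  \<comment> \<open>The bound of \<open>disc_difference_depth\<close> divided by
    \<open>(d n)\<^sup>2\<close>; the fourth power of \<open>C0\<close> comes from the square of the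
    normal shift.\<close>
  define C1 where "C1 = ((2 * R + 4 * \<rho>) * C0 + C0\<^sup>2 * C0\<^sup>2 + (1 + 2 * \<rho> / (R - \<rho>)) * C0\<^sup>2) / (R - \<rho>)"
  define C2 where "C2 = sqrt (2 * \<rho> * C1)"
  have dom: "F n \<beta> \<alpha> \<le> indicator {0..C1} \<beta> * indicator {-C2..C2} \<alpha>" for n \<alpha> \<beta>
  proof (cases "K.pt t (d n * \<alpha>) ((d n)\<^sup>2 * \<beta>) \<in> S n")
    case True
    note dn = d(2)[of n]
    have K: "(d n * \<alpha>)\<^sup>2 + ((d n)\<^sup>2 * \<beta>)\<^sup>2 \<le> 2 * \<rho> * ((d n)\<^sup>2 * \<beta>)"
      using K.pt_outer rK_le True Smem by blast
    have L: "\<not> (d n * \<alpha> - d n * (a - \<xi> n))\<^sup>2 + ((d n)\<^sup>2 * \<beta> - (d n)\<^sup>2 * (b - \<sigma> n))\<^sup>2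
        \<le> 2 * R * ((d n)\<^sup>2 * \<beta> - (d n)\<^sup>2 * (b - \<sigma> n))"
    proof
      assume *: "(d n * \<alpha> - d n * (a - \<xi> n))\<^sup>2 + ((d n)\<^sup>2 * \<beta> - (d n)\<^sup>2 * (b - \<sigma> n))\<^sup>2
        \<le> 2 * R * ((d n)\<^sup>2 * \<beta> - (d n)\<^sup>2 * (b - \<sigma> n))"
      have "L.pt t (d n * \<alpha> - d n * (a - \<xi> n)) ((d n)\<^sup>2 * \<beta> - (d n)\<^sup>2 * (b - \<sigma> n)) \<in> L"
        using * by (rule L.pt_inner) (use L.R in auto)
      then show False using True Smem by (simp add: algebra_simps)
    qed
    note D = disc_difference_depth[OF rho_pos rho_less K L]
    have "(R - \<rho>) * ((d n)\<^sup>2 * \<beta>) \<le> (2 * R + 4 * \<rho>) * ((d n)\<^sup>2 * C0) + (d n)\<^sup>2 * (C0\<^sup>2 * C0\<^sup>2) + (1 + 2 * \<rho> / (R - \<rho>)) * ((d n)\<^sup>2 * C0\<^sup>2)"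
    proof (rule order_trans[OF D(3)], intro add_mono mult_left_mono)
      show "\<bar>(d n)\<^sup>2 * (b - \<sigma> n)\<bar> \<le> (d n)\<^sup>2 * C0" using C0(2)[of n] by (simp add: abs_mult mult_left_mono)
      have "(b - \<sigma> n)\<^sup>2 \<le> C0\<^sup>2" using C0(2)[of n] by (metis abs_ge_zero power2_abs power_mono)
      moreover have "(d n)\<^sup>2 \<le> C0\<^sup>2" using C0(3)[of n] dn by (intro power_mono) auto
      ultimately have "(d n)\<^sup>2 * (b - \<sigma> n)\<^sup>2 \<le> C0\<^sup>2 * C0\<^sup>2" by (intro mult_mono) auto
      then have "(d n)\<^sup>2 * ((d n)\<^sup>2 * (b - \<sigma> n)\<^sup>2) \<le> (d n)\<^sup>2 * (C0\<^sup>2 * C0\<^sup>2)" by (intro mult_left_mono) auto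
      then show "((d n)\<^sup>2 * (b - \<sigma> n))\<^sup>2 \<le> (d n)\<^sup>2 * (C0\<^sup>2 * C0\<^sup>2)" by (simp add: power_mult_distrib power2_eq_square[of "(d n)\<^sup>2"])
      have "(a - \<xi> n)\<^sup>2 \<le> C0\<^sup>2" using C0(1)[of n] by (metis abs_ge_zero power2_abs power_mono)
      then show "(d n * (a - \<xi> n))\<^sup>2 \<le> (d n)\<^sup>2 * C0\<^sup>2" by (simp add: power_mult_distrib mult_left_mono)
    qed (use R_gt rho_pos R_pos in auto)
    also have "\<dots> = (d n)\<^sup>2 * ((2 * R + 4 * \<rho>) * C0 + C0\<^sup>2 * C0\<^sup>2 + (1 + 2 * \<rho> / (R - \<rho>)) * C0\<^sup>2)"
      by (simp add: distrib_left mult.left_commute)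
    finally have "(d n)\<^sup>2 * ((R - \<rho>) * \<beta>) \<le> (d n)\<^sup>2 * ((2 * R + 4 * \<rho>) * C0 + C0\<^sup>2 * C0\<^sup>2 + (1 + 2 * \<rho> / (R - \<rho>)) * C0\<^sup>2)"
      by (simp only: mult.left_commute)
    then have "(R - \<rho>) * \<beta> \<le> (2 * R + 4 * \<rho>) * C0 + C0\<^sup>2 * C0\<^sup>2 + (1 + 2 * \<rho> / (R - \<rho>)) * C0\<^sup>2"
      using dn by simp
    then have b1: "\<beta> \<le> C1" using R_gt(2) by (simp add: C1_def pos_le_divide_eq mult.commute)
    have b0: "0 \<le> \<beta>" using D(1) dn by (simp add: zero_le_mult_iff)
    have "(d n)\<^sup>2 * \<alpha>\<^sup>2 \<le> (d n)\<^sup>2 * (2 * \<rho> * \<beta>)" using D(2) by (simp add: power_mult_distrib mult.left_commute)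
    then have "\<alpha>\<^sup>2 \<le> 2 * \<rho> * \<beta>" using dn by simp
    also have "\<dots> \<le> 2 * \<rho> * C1" using b1 rho_pos by simp
    finally have "\<bar>\<alpha>\<bar> \<le> C2" unfolding C2_def by (simp add: real_le_rsqrt)
    then show ?thesis using b0 b1 by (simp add: indicator_def abs_le_iff F_def)
  qed (simp add: F_def)
  have inner: "(\<lambda>n. \<integral>\<^sup>+\<alpha>. F n \<beta> \<alpha> \<partial>lborel) \<longlonglongrightarrow> (\<integral>\<^sup>+\<alpha>. G \<beta> \<alpha> \<partial>lborel)" for \<beta>
  proof (rule nn_integral_dominated_convergence[where w = "\<lambda>\<alpha>. indicator {-C2..C2} \<alpha>"])
    show "AE \<alpha> in lborel. F n \<beta> \<alpha> \<le> indicator {- C2..C2} \<alpha>" for n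
      using dom[of n \<beta>] by (intro AE_I2 order_trans[OF dom]) (auto simp: indicator_def)
    \<comment> \<open>Convergence can fail only on the two limiting parabolas, at finitely many
      \<open>\<alpha>\<close> for each \<open>\<beta>\<close>.\<close>
    have "AE \<alpha> in lborel. \<alpha> \<notin> {\<alpha>. (\<alpha> - 0)\<^sup>2 = 2 * rK t * \<beta>} \<union> {\<alpha>. (\<alpha> - m)\<^sup>2 = 2 * rL t * (\<beta> - b + \<mu> * q\<^sup>2 / 8)}"
      by (intro AE_finite finite_UnI finite_square_eq)
    then show "AE \<alpha> in lborel. (\<lambda>n. F n \<beta> \<alpha>) \<longlonglongrightarrow> G \<beta> \<alpha>"
    proof eventually_elim
      case (elim \<alpha>)
      have x: "(\<lambda>n. \<alpha> - a + \<xi> n) \<longlonglongrightarrow> \<alpha> - m" "(\<lambda>n. \<beta> - b + \<sigma> n) \<longlonglongrightarrow> \<beta> - b + \<mu> * q\<^sup>2 / 8"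
        using tendsto_add[OF tendsto_const lim(2), of "\<alpha> - a"] tendsto_add[OF tendsto_const lim(1), of "\<beta> - b"]
        by (simp_all add: m_def algebra_simps)
      have "\<forall>\<^sub>F n in sequentially. F n \<beta> \<alpha> = G \<beta> \<alpha>"
      proof (cases "\<alpha>\<^sup>2 < 2 * rK t * \<beta>")
        case False
        then have "2 * rK t * \<beta> < \<alpha>\<^sup>2" using elim by auto
        from K.parabolic_out[OF d tendsto_const tendsto_const this]
        show ?thesis by eventually_elim (use False in \<open>simp add: F_def G_def Smem\<close>)
      next
        case True
        from K.parabolic_in[OF d tendsto_const tendsto_const this]
        have *: "\<forall>\<^sub>F n in sequentially. K.pt t (d n * \<alpha>) ((d n)\<^sup>2 * \<beta>) \<in> K" .
        show ?thesis
        proof (cases "2 * rL t * (\<beta> - b + \<mu> * q\<^sup>2 / 8) < (\<alpha> - m)\<^sup>2")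
          case lt: True
          from L.parabolic_out[OF d x lt] * show ?thesis
            by eventually_elim (use lt True in \<open>simp add: F_def G_def Smem\<close>)
        next
          case nl: False
          then have "(\<alpha> - m)\<^sup>2 < 2 * rL t * (\<beta> - b + \<mu> * q\<^sup>2 / 8)" using elim by auto
          from L.parabolic_in[OF d x this] show ?thesis
            by eventually_elim (use nl in \<open>simp add: F_def G_def Smem\<close>)
        qed
      qed
      then show ?case by (rule tendsto_eventually)
    qed
  qed (auto simp: emeasure_lborel_Icc_eq)
  have "(\<lambda>n. \<integral>\<^sup>+\<beta>. \<integral>\<^sup>+\<alpha>. F n \<beta> \<alpha> \<partial>lborel \<partial>lborel) \<longlonglongrightarrow> (\<integral>\<^sup>+\<beta>. \<integral>\<^sup>+\<alpha>. G \<beta> \<alpha> \<partial>lborel \<partial>lborel)"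
  proof (rule nn_integral_dominated_convergence[where w = "\<lambda>\<beta>. indicator {0..C1} \<beta> * emeasure lborel {-C2..C2}"])
    show "AE \<beta> in lborel. (\<integral>\<^sup>+\<alpha>. F n \<beta> \<alpha> \<partial>lborel) \<le> indicator {0..C1} \<beta> * emeasure lborel {-C2..C2}" for n
    proof (rule AE_I2)
      fix \<beta> :: real
      have "(\<integral>\<^sup>+\<alpha>. F n \<beta> \<alpha> \<partial>lborel) \<le> (\<integral>\<^sup>+\<alpha>. indicator {0..C1} \<beta> * indicator {-C2..C2} \<alpha> \<partial>lborel)"
        by (intro nn_integral_mono dom)
      also have "\<dots> = indicator {0..C1} \<beta> * emeasure lborel {-C2..C2}" by (simp add: nn_integral_cmult)
      finally show "(\<integral>\<^sup>+\<alpha>. F n \<beta> \<alpha> \<partial>lborel) \<le> indicator {0..C1} \<beta> * emeasure lborel {-C2..C2}" .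
    qed
    show "AE \<beta> in lborel. (\<lambda>n. \<integral>\<^sup>+\<alpha>. F n \<beta> \<alpha> \<partial>lborel) \<longlonglongrightarrow> (\<integral>\<^sup>+\<alpha>. G \<beta> \<alpha> \<partial>lborel)"
      using inner by simp
    have "(\<integral>\<^sup>+\<beta>. indicator {0..C1} \<beta> * emeasure lborel {-C2..C2} \<partial>lborel) = emeasure lborel {0..C1} * emeasure lborel {-C2..C2}"
      by (simp add: nn_integral_multc)
    also have "\<dots> < \<infinity>" by (simp add: ennreal_mult_less_top emeasure_lborel_Icc_eq)
    finally show "(\<integral>\<^sup>+\<beta>. indicator {0..C1} \<beta> * emeasure lborel {-C2..C2} \<partial>lborel) < \<infinity>" .
    show "(\<lambda>\<beta>. \<integral>\<^sup>+\<alpha>. F n \<beta> \<alpha> \<partial>lborel) \<in> borel_measurable lborel" for n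
      using lborel.borel_measurable_nn_integral_fst[OF F2[of n]] by simp
    show "(\<lambda>\<beta>. \<integral>\<^sup>+\<alpha>. G \<beta> \<alpha> \<partial>lborel) \<in> borel_measurable lborel"
      using lborel.borel_measurable_nn_integral_fst[OF G2] by simp
  qed auto
  moreover have "(\<integral>\<^sup>+\<beta>. \<integral>\<^sup>+\<alpha>. F n \<beta> \<alpha> \<partial>lborel \<partial>lborel) = ennreal (A * (1 - g (v n)) / d n ^ 3)" for n
  proof -
    have "emeasure lborel (S n) = ennreal (A * (1 - g (v n)))"
      unfolding g_eq[symmetric] by (rule arg_cong[where f = "emeasure lborel"]) (auto simp: S_def)
    moreover have "emeasure lborel (S n) = (\<integral>\<^sup>+z. indicator (S n) z \<partial>lborel)"
      by simp
    moreover have "\<dots> = ennreal (d n ^ 3) * (\<integral>\<^sup>+\<beta>. \<integral>\<^sup>+\<alpha>. F n \<beta> \<alpha> \<partial>lborel \<partial>lborel)"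
      unfolding F_def K.pt_def by (rule nn_integral_frame) (use d(2) in auto)
    ultimately have "ennreal (d n ^ 3) * (\<integral>\<^sup>+\<beta>. \<integral>\<^sup>+\<alpha>. F n \<beta> \<alpha> \<partial>lborel \<partial>lborel) = ennreal (A * (1 - g (v n)))" by simp
    then have "ennreal (1 / d n ^ 3) * (ennreal (d n ^ 3) * (\<integral>\<^sup>+\<beta>. \<integral>\<^sup>+\<alpha>. F n \<beta> \<alpha> \<partial>lborel \<partial>lborel))
        = ennreal (1 / d n ^ 3) * ennreal (A * (1 - g (v n)))" by simp
    then show ?thesis
      using d(2)[of n] by (simp add: mult.assoc[symmetric] ennreal_mult'[symmetric])
  qed
  moreover have "(\<integral>\<^sup>+\<beta>. \<integral>\<^sup>+\<alpha>. G \<beta> \<alpha> \<partial>lborel \<partial>lborel) = ennreal (4 / 3 * sqrt (2 / (\<kappa> - \<mu>)) * cap_height \<kappa> \<mu> q a b powr (3/2))"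
  proof -
    \<comment> \<open>Abscissa of the vertex of the difference of the two parabolas.\<close>
    define c where "c = - (\<mu> * m / (\<kappa> - \<mu>))"
    have "(\<integral>\<^sup>+\<beta>. \<integral>\<^sup>+\<alpha>. G \<beta> \<alpha> \<partial>lborel \<partial>lborel) = (\<integral>\<^sup>+\<alpha>. \<integral>\<^sup>+\<beta>. G \<beta> \<alpha> \<partial>lborel \<partial>lborel)"
      by (rule lborel_pair.Fubini') (use measurable_pair_swap[OF G2] in \<open>simp add: case_prod_unfold\<close>)
    also have "\<dots> = (\<integral>\<^sup>+\<alpha>. ennreal (max 0 (cap_height \<kappa> \<mu> q a b - (\<kappa> - \<mu>) / 2 * (\<alpha> - c)\<^sup>2)) \<partial>lborel)"
    proof (rule nn_integral_cong)
      fix \<alpha> :: real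
      define lo where "lo = \<kappa> * \<alpha>\<^sup>2 / 2"
      define hi where "hi = b - \<mu> * q\<^sup>2 / 8 + \<mu> * (\<alpha> - m)\<^sup>2 / 2"
      have "G \<beta> \<alpha> = indicator {lo<..<hi} \<beta>" for \<beta>
      proof -
        have "\<alpha>\<^sup>2 < 2 * rK t * \<beta> \<longleftrightarrow> lo < \<beta>" using rp by (simp add: lo_def \<kappa> field_simps)
        moreover have "2 * rL t * (\<beta> - b + \<mu> * q\<^sup>2 / 8) < (\<alpha> - m)\<^sup>2 \<longleftrightarrow> \<beta> - b + \<mu> * q\<^sup>2 / 8 < \<mu> * (\<alpha> - m)\<^sup>2 / 2"
          using rp by (simp add: \<mu> field_simps)
        ultimately show ?thesis by (auto simp: G_def indicator_def hi_def)
      qed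
      then have "(\<integral>\<^sup>+\<beta>. G \<beta> \<alpha> \<partial>lborel) = emeasure lborel {lo<..<hi}" by simp
      also have "\<dots> = ennreal (max 0 (hi - lo))"
        by (cases "lo \<le> hi") (auto simp: max_def)
      also have "hi - lo = cap_height \<kappa> \<mu> q a b - (\<kappa> - \<mu>) / 2 * (\<alpha> - c)\<^sup>2"
      proof -
        define D where "D = \<kappa> - \<mu>"
        have D: "D > 0" "\<kappa> = D + \<mu>" using pos by (auto simp: D_def)
        have "D / 2 * (\<alpha> - c)\<^sup>2 = D / 2 * \<alpha>\<^sup>2 + \<mu> * m * \<alpha> + \<mu>\<^sup>2 * m\<^sup>2 / (2 * D)"
          unfolding c_def D_def[symmetric] using D(1) by (simp add: power2_eq_square field_simps)
        moreover have "\<mu> * \<kappa> / (2 * D) * m\<^sup>2 = \<mu>\<^sup>2 * m\<^sup>2 / (2 * D) + \<mu> * m\<^sup>2 / 2"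
          unfolding D(2) using D(1) by (simp add: power2_eq_square field_simps)
        moreover have "\<mu> * (\<alpha> - m)\<^sup>2 / 2 = \<mu> * \<alpha>\<^sup>2 / 2 - \<mu> * m * \<alpha> + \<mu> * m\<^sup>2 / 2"
          by (simp add: power2_eq_square field_simps)
        moreover have "\<kappa> * \<alpha>\<^sup>2 / 2 = D / 2 * \<alpha>\<^sup>2 + \<mu> * \<alpha>\<^sup>2 / 2" unfolding D(2) by (simp add: field_simps)
        ultimately show ?thesis
          unfolding hi_def lo_def cap_height_def m_def[symmetric] D_def[symmetric] by linarith
      qed
      finally show "(\<integral>\<^sup>+\<beta>. G \<beta> \<alpha> \<partial>lborel) = ennreal (max 0 (cap_height \<kappa> \<mu> q a b - (\<kappa> - \<mu>) / 2 * (\<alpha> - c)\<^sup>2))" .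
    qed
    also have "\<dots> = ennreal (4 / 3 * sqrt (2 / (\<kappa> - \<mu>)) * cap_height \<kappa> \<mu> q a b powr (3/2))"
    proof (rule nn_integral_parabola)
      have "(\<kappa> - \<mu>) / 2 * (\<bar>\<kappa> / (\<kappa> - \<mu>) * (a + q / 2)\<bar> + q / 2)\<^sup>2 < cap_height \<kappa> \<mu> q a b"
        using cap_height_iff[OF pos(2,1) q] ab by blast
      moreover have "0 \<le> (\<kappa> - \<mu>) / 2 * (\<bar>\<kappa> / (\<kappa> - \<mu>) * (a + q / 2)\<bar> + q / 2)\<^sup>2" using pos by simp
      ultimately show "0 \<le> cap_height \<kappa> \<mu> q a b" by linarith
    qed (use pos in simp)
    finally show ?thesis .
  qed
  ultimately have "(\<lambda>n. ennreal (A * (1 - g (v n)) / d n ^ 3)) \<longlonglongrightarrow> ennreal (4 / 3 * sqrt (2 / (\<kappa> - \<mu>)) * cap_height \<kappa> \<mu> q a b powr (3/2))"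
    by simp
  moreover have "0 \<le> A * (1 - g (v n)) / d n ^ 3" for n
    using A_pos g_le_1[of "v n"] d(2)[of n] by simp
  ultimately show ?thesis
    using pos by (subst (asm) tendsto_ennreal_iff) (auto simp: v_def)
qed

end

section \<open>The limit\<close>

context two_discs
begin

definition \<kappa> :: "real \<Rightarrow> real" where "\<kappa> t = 1 / rK t"
definition \<mu> :: "real \<Rightarrow> real" where "\<mu> t = 1 / rL t"
text \<open>Multiplied by the power \<open>3/2\<close> of the cap height, this is the limit of
  \<open>n\<close> times the probability of missing the translate.\<close>

definition cap_rate :: "real \<Rightarrow> real" where "cap_rate t = 4 / 3 * sqrt (2 / (\<kappa> t - \<mu> t)) / A"
text \<open>The parabolic scale: a cap of width \<open>d n\<close> and height \<open>(d n)\<^sup>2\<close> has area of order \<open>1 / n\<close>.\<close>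
definition d :: "nat \<Rightarrow> real" where "d n = real (max n 1) powr (- 1 / 3)"

lemma d_pos: "d n > 0" by (simp add: d_def)

lemma d_cube:
  assumes "n \<ge> 1" shows "d n ^ 3 = 1 / real n"
proof -
  have "d n ^ 3 = d n powr real 3" by (rule powr_realpow[symmetric, OF d_pos])
  also have "\<dots> = real n powr (-1)" using assms by (simp add: d_def max_def powr_powr)
  also have "\<dots> = 1 / real n" using assms by (simp add: powr_minus_divide)
  finally show ?thesis .
qed

lemma d_tendsto: "d \<longlonglongrightarrow> 0"
proof -
  have "(\<lambda>n. real n powr (- 1 / 3)) \<longlonglongrightarrow> 0"
    by (rule tendsto_neg_powr) (auto intro: filterlim_real_sequentially)
  then show ?thesis
    by (rule Lim_transform_eventually)
      (rule eventually_mono[OF eventually_ge_at_top[of 1]], simp add: d_def max_def)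
qed

lemma curvature_order: "0 < \<mu> t" "\<mu> t < \<kappa> t" "0 < cap_rate t"
proof -
  have r: "rK t > 0" "rL t > 0" by (rule K.r_pos, rule L.r_pos)
  have "rK t < rL t" using rK_le[of t] L.R(2)[of t] rho_less by linarith
  then show "0 < \<mu> t" "\<mu> t < \<kappa> t" using r by (simp_all add: \<mu>_def \<kappa>_def frac_less2)
  then show "0 < cap_rate t" using A_pos by (simp add: cap_rate_def)
qed

lemma frame_measurable [measurable]:
  "nu \<in> borel_measurable borel" "tau \<in> borel_measurable borel" "k \<in> borel_measurable borel"
proof -
  have "continuous_on UNIV k" by (rule continuous_on_vector_derivative[OF K.m_deriv])
  then show "nu \<in> borel_measurable borel" "tau \<in> borel_measurable borel" "k \<in> borel_measurable borel"
    by (intro borel_measurable_continuous_onI nu_continuous tau_continuous; assumption)+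
qed

definition rescaled_integrand :: "nat \<Rightarrow> real \<Rightarrow> real \<Rightarrow> real \<Rightarrow> real \<Rightarrow> ennreal" where
  "rescaled_integrand n t q b a = indicator K (K.pt t (d n * a) ((d n)\<^sup>2 * b)) * indicator K (K.pt t (d n * (a + q)) ((d n)\<^sup>2 * b)) *
    ennreal (g (K.pt t (d n * a) ((d n)\<^sup>2 * b) - Z ((d n * q) *\<^sub>R tau t)) ^ (n - 1))"

definition limit_integrand :: "real \<Rightarrow> real \<Rightarrow> real \<Rightarrow> real \<Rightarrow> ennreal" where
  "limit_integrand t q b a = indicator {a. \<kappa> t * a\<^sup>2 / 2 < b \<and> \<kappa> t * (a + q)\<^sup>2 / 2 < b} a *
     ennreal (exp (- cap_rate t * cap_height (\<kappa> t) (\<mu> t) q a b powr (3/2)))"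

text \<open>Independent of \<open>n\<close> and of the boundary point. Both end points of the chord
  satisfy the bound of the disc of radius \<open>\<rho>\<close>, and
  \<open>q\<^sup>2 \<le> 2 * a\<^sup>2 + 2 * (a + q)\<^sup>2\<close> produces the constant
  8.\<close>

definition majorant :: "real \<Rightarrow> real \<Rightarrow> real \<Rightarrow> real \<Rightarrow> ennreal" where
  "majorant c q b a = indicator {0<..} b * indicator {0..} (2 * \<rho> * b - a\<^sup>2) * indicator {0..} (8 * \<rho> * b - q\<^sup>2) *
     ennreal (exp (- c * b powr (3/2)))"

text \<open>If both end points are inside the limiting parabola, \<open>n\<close> times the missing
  probability converges and the power tends to an exponential. If one is outside, it eventually
  leaves \<open>K\<close>. The boundary values of \<open>a\<close> are finitely many.\<close>

lemma rescaled_integrand_limit: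
  assumes q: "q > 0"
  shows "AE a in lborel. (\<lambda>n. rescaled_integrand n t q b a) \<longlonglongrightarrow> limit_integrand t q b a"
proof -
  have rp: "rK t > 0" by (rule K.r_pos)
  have iff: "\<kappa> t * x\<^sup>2 / 2 < b \<longleftrightarrow> x\<^sup>2 < 2 * rK t * b" for x
    using rp by (simp add: \<kappa>_def field_simps)
  have "AE a in lborel. a \<notin> {a. (a - 0)\<^sup>2 = 2 * rK t * b} \<union> {a. (a - (- q))\<^sup>2 = 2 * rK t * b}"
    by (intro AE_finite finite_UnI finite_square_eq)
  then show ?thesis
  proof eventually_elim
    case (elim a)
    have ne: "a\<^sup>2 \<noteq> 2 * rK t * b" "(a + q)\<^sup>2 \<noteq> 2 * rK t * b" using elim by auto
    show ?case
    proof (cases "a\<^sup>2 < 2 * rK t * b \<and> (a + q)\<^sup>2 < 2 * rK t * b")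
      case True
      define v where "v = (\<lambda>n. K.pt t (d n * a) ((d n)\<^sup>2 * b) - Z ((d n * q) *\<^sub>R tau t))"
      define V where "V = 4 / 3 * sqrt (2 / (\<kappa> t - \<mu> t)) * cap_height (\<kappa> t) (\<mu> t) q a b powr (3/2)"
      have "(\<lambda>n. A * (1 - g (v n)) / d n ^ 3) \<longlonglongrightarrow> V"
        unfolding v_def V_def
        by (rule missing_area_limit[OF q d_tendsto d_pos \<kappa>_def \<mu>_def]) (use True iff in auto)
      then have "(\<lambda>n. A * (1 - g (v n)) / d n ^ 3 * (1 / A)) \<longlonglongrightarrow> V * (1 / A)" by (rule tendsto_mult_right)
      then have "(\<lambda>n. real n * (1 - g (v n))) \<longlonglongrightarrow> V * (1 / A)"
        by (rule Lim_transform_eventually)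
          (rule eventually_mono[OF eventually_ge_at_top[of 1]], use A_pos in \<open>simp add: d_cube\<close>)
      from power_exp_limit[OF this] g_le_1
      have "(\<lambda>n. g (v n) ^ (n - 1)) \<longlonglongrightarrow> exp (- (V * (1 / A)))" by simp
      then have lim: "(\<lambda>n. ennreal (g (v n) ^ (n - 1))) \<longlonglongrightarrow> ennreal (exp (- (V * (1 / A))))"
        by (rule tendsto_ennrealI)
      have "\<forall>\<^sub>F n in sequentially. K.pt t (d n * a) ((d n)\<^sup>2 * b) \<in> K"
        "\<forall>\<^sub>F n in sequentially. K.pt t (d n * (a + q)) ((d n)\<^sup>2 * b) \<in> K"
        by (rule K.parabolic_in[OF d_tendsto d_pos tendsto_const tendsto_const], use True in simp)+
      then have "\<forall>\<^sub>F n in sequentially. ennreal (g (v n) ^ (n - 1)) = rescaled_integrand n t q b a"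
        by eventually_elim (simp add: rescaled_integrand_def v_def)
      from Lim_transform_eventually[OF lim this]
      have "(\<lambda>n. rescaled_integrand n t q b a) \<longlonglongrightarrow> ennreal (exp (- (V * (1 / A))))" .
      moreover have "limit_integrand t q b a = ennreal (exp (- (V * (1 / A))))"
        using True iff by (simp add: limit_integrand_def V_def cap_rate_def)
      ultimately show ?thesis by simp
    next
      case False
      then have "2 * rK t * b < a\<^sup>2 \<or> 2 * rK t * b < (a + q)\<^sup>2" using ne by linarith
      then have "\<forall>\<^sub>F n in sequentially. K.pt t (d n * a) ((d n)\<^sup>2 * b) \<notin> K \<or> K.pt t (d n * (a + q)) ((d n)\<^sup>2 * b) \<notin> K"
      proof
        assume "2 * rK t * b < a\<^sup>2"
        from K.parabolic_out[OF d_tendsto d_pos tendsto_const tendsto_const this]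
        show ?thesis by eventually_elim simp
      next
        assume "2 * rK t * b < (a + q)\<^sup>2"
        from K.parabolic_out[OF d_tendsto d_pos tendsto_const tendsto_const this]
        show ?thesis by eventually_elim simp
      qed
      then have "\<forall>\<^sub>F n in sequentially. rescaled_integrand n t q b a = 0"
        by eventually_elim (auto simp: rescaled_integrand_def indicator_def)
      moreover have "limit_integrand t q b a = 0" using False iff by (auto simp: limit_integrand_def)
      ultimately show ?thesis by (simp add: tendsto_eventually)
    qed
  qed
qed

text \<open>At depth \<open>(d n)\<^sup>2 * b\<close> the missing probability is at least
  \<open>c * b powr (3/2) / real n\<close>. For \<open>n \<ge> 2\<close> the exponent
  \<open>n - 1\<close> is at least half of \<open>n\<close>, hence the rate
  \<open>c / 2\<close>.\<close>

lemma rescaled_integrand_dominated: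
  assumes c: "c > 0" and gu: "\<And>t q x h. 0 < q \<Longrightarrow> K.pt t x h \<in> K \<Longrightarrow> K.pt t (x + q) h \<in> K \<Longrightarrow>
      g (K.pt t x h - Z (q *\<^sub>R tau t)) \<le> 1 - c * h powr (3/2)"
    and q: "q > 0" and n: "n \<ge> 2"
  shows "rescaled_integrand n t q b a \<le> majorant (c / 2) q b a"
proof (cases "K.pt t (d n * a) ((d n)\<^sup>2 * b) \<in> K \<and> K.pt t (d n * (a + q)) ((d n)\<^sup>2 * b) \<in> K")
  case True
  note dn = d_pos[of n]
  have *: "x\<^sup>2 \<le> 2 * \<rho> * b" if "K.pt t (d n * x) ((d n)\<^sup>2 * b) \<in> K" for x
  proof -
    have "(d n * x)\<^sup>2 + ((d n)\<^sup>2 * b)\<^sup>2 \<le> 2 * \<rho> * ((d n)\<^sup>2 * b)" using K.pt_outer[OF that rK_le] .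
    then have "(d n)\<^sup>2 * x\<^sup>2 + ((d n)\<^sup>2 * b)\<^sup>2 \<le> (d n)\<^sup>2 * (2 * \<rho> * b)"
      by (simp add: power_mult_distrib[of "d n" x] mult.left_commute)
    moreover have "0 \<le> ((d n)\<^sup>2 * b)\<^sup>2" by simp
    ultimately have "(d n)\<^sup>2 * x\<^sup>2 \<le> (d n)\<^sup>2 * (2 * \<rho> * b)" by linarith
    then show ?thesis using dn by simp
  qed
  have 1: "a\<^sup>2 \<le> 2 * \<rho> * b" "(a + q)\<^sup>2 \<le> 2 * \<rho> * b" using * True by auto
  have "q\<^sup>2 \<le> 2 * a\<^sup>2 + 2 * (a + q)\<^sup>2"
    using zero_le_power2[of "2 * a + q"] by (simp add: power2_eq_square algebra_simps)
  then have q8: "q\<^sup>2 \<le> 8 * \<rho> * b" using 1 by simp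
  have b: "b > 0"
  proof -
    have "0 < q\<^sup>2" using q by simp
    then have "0 < 8 * \<rho> * b" using q8 by linarith
    then show ?thesis using rho_pos by (simp add: zero_less_mult_iff)
  qed
  define gv where "gv = g (K.pt t (d n * a) ((d n)\<^sup>2 * b) - Z ((d n * q) *\<^sub>R tau t))"
  define y where "y = c * b powr (3/2) / real n"
  have "gv \<le> 1 - c * ((d n)\<^sup>2 * b) powr (3/2)"
    unfolding gv_def by (rule gu) (use True dn q in \<open>simp_all add: distrib_left\<close>)
  also have "((d n)\<^sup>2 * b) powr (3/2) = b powr (3/2) / real n"
  proof -
    have "((d n)\<^sup>2) powr (3/2) = (d n powr real 2) powr (3/2)" by (simp only: powr_realpow[OF dn])
    also have "\<dots> = d n powr real 3" by (simp add: powr_powr)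
    also have "\<dots> = d n ^ 3" by (rule powr_realpow[OF dn])
    finally have "((d n)\<^sup>2) powr (3/2) = d n ^ 3" .
    then show ?thesis using powr_mult[of "(d n)\<^sup>2" b "3/2"] dn b n by (simp add: d_cube)
  qed
  finally have "gv \<le> 1 - y" by (simp add: y_def)
  also have "\<dots> \<le> exp (- y)" using exp_ge_add_one_self[of "- y"] by simp
  finally have "gv ^ (n - 1) \<le> exp (- y) ^ (n - 1)" using g_nonneg by (intro power_mono) (auto simp: gv_def)
  also have "\<dots> = exp (- (real (n - 1) * y))" by (simp add: exp_of_nat_mult[symmetric])
  also have "\<dots> \<le> exp (- (c / 2) * b powr (3/2))"
  proof -
    have "1 / 2 \<le> real (n - 1) / real n" using n by (simp add: field_simps of_nat_diff)
    then have "1 / 2 * (c * b powr (3/2)) \<le> real (n - 1) / real n * (c * b powr (3/2))"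
      by (rule mult_right_mono) (use c in simp)
    then show ?thesis by (simp add: y_def)
  qed
  finally have "ennreal (gv ^ (n - 1)) \<le> ennreal (exp (- (c / 2) * b powr (3/2)))" by (rule ennreal_leI)
  then show ?thesis using True 1 q8 b by (simp add: rescaled_integrand_def majorant_def gv_def)
qed (auto simp: rescaled_integrand_def)

lemma majorant_measurable [measurable]:
  "(\<lambda>x. majorant c (f x) (h x) (j x)) \<in> borel_measurable M"
  if [measurable]: "f \<in> borel_measurable M" "h \<in> borel_measurable M" "j \<in> borel_measurable M"
  unfolding majorant_def by measurable

lemma rescaled_integrand_measurable [measurable]:
  "(\<lambda>x. rescaled_integrand n (t x) (f x) (h x) (j x)) \<in> borel_measurable M"
  if [measurable]: "t \<in> borel_measurable M" "f \<in> borel_measurable M" "h \<in> borel_measurable M" "j \<in> borel_measurable M"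
  unfolding rescaled_integrand_def K.pt_def by measurable

lemma limit_integrand_measurable [measurable]:
  "(\<lambda>x. limit_integrand t (f x) (h x) (j x)) \<in> borel_measurable M"
  if [measurable]: "f \<in> borel_measurable M" "h \<in> borel_measurable M" "j \<in> borel_measurable M"
  unfolding limit_integrand_def cap_height_def indicator_def by simp measurable

lemma majorant_inner: "(\<integral>\<^sup>+a. majorant c q b a \<partial>lborel) =
   indicator {0<..} b * indicator {0..} (8 * \<rho> * b - q\<^sup>2) * ennreal (2 * sqrt (2 * \<rho> * b) * exp (- c * b powr (3/2)))"
proof (cases "b > 0")
  case True
  have s: "0 \<le> 2 * \<rho> * b" using True rho_pos by simp
  have "0 \<le> 2 * \<rho> * b - a\<^sup>2 \<longleftrightarrow> a \<in> {- sqrt (2 * \<rho> * b)..sqrt (2 * \<rho> * b)}" for a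
  proof -
    have "0 \<le> 2 * \<rho> * b - a\<^sup>2 \<longleftrightarrow> a\<^sup>2 \<le> (sqrt (2 * \<rho> * b))\<^sup>2" using s by simp
    also have "\<dots> \<longleftrightarrow> \<bar>a\<bar> \<le> sqrt (2 * \<rho> * b)" by (rule power2_le_iff_abs_le) (use s in simp)
    finally show ?thesis by (auto simp: abs_le_iff)
  qed
  then have "majorant c q b a = (indicator {0..} (8 * \<rho> * b - q\<^sup>2) * ennreal (exp (- c * b powr (3/2)))) * indicator {- sqrt (2 * \<rho> * b)..sqrt (2 * \<rho> * b)} a" for a
    using True by (simp add: majorant_def indicator_def)
  then have "(\<integral>\<^sup>+a. majorant c q b a \<partial>lborel) = (indicator {0..} (8 * \<rho> * b - q\<^sup>2) * ennreal (exp (- c * b powr (3/2)))) * emeasure lborel {- sqrt (2 * \<rho> * b)..sqrt (2 * \<rho> * b)}"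
    by (simp add: nn_integral_cmult_indicator)
  also have "emeasure lborel {- sqrt (2 * \<rho> * b)..sqrt (2 * \<rho> * b)} = ennreal (2 * sqrt (2 * \<rho> * b))"
    using s by (simp add: emeasure_lborel_Icc_eq)
  finally show ?thesis using True s by (simp add: ennreal_mult' ac_simps)
qed (simp add: majorant_def)

text \<open>For fixed \<open>b\<close> the range of \<open>a\<close> has length of order
  \<open>sqrt b\<close> and the weighted integral over \<open>q\<close> is of order
  \<open>b\<close>, which leaves a Gamma integrand in \<open>b\<close>.\<close>

lemma majorant_finite:
  assumes c: "c > 0"
  shows "(\<integral>\<^sup>+q. indicator {0<..} q * (ennreal q * (\<integral>\<^sup>+b. \<integral>\<^sup>+a. majorant c q b a \<partial>lborel \<partial>lborel)) \<partial>lborel) < \<infinity>"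
proof -
  define e where "e = (\<lambda>b. ennreal (2 * sqrt (2 * \<rho> * b) * exp (- c * b powr (3/2))))"
  have e: "ennreal (2 * sqrt (2 * \<rho> * b) * exp (- c * b powr (3/2))) = e b" for b by (simp add: e_def)
  have [measurable]: "e \<in> borel_measurable borel" unfolding e_def by measurable
  have "(\<integral>\<^sup>+q. indicator {0<..} q * (ennreal q * (\<integral>\<^sup>+b. \<integral>\<^sup>+a. majorant c q b a \<partial>lborel \<partial>lborel)) \<partial>lborel)
      = (\<integral>\<^sup>+q. \<integral>\<^sup>+b. indicator {0<..} q * ennreal q * (indicator {0<..} b * indicator {0..} (8 * \<rho> * b - q\<^sup>2) * e b) \<partial>lborel \<partial>lborel)"
    unfolding majorant_inner e by (intro nn_integral_cong) (simp add: nn_integral_cmult mult.assoc)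
  also have "\<dots> = (\<integral>\<^sup>+b. \<integral>\<^sup>+q. indicator {0<..} q * ennreal q * (indicator {0<..} b * indicator {0..} (8 * \<rho> * b - q\<^sup>2) * e b) \<partial>lborel \<partial>lborel)"
    by (intro lborel_pair.Fubini'[symmetric]) measurable
  also have "\<dots> \<le> (\<integral>\<^sup>+b. ennreal (16 * \<rho> * sqrt (2 * \<rho>)) * (ennreal (b powr (3/2) * exp (- c * b powr (3/2))) * indicator {0<..} b) \<partial>lborel)"
  proof (rule nn_integral_mono)
    fix b :: real
    show "(\<integral>\<^sup>+q. indicator {0<..} q * ennreal q * (indicator {0<..} b * indicator {0..} (8 * \<rho> * b - q\<^sup>2) * e b) \<partial>lborel)
      \<le> ennreal (16 * \<rho> * sqrt (2 * \<rho>)) * (ennreal (b powr (3/2) * exp (- c * b powr (3/2))) * indicator {0<..} b)"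
    proof (cases "b > 0")
      case True
      define s where "s = sqrt (8 * \<rho> * b)"
      have s: "s \<ge> 0" "s\<^sup>2 = 8 * \<rho> * b" using True rho_pos by (simp_all add: s_def)
      have "(\<integral>\<^sup>+q. indicator {0<..} q * ennreal q * (indicator {0<..} b * indicator {0..} (8 * \<rho> * b - q\<^sup>2) * e b) \<partial>lborel)
          \<le> (\<integral>\<^sup>+q. (ennreal s * e b) * indicator {0..s} q \<partial>lborel)"
      proof (rule nn_integral_mono)
        fix q :: real
        show "indicator {0<..} q * ennreal q * (indicator {0<..} b * indicator {0..} (8 * \<rho> * b - q\<^sup>2) * e b) \<le> (ennreal s * e b) * indicator {0..s} q"
        proof (cases "0 < q \<and> q\<^sup>2 \<le> 8 * \<rho> * b")
          case q: True
          then have "q \<le> s" using power2_le_imp_le[of q s] s by simp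
          then show ?thesis using q True by (auto simp: indicator_def intro!: mult_right_mono ennreal_leI)
        qed (auto simp: indicator_def)
      qed
      also have "\<dots> = (ennreal s * e b) * ennreal s" using s by (simp add: nn_integral_cmult_indicator)
      also have "\<dots> = ennreal (s * s * (2 * sqrt (2 * \<rho> * b) * exp (- c * b powr (3/2))))"
        using s(1) by (simp add: e_def ennreal_mult'[symmetric] ennreal_mult''[symmetric] ac_simps)
      also have "s * s * (2 * sqrt (2 * \<rho> * b) * exp (- c * b powr (3/2))) = 16 * \<rho> * sqrt (2 * \<rho>) * (b powr (3/2) * exp (- c * b powr (3/2)))"
      proof -
        have "b powr (3/2) = b powr 1 * b powr (1/2)" unfolding powr_add[symmetric] by simp
        then have "b powr (3/2) = b * sqrt b" using True by (simp add: powr_half_sqrt)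
        moreover have "s * s = 8 * \<rho> * b" using s(2) by (simp add: power2_eq_square)
        ultimately show ?thesis by (simp add: real_sqrt_mult)
      qed
      finally show ?thesis using True rho_pos by (simp add: ennreal_mult')
    qed simp
  qed
  also have "\<dots> = ennreal (16 * \<rho> * sqrt (2 * \<rho>)) * ennreal (2 / 3 * c powr (-5/3) * Gamma (5/3))"
    unfolding nn_integral_Gamma_substitution[OF c, symmetric] by (intro nn_integral_cmult) measurable
  also have "\<dots> < \<infinity>" by (simp add: ennreal_mult_less_top)
  finally show ?thesis .
qed

definition section_integral :: "nat \<Rightarrow> real \<Rightarrow> real \<Rightarrow> ennreal" where
  "section_integral n t q = (\<integral>\<^sup>+b. \<integral>\<^sup>+a. rescaled_integrand n t q b a \<partial>lborel \<partial>lborel)"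

definition section_majorant :: "real \<Rightarrow> real \<Rightarrow> ennreal" where
  "section_majorant c q = (\<integral>\<^sup>+b. \<integral>\<^sup>+a. majorant c q b a \<partial>lborel \<partial>lborel)"

definition section_limit :: "real \<Rightarrow> real \<Rightarrow> ennreal" where
  "section_limit t q = (\<integral>\<^sup>+b. \<integral>\<^sup>+a. limit_integrand t q b a \<partial>lborel \<partial>lborel)"

lemma section_integral_measurable [measurable]:
  "(\<lambda>x. section_integral n (f x) (h x)) \<in> borel_measurable M" if [measurable]: "f \<in> borel_measurable M" "h \<in> borel_measurable M"
  unfolding section_integral_def by measurable

lemma section_majorant_measurable [measurable]: "section_majorant c \<in> borel_measurable borel"
  unfolding section_majorant_def by measurable

lemma section_limit_measurable [measurable]: "section_limit t \<in> borel_measurable borel"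
  unfolding section_limit_def by measurable

lemma section_integral_dominated:
  assumes "\<And>b a. rescaled_integrand n t q b a \<le> majorant c q b a" shows "section_integral n t q \<le> section_majorant c q"
  unfolding section_integral_def section_majorant_def by (intro nn_integral_mono assms)

lemma section_integral_limit:
  assumes q: "q > 0" and fd: "\<And>n b a. n \<ge> 2 \<Longrightarrow> rescaled_integrand n t q b a \<le> majorant c q b a" and fin: "section_majorant c q < \<infinity>"
  shows "(\<lambda>n. section_integral (n + 2) t q) \<longlonglongrightarrow> section_limit t q"
  unfolding section_integral_def section_limit_def
proof (rule nn_integral_dominated_convergence[where w = "\<lambda>b. \<integral>\<^sup>+a. majorant c q b a \<partial>lborel"])
  show "(\<integral>\<^sup>+b. \<integral>\<^sup>+a. majorant c q b a \<partial>lborel \<partial>lborel) < \<infinity>" using fin by (simp add: section_majorant_def)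
  show "AE b in lborel. (\<integral>\<^sup>+a. rescaled_integrand (n + 2) t q b a \<partial>lborel) \<le> (\<integral>\<^sup>+a. majorant c q b a \<partial>lborel)" for n
    by (intro AE_I2 nn_integral_mono fd) simp
  show "AE b in lborel. (\<lambda>n. \<integral>\<^sup>+a. rescaled_integrand (n + 2) t q b a \<partial>lborel) \<longlonglongrightarrow> (\<integral>\<^sup>+a. limit_integrand t q b a \<partial>lborel)"
  proof (rule AE_I2)
    fix b :: real
    show "(\<lambda>n. \<integral>\<^sup>+a. rescaled_integrand (n + 2) t q b a \<partial>lborel) \<longlonglongrightarrow> (\<integral>\<^sup>+a. limit_integrand t q b a \<partial>lborel)"
    proof (rule nn_integral_dominated_convergence[where w = "\<lambda>a. majorant c q b a"])
      show "AE a in lborel. rescaled_integrand (n + 2) t q b a \<le> majorant c q b a" for n by (intro AE_I2 fd) simp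
      show "AE a in lborel. (\<lambda>n. rescaled_integrand (n + 2) t q b a) \<longlonglongrightarrow> limit_integrand t q b a"
        using rescaled_integrand_limit[OF q, of t b] by eventually_elim (rule LIMSEQ_ignore_initial_segment)
      show "(\<integral>\<^sup>+a. majorant c q b a \<partial>lborel) < \<infinity>" unfolding majorant_inner by (auto simp: indicator_def)
    qed measurable
  qed
qed measurable

text \<open>Domination starts at \<open>n = 2\<close>, hence the shift of the sequences by 2. As the
  majorant is the same for all \<open>t\<close>, the single constant \<open>W\<close> bounds the
  integrand over the circle.\<close>

lemma main_limit:
  "(\<lambda>n. \<integral>\<^sup>+t. indicator {0<..<2*pi} t * (\<integral>\<^sup>+q. indicator {0<..} q * (ennreal q * section_integral n t q) \<partial>lborel) \<partial>lborel) \<longlonglongrightarrow>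
    (\<integral>\<^sup>+t. indicator {0<..<2*pi} t * ennreal ((\<kappa> t - \<mu> t) / \<kappa> t * (4 / 3 * (2 / (\<kappa> t - \<mu> t)) powr (3/2) * (2 / 3 * cap_rate t powr (-5/3) * Gamma (5/3)))) \<partial>lborel)"
proof -
  obtain c0 where c0: "c0 > 0"
    "\<And>t q x h. 0 < q \<Longrightarrow> K.pt t x h \<in> K \<Longrightarrow> K.pt t (x + q) h \<in> K \<Longrightarrow>
      g (K.pt t x h - Z (q *\<^sub>R tau t)) \<le> 1 - c0 * h powr (3/2)"
    using g_upper by blast
  define c where "c = c0 / 2"
  have c: "c > 0" using c0 by (simp add: c_def)
  have fd: "rescaled_integrand n t q b a \<le> majorant c q b a" if "q > 0" "n \<ge> 2" for n t q b a
    unfolding c_def by (rule rescaled_integrand_dominated[OF c0 that])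
  define W where "W = (\<integral>\<^sup>+q. indicator {0<..} q * (ennreal q * section_majorant c q) \<partial>lborel)"
  have W: "W < \<infinity>" unfolding W_def section_majorant_def by (rule majorant_finite[OF c])
  have AEfin: "AE q in lborel. indicator {0<..} q * (ennreal q * section_majorant c q) \<noteq> \<infinity>"
    by (rule nn_integral_PInf_AE) (use W in \<open>auto simp: W_def\<close>)
  have inner: "(\<lambda>n. \<integral>\<^sup>+q. indicator {0<..} q * (ennreal q * section_integral (n + 2) t q) \<partial>lborel) \<longlonglongrightarrow>
      (\<integral>\<^sup>+q. indicator {0<..} q * (ennreal q * section_limit t q) \<partial>lborel)" for t
  proof (rule nn_integral_dominated_convergence[where w = "\<lambda>q. indicator {0<..} q * (ennreal q * section_majorant c q)"])
    show "(\<integral>\<^sup>+q. indicator {0<..} q * (ennreal q * section_majorant c q) \<partial>lborel) < \<infinity>" using W by (simp add: W_def)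
    show "AE q in lborel. indicator {0<..} q * (ennreal q * section_integral (n + 2) t q) \<le> indicator {0<..} q * (ennreal q * section_majorant c q)" for n
      by (intro AE_I2) (auto simp: indicator_def intro!: mult_left_mono section_integral_dominated fd)
    show "AE q in lborel. (\<lambda>n. indicator {0<..} q * (ennreal q * section_integral (n + 2) t q)) \<longlonglongrightarrow> indicator {0<..} q * (ennreal q * section_limit t q)"
      using AEfin
    proof eventually_elim
      case (elim q)
      show ?case
      proof (cases "q > 0")
        case True
        have "section_majorant c q < \<infinity>"
          using elim True by (auto simp: ennreal_mult_eq_top_iff less_top)
        then have "(\<lambda>n. section_integral (n + 2) t q) \<longlonglongrightarrow> section_limit t q" by (intro section_integral_limit[OF True fd[OF True]])
        then have "(\<lambda>n. ennreal q * section_integral (n + 2) t q) \<longlonglongrightarrow> ennreal q * section_limit t q"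
          by (intro ennreal_tendsto_cmult) auto
        then show ?thesis using True by simp
      qed simp
    qed
  qed measurable
  have lim: "(\<integral>\<^sup>+q. indicator {0<..} q * (ennreal q * section_limit t q) \<partial>lborel) =
      ennreal ((\<kappa> t - \<mu> t) / \<kappa> t * (4 / 3 * (2 / (\<kappa> t - \<mu> t)) powr (3/2) * (2 / 3 * cap_rate t powr (-5/3) * Gamma (5/3))))" for t
    unfolding section_limit_def limit_integrand_def by (rule limit_integral[OF curvature_order(2,1,3)])
  have "(\<lambda>n. \<integral>\<^sup>+t. indicator {0<..<2*pi} t * (\<integral>\<^sup>+q. indicator {0<..} q * (ennreal q * section_integral (n + 2) t q) \<partial>lborel) \<partial>lborel) \<longlonglongrightarrow>
    (\<integral>\<^sup>+t. indicator {0<..<2*pi} t * (\<integral>\<^sup>+q. indicator {0<..} q * (ennreal q * section_limit t q) \<partial>lborel) \<partial>lborel)"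
  proof (rule nn_integral_dominated_convergence[where w = "\<lambda>t. indicator {0<..<2*pi} t * W"])
    show "AE t in lborel. indicator {0<..<2*pi} t * (\<integral>\<^sup>+q. indicator {0<..} q * (ennreal q * section_integral (n + 2) t q) \<partial>lborel) \<le> indicator {0<..<2*pi} t * W" for n
    proof (intro AE_I2 mult_left_mono)
      fix t
      show "(\<integral>\<^sup>+q. indicator {0<..} q * (ennreal q * section_integral (n + 2) t q) \<partial>lborel) \<le> W"
        unfolding W_def by (intro nn_integral_mono) (auto simp: indicator_def intro!: mult_left_mono section_integral_dominated fd)
    qed simp
    have "(\<integral>\<^sup>+t. indicator {0<..<2*pi} t * W \<partial>lborel) = emeasure lborel {0<..<2*pi} * W"
      by (simp add: nn_integral_multc)
    also have "\<dots> < \<infinity>" using W by (simp add: ennreal_mult_less_top)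
    finally show "(\<integral>\<^sup>+t. indicator {0<..<2*pi} t * W \<partial>lborel) < \<infinity>" .
    show "AE t in lborel. (\<lambda>n. indicator {0<..<2*pi} t * (\<integral>\<^sup>+q. indicator {0<..} q * (ennreal q * section_integral (n + 2) t q) \<partial>lborel)) \<longlonglongrightarrow>
      indicator {0<..<2*pi} t * (\<integral>\<^sup>+q. indicator {0<..} q * (ennreal q * section_limit t q) \<partial>lborel)"
      using inner by (intro AE_I2) (auto simp: indicator_def)
    show "(\<lambda>t. indicator {0<..<2*pi} t * (\<integral>\<^sup>+q. indicator {0<..} q * (ennreal q * section_integral (n + 2) t q) \<partial>lborel)) \<in> borel_measurable lborel" for n
      by measurable
    note meas = this
    \<comment> \<open>Measurability of the limit in \<open>t\<close> is inherited from the
      approximating integrals.\<close>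
    show "(\<lambda>t. indicator {0<..<2*pi} t * (\<integral>\<^sup>+q. indicator {0<..} q * (ennreal q * section_limit t q) \<partial>lborel)) \<in> borel_measurable lborel"
      by (rule borel_measurable_LIMSEQ_order[OF _ meas]) (use inner in \<open>auto simp: indicator_def\<close>)
  qed measurable
  then show ?thesis unfolding lim by (rule LIMSEQ_offset)
qed

text \<open>\<open>y\<close> is taken in the frame at \<open>k t\<close>, the point whose tangent is
  parallel to the chord. The frame contributes \<open>d n ^ 3\<close> and the radial measure
  \<open>r dr\<close> contributes \<open>d n ^ 2\<close>.\<close>

lemma rescale_integral:
  assumes n: "n \<ge> 1"
  shows "(\<integral>\<^sup>+y. \<integral>\<^sup>+x. indicator K y * indicator K x * ennreal (g (y - Z (x - y)) ^ (n - 1)) \<partial>lborel \<partial>lborel) =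
    ennreal (d n ^ 5) * (\<integral>\<^sup>+t. indicator {0<..<2*pi} t * (\<integral>\<^sup>+q. indicator {0<..} q * (ennreal q * section_integral n t q) \<partial>lborel) \<partial>lborel)"
proof -
  note dn = d_pos[of n]
  define Q where "Q = (\<lambda>w. \<integral>\<^sup>+y. indicator K y * indicator K (y + w) * ennreal (g (y - Z w) ^ (n - 1)) \<partial>lborel)"
  have [measurable]: "Q \<in> borel_measurable borel" unfolding Q_def by measurable
  have "(\<integral>\<^sup>+y. \<integral>\<^sup>+x. indicator K y * indicator K x * ennreal (g (y - Z (x - y)) ^ (n - 1)) \<partial>lborel \<partial>lborel)
      = (\<integral>\<^sup>+y. \<integral>\<^sup>+w. indicator K y * indicator K (y + w) * ennreal (g (y - Z w) ^ (n - 1)) \<partial>lborel \<partial>lborel)"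
  proof (rule nn_integral_cong)
    fix y :: "real^2"
    have "(\<integral>\<^sup>+x. indicator K y * indicator K x * ennreal (g (y - Z (x - y)) ^ (n - 1)) \<partial>lborel)
       = (\<integral>\<^sup>+x. indicator K y * indicator K x * ennreal (g (y - Z (x - y)) ^ (n - 1)) \<partial>distr lborel borel ((+) y))"
      by (simp add: lborel_distr_plus)
    also have "\<dots> = (\<integral>\<^sup>+w. indicator K y * indicator K (y + w) * ennreal (g (y - Z w) ^ (n - 1)) \<partial>lborel)"
      by (subst nn_integral_distr) auto
    finally show "(\<integral>\<^sup>+x. indicator K y * indicator K x * ennreal (g (y - Z (x - y)) ^ (n - 1)) \<partial>lborel)
       = (\<integral>\<^sup>+w. indicator K y * indicator K (y + w) * ennreal (g (y - Z w) ^ (n - 1)) \<partial>lborel)" .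
  qed
  also have "\<dots> = (\<integral>\<^sup>+w. Q w \<partial>lborel)"
    unfolding Q_def by (intro lborel_pair.Fubini') measurable
  also have "\<dots> = (\<integral>\<^sup>+t. indicator {0<..<2*pi} t * (\<integral>\<^sup>+r. indicator {0<..} r * (ennreal r * Q (r *\<^sub>R tau t)) \<partial>lborel) \<partial>lborel)"
    by (rule nn_integral_polar) measurable
  also have "\<dots> = (\<integral>\<^sup>+t. ennreal (d n ^ 5) * (indicator {0<..<2*pi} t * (\<integral>\<^sup>+q. indicator {0<..} q * (ennreal q * section_integral n t q) \<partial>lborel)) \<partial>lborel)"
  proof (rule nn_integral_cong)
    fix t :: real
    have QH: "Q ((d n * q) *\<^sub>R tau t) = ennreal (d n ^ 3) * section_integral n t q" for q
    proof -
      have "Q ((d n * q) *\<^sub>R tau t) = ennreal (d n ^ 3) * (\<integral>\<^sup>+b. \<integral>\<^sup>+a.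
          (\<lambda>y. indicator K y * indicator K (y + (d n * q) *\<^sub>R tau t) * ennreal (g (y - Z ((d n * q) *\<^sub>R tau t)) ^ (n - 1)))
          (k t + (d n * a) *\<^sub>R tau t - ((d n)\<^sup>2 * b) *\<^sub>R nu t) \<partial>lborel \<partial>lborel)"
        unfolding Q_def by (rule nn_integral_frame[OF _ dn]) measurable
      also have "\<dots> = ennreal (d n ^ 3) * section_integral n t q"
        unfolding section_integral_def rescaled_integrand_def K.pt_def[symmetric] K.pt_add distrib_left by simp
      finally show ?thesis .
    qed
    have "(\<integral>\<^sup>+r. indicator {0<..} r * (ennreal r * Q (r *\<^sub>R tau t)) \<partial>lborel)
        = ennreal \<bar>d n\<bar> * (\<integral>\<^sup>+q. indicator {0<..} (0 + d n * q) * (ennreal (0 + d n * q) * Q ((0 + d n * q) *\<^sub>R tau t)) \<partial>lborel)"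
      using dn by (intro nn_integral_real_affine) auto
    also have "\<dots> = ennreal (d n) * (\<integral>\<^sup>+q. ennreal (d n ^ 4) * (indicator {0<..} q * (ennreal q * section_integral n t q)) \<partial>lborel)"
    proof -
      have "indicator {0<..} (0 + d n * q) * (ennreal (0 + d n * q) * Q ((0 + d n * q) *\<^sub>R tau t))
          = ennreal (d n ^ 4) * (indicator {0<..} q * (ennreal q * section_integral n t q))" for q
      proof (cases "q > 0")
        case True
        have "ennreal (d n * q) * (ennreal (d n ^ 3) * section_integral n t q) = ennreal (d n * q * d n ^ 3) * section_integral n t q"
          using dn True by (simp add: ennreal_mult mult.assoc)
        also have "d n * q * d n ^ 3 = d n ^ 4 * q" by (simp add: power4_eq_xxxx power3_eq_cube)
        finally show ?thesis using True dn by (simp add: QH ennreal_mult mult.assoc)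
      next
        case False
        then show ?thesis using dn by (simp add: zero_less_mult_iff)
      qed
      then show ?thesis using dn by simp
    qed
    also have "\<dots> = ennreal (d n) * (ennreal (d n ^ 4) * (\<integral>\<^sup>+q. indicator {0<..} q * (ennreal q * section_integral n t q) \<partial>lborel))"
      by (subst nn_integral_cmult) auto
    also have "\<dots> = ennreal (d n ^ 5) * (\<integral>\<^sup>+q. indicator {0<..} q * (ennreal q * section_integral n t q) \<partial>lborel)"
      using dn by (simp add: mult.assoc[symmetric] ennreal_mult[symmetric] eval_nat_numeral)
    finally show "indicator {0<..<2*pi} t * (\<integral>\<^sup>+r. indicator {0<..} r * (ennreal r * Q (r *\<^sub>R tau t)) \<partial>lborel)
      = ennreal (d n ^ 5) * (indicator {0<..<2*pi} t * (\<integral>\<^sup>+q. indicator {0<..} q * (ennreal q * section_integral n t q) \<partial>lborel))"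
      by (simp only: mult.left_commute)
  qed
  also have "\<dots> = ennreal (d n ^ 5) * (\<integral>\<^sup>+t. indicator {0<..<2*pi} t * (\<integral>\<^sup>+q. indicator {0<..} q * (ennreal q * section_integral n t q) \<partial>lborel) \<partial>lborel)"
    by (intro nn_integral_cmult) measurable
  finally show ?thesis .
qed

text \<open>With \<open>u = 2 / D\<close>, the product
  \<open>D * u powr (3/2) * u powr (-5/6)\<close> is a multiple of \<open>D powr (1/3)\<close>, and
  \<open>A powr (5/3)\<close> splits into \<open>A\<close> and \<open>A powr (2/3)\<close>.
  Logarithms make the identity linear.\<close>

lemma limit_constant:
  "(\<kappa> t - \<mu> t) / \<kappa> t * (4 / 3 * (2 / (\<kappa> t - \<mu> t)) powr (3/2) * (2 / 3 * cap_rate t powr (-5/3) * Gamma (5/3)))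
    = A * (root 3 (2 * A\<^sup>2 / 3) * Gamma (5/3)) * ((\<kappa> t - \<mu> t) powr (1/3) / \<kappa> t)"
proof -
  define D where "D = \<kappa> t - \<mu> t"
  have D: "D > 0" using curvature_order[of t] by (simp add: D_def)
  define u where "u = 2 / D"
  have u: "u > 0" using D by (simp add: u_def)
  have c: "cap_rate t = 4 / (3 * A) * u powr (1/2)"
    using u by (simp add: cap_rate_def D_def[symmetric] u_def[symmetric] powr_half_sqrt)
  have "cap_rate t powr (-5/3) = (4 / (3 * A)) powr (-5/3) * (u powr (1/2)) powr (-5/3)"
    unfolding c by (rule powr_mult)
  also have "(u powr (1/2)) powr (-5/3) = u powr (-5/6)" by (simp add: powr_powr)
  also have "(4 / (3 * A)) powr (-5/3) = (3 * A / 4) powr (5/3)"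
    using A_pos by (simp add: powr_minus powr_divide inverse_eq_divide)
  finally have c': "cap_rate t powr (-5/3) = (3 * A / 4) powr (5/3) * u powr (-5/6)" .
  have "root 3 (2 * A\<^sup>2 / 3) = (2 * A\<^sup>2 / 3) powr (1/3)"
    using A_pos by (simp add: root_powr_inverse)
  have D': "D = 2 / u" using D by (simp add: u_def)
  have F: "D * (4 / 3 * u powr (3/2) * (2 / 3 * ((3 * A / 4) powr (5/3) * u powr (-5/6))))
      = A * root 3 (2 * A\<^sup>2 / 3) * D powr (1/3)"
  proof -
    have l2: "ln (2 * A\<^sup>2 / 3) = ln 2 + 2 * ln A - ln 3"
      using A_pos by (simp add: ln_mult ln_div ln_realpow)
    have l3: "ln (3 * A / 4) = ln 3 + ln A - 2 * ln 2"
    proof -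
      have "ln (4 :: real) = ln (2 ^ 2)" by simp
      then have "ln (4 :: real) = 2 * ln 2" by (simp only: ln_realpow)
      then show ?thesis using A_pos by (simp add: ln_mult ln_div)
    qed
    have "ln (8 / 9 :: real) = 3 * ln 2 - 2 * ln 3"
    proof -
      have "ln (8 :: real) = ln (2 ^ 3)" "ln (9 :: real) = ln (3 ^ 2)" by simp_all
      then have "ln (8 :: real) = 3 * ln 2" "ln (9 :: real) = 2 * ln 3" by (simp_all only: ln_realpow)
      then show ?thesis by (simp add: ln_div)
    qed
    moreover have "ln D = ln 2 - ln u" unfolding D' using u by (simp add: ln_div)
    ultimately have "ln D + ln (8 / 9) + 3 / 2 * ln u + 5 / 3 * ln (3 * A / 4) + (-5/6) * ln u
        = ln A + 1 / 3 * ln (2 * A\<^sup>2 / 3) + 1 / 3 * ln D"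
      using l2 l3 by (simp add: field_simps)
    then have "exp (ln D + ln (8 / 9) + 3 / 2 * ln u + 5 / 3 * ln (3 * A / 4) + (-5/6) * ln u)
        = exp (ln A + 1 / 3 * ln (2 * A\<^sup>2 / 3) + 1 / 3 * ln D)" by simp
    then have "D * (8 / 9) * u powr (3/2) * (3 * A / 4) powr (5/3) * u powr (-5/6) = A * (2 * A\<^sup>2 / 3) powr (1/3) * D powr (1/3)"
      using D u A_pos by (simp only: exp_add) (simp add: powr_def)
    then show ?thesis
      using \<open>root 3 (2 * A\<^sup>2 / 3) = (2 * A\<^sup>2 / 3) powr (1/3)\<close> by simp
  qed
  have "D / \<kappa> t * (4 / 3 * u powr (3/2) * (2 / 3 * ((3 * A / 4) powr (5/3) * u powr (-5/6)) * Gamma (5/3)))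
      = (D * (4 / 3 * u powr (3/2) * (2 / 3 * ((3 * A / 4) powr (5/3) * u powr (-5/6))))) * (Gamma (5/3) / \<kappa> t)"
    by simp
  then show ?thesis
    unfolding D_def[symmetric] u_def[symmetric] c' F by simp
qed

definition scaled_integral :: "nat \<Rightarrow> ennreal" where
  "scaled_integral n = (\<integral>\<^sup>+t. indicator {0<..<2*pi} t * (\<integral>\<^sup>+q. indicator {0<..} q * (ennreal q * section_integral n t q) \<partial>lborel) \<partial>lborel)"

text \<open>The end points of the angular interval are null, so the open interval of the polar
  coordinates becomes the closed one of the arc length integral; continuity of the curvatures gives
  integrability.\<close>

lemma scaled_integral_limit:
  "scaled_integral \<longlonglongrightarrow> ennreal (A * (root 3 (2 * A\<^sup>2 / 3) * Gamma (5/3)) *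
     (LBINT t:{0..2*pi}. (\<kappa> t - \<mu> t) powr (1/3) / \<kappa> t))"
proof -
  define c where "c = A * (root 3 (2 * A\<^sup>2 / 3) * Gamma (5/3))"
  define \<psi> where "\<psi> = (\<lambda>t. (\<kappa> t - \<mu> t) powr (1/3) / \<kappa> t)"
  have c0: "c \<ge> 0" using A_pos by (simp add: c_def)
  have \<psi>0: "\<psi> t \<ge> 0" for t using curvature_order[of t] by (simp add: \<psi>_def)
  have cont: "continuous_on UNIV \<kappa>" "continuous_on UNIV \<mu>"
    unfolding \<kappa>_def \<mu>_def using K.r_pos L.r_pos
    by (auto intro!: continuous_intros K.r_cont L.r_cont simp: less_imp_neq[symmetric])
  have "continuous_on UNIV \<psi>"
    unfolding \<psi>_def using curvature_order
    by (intro continuous_intros cont) (metis less_irrefl less_trans diff_gt_0_iff_gt)+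
  then have int: "integrable lborel (\<lambda>t. indicator {0..2*pi} t *\<^sub>R \<psi> t)"
    by (intro borel_integrable_compact) (auto intro: continuous_on_subset)
  have "AE t in lborel. t \<notin> {0, 2 * pi}" by (rule AE_finite) simp
  then have "AE t in lborel. indicator {0<..<2*pi} t * ennreal (c * \<psi> t)
      = ennreal (c * (indicator {0..2*pi} t *\<^sub>R \<psi> t))"
    by eventually_elim (auto simp: indicator_def)
  then have "(\<integral>\<^sup>+t. indicator {0<..<2*pi} t * ennreal (c * \<psi> t) \<partial>lborel)
      = (\<integral>\<^sup>+t. ennreal (c * (indicator {0..2*pi} t *\<^sub>R \<psi> t)) \<partial>lborel)"
    by (rule nn_integral_cong_AE)
  also have "\<dots> = ennreal (\<integral>t. c * (indicator {0..2*pi} t *\<^sub>R \<psi> t) \<partial>lborel)"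
    by (rule nn_integral_eq_integral) (use int c0 \<psi>0 in auto)
  also have "(\<integral>t. c * (indicator {0..2*pi} t *\<^sub>R \<psi> t) \<partial>lborel) = c * (LBINT t:{0..2*pi}. \<psi> t)"
    unfolding set_lebesgue_integral_def by (rule integral_mult_right_zero)
  finally have *: "(\<integral>\<^sup>+t. indicator {0<..<2*pi} t * ennreal (c * \<psi> t) \<partial>lborel) = ennreal (c * (LBINT t:{0..2*pi}. \<psi> t))" .
  have "scaled_integral \<longlonglongrightarrow> (\<integral>\<^sup>+t. indicator {0<..<2*pi} t * ennreal (c * \<psi> t) \<partial>lborel)"
    using main_limit unfolding limit_constant scaled_integral_def[symmetric] c_def[symmetric] \<psi>_def .
  then show ?thesis unfolding * unfolding c_def \<psi>_def .
qed

end

text \<open>\<open>d n ^ 5\<close> equals \<open>real n powr (-5/3)\<close>, which cancels the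
  prefactor \<open>n\<close> and the normalization exactly and leaves \<open>1 / A\<close>.\<close>

lemma (in disc_sample) expectation_rescaled:
  "(\<integral>\<omega>. area (K - L_hull L ((\<lambda>i. X i \<omega>) ` {1..n})) \<partial>P) * real n powr (2/3) = enn2real (ennreal (1 / A) * scaled_integral n)"
proof -
  have n0: "real n > 0" using n by simp
  have "d n ^ 5 = real n powr (-5/3)"
  proof -
    have "d n ^ 5 = d n powr real 5" by (rule powr_realpow[symmetric, OF d_pos])
    then show ?thesis using n by (simp add: d_def max_def powr_powr)
  qed
  moreover have "real n * real n powr (-5/3) * real n powr (2/3) = 1"
  proof -
    have "real n * real n powr (-5/3) * real n powr (2/3) = real n powr 1 * real n powr (-5/3) * real n powr (2/3)"
      using n0 by simp
    also have "\<dots> = real n powr 0" unfolding powr_add[symmetric] by simp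
    finally show ?thesis using n0 by simp
  qed
  ultimately have *: "real n / A * d n ^ 5 * real n powr (2/3) = 1 / A"
    by (metis times_divide_eq_left mult.commute mult.left_commute)
  have split: "ennreal (real n / A * d n ^ 5) = ennreal (real n / A) * ennreal (d n ^ 5)"
    by (rule ennreal_mult) (use A_pos d_pos[of n] in simp_all)
  have "(\<integral>\<omega>. area (K - L_hull L ((\<lambda>i. X i \<omega>) ` {1..n})) \<partial>P) = enn2real (ennreal (real n / A * d n ^ 5) * scaled_integral n)"
    using expectation_eq unfolding nn_expectation rescale_integral[OF n] scaled_integral_def[symmetric] split
    unfolding I_def mult.assoc .
  then show ?thesis
    using A_pos d_pos[of n] *[symmetric] by (simp add: enn2real_mult)
qed

theorem corollary1p1:
  fixes K L :: "(real^2) set"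
    and P :: "'w measure"
    and X :: "nat \<Rightarrow> 'w \<Rightarrow> real^2"
  assumes "convex_disc K" and "C2_plus_boundary K"
    and "convex_disc L" and "C2_plus_boundary L"
    and "L_convex L K"
    and "(SUP x\<in>frontier L. boundary_curvature L x) < 1"
    and "1 < (INF y\<in>frontier K. boundary_curvature K y)"
    and "prob_space P"
    and "prob_space.indep_vars P (\<lambda>_. borel) X UNIV"
    and "\<And>i. distr P borel (X i) = uniform_measure lborel K"
  shows "(\<lambda>n. (\<integral>\<omega>. area (K - L_hull L ((\<lambda>i. X i \<omega>) ` {1..n})) \<partial>P) * real n powr (2/3))
           \<longlonglongrightarrow> root 3 (2 * (area K)\<^sup>2 / 3) * Gamma (5/3) *
               circle_integral (\<lambda>u. (normal_curvature K u - normal_curvature L u) powr (1/3)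
                                      / normal_curvature K u)"
proof -
  obtain k rK where K: "normal_disc K k rK" and cK: "\<And>t. boundary_curvature K (k t) = 1 / rK t"
    by (rule C2_plus_normal_disc[OF assms(1,2)]) blast
  obtain l rL where L: "normal_disc L l rL" and cL: "\<And>t. boundary_curvature L (l t) = 1 / rL t"
    by (rule C2_plus_normal_disc[OF assms(3,4)]) blast
  interpret K: normal_disc K k rK by (rule K)
  interpret L: normal_disc L l rL by (rule L)
  define sL where "sL = (SUP x\<in>frontier L. boundary_curvature L x)"
  define iK where "iK = (INF y\<in>frontier K. boundary_curvature K y)"
  have inv_rL: "1 / rL t \<le> sL" for t
  proof -
    obtain e where e: "e > 0" "\<And>t. e \<le> rL t" by (rule L.r_bounded_below) blast
    \<comment> \<open>The least radius of curvature bounds the curvature of \<open>L\<close>, so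
      that the supremum is an actual upper bound.\<close>
    have "bdd_above (boundary_curvature L ` frontier L)"
      by (rule bdd_aboveI[of _ "1 / e"]) (use e L.r_pos in \<open>auto simp: L.frontier_eq cL intro!: frac_le\<close>)
    then have "boundary_curvature L (l t) \<le> sL"
      unfolding sL_def by (intro cSUP_upper) (auto simp: L.frontier_eq)
    then show ?thesis by (simp add: cL)
  qed
  have inv_rK: "iK \<le> 1 / rK t" for t
  proof -
    have "bdd_below (boundary_curvature K ` frontier K)"
      by (rule bdd_belowI[of _ 0]) (use K.r_pos in \<open>auto simp: K.frontier_eq cK less_imp_le\<close>)
    then have "iK \<le> boundary_curvature K (k t)"
      unfolding iK_def by (intro cINF_lower) (auto simp: K.frontier_eq)
    then show ?thesis by (simp add: cK)
  qed
  have s: "0 < sL" "sL < 1" "1 < iK"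
    using inv_rL[of 0] L.r_pos[of 0] assms(6,7) by (auto simp: sL_def iK_def intro: less_le_trans[of 0 "1 / rL 0"])
  \<comment> \<open>The radii of the rolling discs are \<open>R = 1 / sL\<close> and
    \<open>\<rho> = 1 / iK\<close>, strictly ordered because \<open>sL < 1 < iK\<close>.\<close>
  have "1 / sL \<le> rL t" for t
    using inv_rL[of t] L.r_pos[of t] s by (simp add: field_simps)
  moreover have "rK t \<le> 1 / iK" for t
    using inv_rK[of t] K.r_pos[of t] s by (simp add: field_simps)
  moreover have "1 / iK < 1 / sL" using s by (intro frac_less2) auto
  ultimately interpret two_discs K k rK L l rL "1 / sL" "1 / iK"
    using s by unfold_locales auto
  have *: "(\<integral>\<omega>. area (K - L_hull L ((\<lambda>i. X i \<omega>) ` {1..n})) \<partial>P) * real n powr (2/3)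
      = enn2real (ennreal (1 / A) * scaled_integral n)" if "n \<ge> 1" for n
  proof -
    interpret disc_sample K k rK L l rL "1 / sL" "1 / iK" P X n
      using assms(8-10) that by (intro disc_sample.intro disc_sample_axioms.intro two_discs_axioms)
    show ?thesis by (rule expectation_rescaled)
  qed
  define J where "J = (LBINT t:{0..2*pi}. (\<kappa> t - \<mu> t) powr (1/3) / \<kappa> t)"
  have J0: "J \<ge> 0"
    unfolding J_def set_lebesgue_integral_def
    by (intro integral_nonneg_AE AE_I2) (use curvature_order less_imp_le in \<open>auto intro!: mult_nonneg_nonneg divide_nonneg_pos less_trans[OF curvature_order(1,2)]\<close>)
  have "circle_integral (\<lambda>u. (normal_curvature K u - normal_curvature L u) powr (1/3) / normal_curvature K u) = J"
    by (simp add: circle_integral_def J_def nu_def[symmetric] K.normal_curvature_eq L.normal_curvature_eq cK cL \<kappa>_def \<mu>_def)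
  moreover have "(\<lambda>n. enn2real (ennreal (1 / A) * scaled_integral n)) \<longlonglongrightarrow> root 3 (2 * A\<^sup>2 / 3) * Gamma (5/3) * J"
  proof -
    have "(\<lambda>n. ennreal (1 / A) * scaled_integral n) \<longlonglongrightarrow> ennreal (1 / A) * ennreal (A * (root 3 (2 * A\<^sup>2 / 3) * Gamma (5/3)) * J)"
      using scaled_integral_limit unfolding J_def by (intro ennreal_tendsto_cmult) auto
    also have "ennreal (1 / A) * ennreal (A * (root 3 (2 * A\<^sup>2 / 3) * Gamma (5/3)) * J) = ennreal (root 3 (2 * A\<^sup>2 / 3) * Gamma (5/3) * J)"
      using A_pos by (subst ennreal_mult'[symmetric]) (auto simp: mult.assoc)
    finally show ?thesis by (rule tendsto_enn2real) (use A_pos J0 in auto)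
  qed
  then have "(\<lambda>n. (\<integral>\<omega>. area (K - L_hull L ((\<lambda>i. X i \<omega>) ` {1..n})) \<partial>P) * real n powr (2/3))
      \<longlonglongrightarrow> root 3 (2 * A\<^sup>2 / 3) * Gamma (5/3) * J"
    by (rule Lim_transform_eventually) (rule eventually_mono[OF eventually_ge_at_top[of 1]], rule *[symmetric])
  ultimately show ?thesis by (simp add: A_def)
qed

end
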